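(* For every constant $c>0$ there exists an increasing sequence of real numbers $(x_n)_{n\ge1}$ with $x_{n+1}-x_n\ge1$ for all $n$, such that, with $\gamma_N=\frac{\log N\,(\log\log N)^{1+c}}{N}$, $E_{N,\gamma_N}\gg N^3$, and such that for Lebesgue-almost every $\alpha\in\mathbb{R}$ the sequence $(\alpha x_n)_{n\ge1}$ has Poissonian $k$-level correlation for every integer $k\ge2$.
   Context: For a real sequence $(x_n)$, $N\ge1$ and $\gamma>0$, the additive energy at scale $\gamma$ is $E_{N,\gamma}=\#\{1\le a,b,c,d\le N : |x_a+x_b-x_c-x_d|<\gamma\}$. For an integer $k\ge2$, let $\mathcal{X}_k(N)$ be the set of $k$-tuples $(a_1,\dots,a_k)$ of distinct integers in $\{1,\dots,N\}$. For $s=(s_1,\dots,s_{2k-2})\in\mathbb{R}^{2k-2}$ with $s_{2i-1}<s_{2i}$ for $1\le i<k$, let $\mathbb{1}_{s,N}(y_1,\dots,y_{k-1})$ be the indicator that for each $i$, $y_i$ lies modulo 1 in the interval $[s_{2i-1}/N,s_{2i}/N]$ (i.e. $y_i\in[s_{2i-1}/N,s_{2i}/N]+\mathbb{Z}$). A real sequence $(y_n)$ has Poissonian $k$-level correlation if for every such $s$, $$\lim_{N\to\infty}\frac1N\sum_{a\in\mathcal{X}_k(N)}\mathbb{1}_{s,N}(y_{a_1}-y_{a_2},y_{a_1}-y_{a_3},\dots,y_{a_1}-y_{a_k})=\prod_{i=1}^{k-1}(s_{2i}-s_{2i-1}).$$ *)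

theory Defs
  imports "HOL-Analysis.Analysis"
begin

definition additive_energy :: "(nat \<Rightarrow> real) \<Rightarrow> nat \<Rightarrow> real \<Rightarrow> nat" where
  "additive_energy x N \<gamma> =
     card {(a, b, c, d). a \<in> {1..N} \<and> b \<in> {1..N} \<and> c \<in> {1..N} \<and> d \<in> {1..N}
                        \<and> \<bar>x a + x b - x c - x d\<bar> < \<gamma>}"

definition gammaN :: "real \<Rightarrow> nat \<Rightarrow> real" where
  "gammaN c N = ln (real N) * (ln (ln (real N))) powr (1 + c) / real N"

text \<open>k-tuples of distinct integers in {1..N}, as lists (a_1,...,a_k) = [as!0, ..., as!(k-1)].\<close>
definition tuples :: "nat \<Rightarrow> nat \<Rightarrow> nat list set" where
  "tuples k N = {as. length as = k \<and> distinct as \<and> set as \<subseteq> {1..N}}"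

definition in_mod1 :: "real \<Rightarrow> real \<Rightarrow> real \<Rightarrow> bool" where
  "in_mod1 y lo hi \<longleftrightarrow> (\<exists>m::int. lo \<le> y - of_int m \<and> y - of_int m \<le> hi)"

definition admissible :: "nat \<Rightarrow> (nat \<Rightarrow> real) \<Rightarrow> bool" where
  "admissible k s \<longleftrightarrow> (\<forall>i. 1 \<le> i \<and> i < k \<longrightarrow> s (2*i - 1) < s (2*i))"

definition corr_count :: "nat \<Rightarrow> (nat \<Rightarrow> real) \<Rightarrow> (nat \<Rightarrow> real) \<Rightarrow> nat \<Rightarrow> nat" where
  "corr_count k y s N = card {as \<in> tuples k N.
      \<forall>i\<in>{1..k-1}. in_mod1 (y (as ! 0) - y (as ! i)) (s (2*i - 1) / real N) (s (2*i) / real N)}"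

definition poissonian_corr :: "nat \<Rightarrow> (nat \<Rightarrow> real) \<Rightarrow> bool" where
  "poissonian_corr k y \<longleftrightarrow>
     (\<forall>s. admissible k s \<longrightarrow>
        (\<lambda>N. real (corr_count k y s N) / real N)
          \<longlonglongrightarrow> (\<Prod>i\<in>{1..k-1}. s (2*i) - s (2*i - 1)))"

end

theory Submission
  imports Defs "HOL-Probability.Probability" "HOL-Real_Asymp.Real_Asymp"
begin

text \<open>Take \<open>x n = 2 n + G j u n\<close> for \<open>2 ^ j \<le> n < 2 ^ (j + 1)\<close>, with independent \<open>u n\<close> uniform in
  \<open>[0, 1]\<close> and \<open>G j\<close> slightly smaller than \<open>gammaN\<close> at \<open>2 ^ j\<close>. Inside a dyadic block this is an
  arithmetic progression up to an error below \<open>gammaN\<close>, so the energy is cubic.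

  For almost every \<open>\<alpha>\<close> the convergence half of Khinchin's theorem bounds the distance of \<open>2 q \<alpha>\<close> from the
  integers from below, so Dirichlet's theorem at level \<open>\<eta> N\<close> returns a denominator \<open>q\<close> that is not much
  smaller than \<open>N\<close>. Cutting the rotation into periods of length \<open>q\<close> shows that the points \<open>2 \<alpha> n\<close> with
  \<open>n \<le> N\<close> are equidistributed in arcs of length \<open>\<alpha> G j\<close>. Hence, whatever the position of one point,
  the expected number of the other perturbed points in an arc of length \<open>t / N\<close> next to it tends to \<open>t\<close>,
  and integrating out one perturbation at a time yields the expected correlation sums. Disjoint tuples are
  independent, so the normalised sums have variance \<open>O(1 / N)\<close> and converge almost surely along squares;
  monotonicity fills the gaps. Fubini's theorem finally exchanges almost every \<open>\<alpha>\<close> and almost every \<open>u\<close>.\<close>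

section \<open>Points of a rotation in short arcs\<close>

text \<open>The window for \<open>G\<close> is forced from both sides. Counting a rotation period by
  period costs O(1) per period. With \<open>q\<close> at least about N / \<psi>(N) there are
  O(\<psi>(N)) periods up to N, so the total error is O(\<psi>(N)), negligible against the main term
  N G only if N G / \<psi>(N) tends to infinity. Almost every number is of type \<psi> once the sum
  of 1 / (q \<psi>(q)) converges, and log q (log log q)^(1 + e) achieves this for every e > 0. Since
  N times \<open>gammaN\<close> is log N (log log N)^(1 + c), every c > 0 leaves room for
  \<open>G\<close> between the two. Arcs of length \<alpha> G shrink, yet hold more and more
  rotation points. Smearing each point over such an arc therefore hides the rigid gap structure of
  the progression at scale 1 / N, while its additive structure at scale \<open>gammaN\<close>
  survives. \<open>G\<close> is constant on dyadic blocks so that one arc length serves a whole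
  block, and the slope 2 leaves room for perturbing without pushing gaps below 1.\<close>

lemma in_mod1_add:
  assumes "in_mod1 y lo hi" "lo' \<le> e" "e \<le> hi'"
  shows "in_mod1 (y + e) (lo + lo') (hi + hi')"
proof -
  obtain m :: int where "lo \<le> y - of_int m" "y - of_int m \<le> hi"
    using assms(1) unfolding in_mod1_def by blast
  with assms(2,3) show ?thesis unfolding in_mod1_def by (intro exI[of _ m]) auto
qed

lemma in_mod1_add2:
  assumes "in_mod1 y lo hi" "in_mod1 y' lo' hi'"
  shows "in_mod1 (y + y') (lo + lo') (hi + hi')"
proof -
  obtain m m' :: int where "lo \<le> y - of_int m" "y - of_int m \<le> hi" "lo' \<le> y' - of_int m'" "y' - of_int m' \<le> hi'"
    using assms unfolding in_mod1_def by blast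
  then show ?thesis unfolding in_mod1_def by (intro exI[of _ "m + m'"]) auto
qed

lemma in_mod1_uminus: "in_mod1 (- y) lo hi \<longleftrightarrow> in_mod1 y (- hi) (- lo)"
proof -
  have "in_mod1 (- y) lo hi" if as: "in_mod1 y (- hi) (- lo)" for y lo hi
  proof -
    obtain m :: int where "- hi \<le> y - of_int m" "y - of_int m \<le> - lo"
      using as unfolding in_mod1_def by blast
    then show ?thesis unfolding in_mod1_def by (intro exI[of _ "- m"]) auto
  qed
  from this[of y hi lo] this[of "- y" "- lo" "- hi"] show ?thesis by auto
qed

lemma in_mod1_mono: "in_mod1 y lo hi \<Longrightarrow> lo' \<le> lo \<Longrightarrow> hi \<le> hi' \<Longrightarrow> in_mod1 y lo' hi'"
  unfolding in_mod1_def by (meson order_trans)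

section \<open>One period of a rational rotation\<close>

lemma card_int_interval_bounds:
  fixes a b :: real
  shows "b - a - 1 \<le> real (card {\<lceil>a\<rceil>..\<lfloor>b\<rfloor>})"
    and "a \<le> b \<Longrightarrow> real (card {\<lceil>a\<rceil>..\<lfloor>b\<rfloor>}) \<le> b - a + 1"
proof -
  show "b - a - 1 \<le> real (card {\<lceil>a\<rceil>..\<lfloor>b\<rfloor>})" by simp linarith
  show "a \<le> b \<Longrightarrow> real (card {\<lceil>a\<rceil>..\<lfloor>b\<rfloor>}) \<le> b - a + 1" by simp linarith
qed

text \<open>Since \<open>p\<close> is invertible modulo \<open>q\<close>, the points r p / q modulo
  1 are the fractions t / q in another order. Choosing one lift \<open>t r\<close> in [q lo, q hi]
  for each \<open>r\<close> is injective, so at most the integers of that interval are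
  counted.\<close>

lemma card_residues_in_arc_le:
  fixes p :: int and q :: nat
  assumes q: "q > 0" and cop: "coprime p (int q)" and le: "lo \<le> hi"
  shows "real (card {r. r < q \<and> in_mod1 (real r * of_int p / real q) lo hi}) \<le> real q * (hi - lo) + 1"
proof -
  let ?R = "{r. r < q \<and> in_mod1 (real r * of_int p / real q) lo hi}"
  have "\<forall>r\<in>?R. \<exists>m::int. lo \<le> real r * of_int p / real q - of_int m
          \<and> real r * of_int p / real q - of_int m \<le> hi"
    unfolding in_mod1_def by blast
  from bchoice[OF this] obtain m :: "nat \<Rightarrow> int" where m: "\<forall>r\<in>?R. lo \<le> real r * of_int p / real q - of_int (m r)
          \<and> real r * of_int p / real q - of_int (m r) \<le> hi" ..
  define t where "t = (\<lambda>r. int r * p - m r * int q)"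
  have "t ` ?R \<subseteq> {\<lceil>real q * lo\<rceil>..\<lfloor>real q * hi\<rfloor>}"
  proof (clarify)
    fix r assume "r < q" "in_mod1 (real r * of_int p / real q) lo hi"
    then have "lo \<le> real r * of_int p / real q - of_int (m r)" "real r * of_int p / real q - of_int (m r) \<le> hi"
      using m by auto
    then have "real q * lo \<le> of_int (t r)" "of_int (t r) \<le> real q * hi"
      using q unfolding t_def by (auto simp: field_simps)
    then show "t r \<in> {\<lceil>real q * lo\<rceil>..\<lfloor>real q * hi\<rfloor>}"
      by (auto simp: ceiling_le_iff le_floor_iff)
  qed
  moreover have "inj_on t ?R"
  proof (rule inj_onI)
    fix r r' assume r: "r \<in> ?R" "r' \<in> ?R" "t r = t r'"
    then have "(int r - int r') * p = (m r - m r') * int q"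
      unfolding t_def by (simp add: algebra_simps)
    then have "int q dvd (int r - int r') * p" by simp
    then have "int q dvd (int r - int r')"
      using cop by (simp add: coprime_commute coprime_dvd_mult_left_iff)
    moreover have "\<bar>int r - int r'\<bar> < int q" using r by auto
    ultimately have "int r - int r' = 0"
      by (metis abs_of_nat dvd_imp_le_int linorder_not_less)
    then show "r = r'" by simp
  qed
  ultimately have "card ?R \<le> card {\<lceil>real q * lo\<rceil>..\<lfloor>real q * hi\<rfloor>}"
    by (intro card_inj_on_le[of t]) auto
  also have "real \<dots> \<le> real q * hi - real q * lo + 1"
    using le by (intro card_int_interval_bounds) (auto intro: mult_left_mono)
  finally show ?thesis by (simp add: algebra_simps)
qed

lemma card_residues_in_arc_ge:
  fixes p :: int and q :: nat
  assumes q: "q > 0" and cop: "coprime p (int q)" and less: "hi - lo < 1"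
  shows "real q * (hi - lo) - 1 \<le> real (card {r. r < q \<and> in_mod1 (real r * of_int p / real q) lo hi})"
proof -
  let ?R = "{r. r < q \<and> in_mod1 (real r * of_int p / real q) lo hi}"
  let ?T = "{\<lceil>real q * lo\<rceil>..\<lfloor>real q * hi\<rfloor>}"
  obtain u v :: int where uv: "u * p + v * int q = 1"
    using bezout_int[of p "int q"] cop by auto
  define r where "r = (\<lambda>t::int. nat ((t * u) mod int q))"
  have r: "\<exists>n. int (r t) * p = t + n * int q" for t
  proof
    have "int (r t) = t * u - (t * u) div int q * int q"
      unfolding r_def using q by (simp add: minus_div_mult_eq_mod)
    then have "int (r t) * p = (t * u - (t * u) div int q * int q) * p" by (simp only:)
    also have "\<dots> = t * (u * p) - (t * u) div int q * int q * p" by (simp only: left_diff_distrib mult.assoc)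
    also have "u * p = 1 - v * int q" using uv by simp
    finally show "int (r t) * p = t + (- t * v - (t * u) div int q * p) * int q"
      by (simp add: algebra_simps)
  qed
  have "r ` ?T \<subseteq> ?R"
  proof clarify
    fix t assume t: "t \<in> ?T"
    then have t': "real q * lo \<le> of_int t" "of_int t \<le> real q * hi"
      by (auto simp: ceiling_le_iff le_floor_iff)
    obtain n where n: "int (r t) * p = t + n * int q" using r by blast
    then have "real (r t) * of_int p = of_int t + of_int n * real q"
      by (metis of_int_add of_int_mult of_int_of_nat_eq)
    then have "real (r t) * of_int p / real q - of_int n = of_int t / real q"
      using q by (simp add: field_simps)
    moreover have "lo \<le> of_int t / real q" "of_int t / real q \<le> hi"
      using t' q by (auto simp: field_simps)
    ultimately have "in_mod1 (real (r t) * of_int p / real q) lo hi"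
      unfolding in_mod1_def by (intro exI[of _ n]) simp
    moreover have "r t < q" unfolding r_def using q by (simp add: nat_less_iff)
    ultimately show "r t < q \<and> in_mod1 (real (r t) * of_int p / real q) lo hi" by blast
  qed
  moreover have "inj_on r ?T"
  proof (rule inj_onI)
    fix t t' assume t: "t \<in> ?T" "t' \<in> ?T" "r t = r t'"
    obtain n n' where "int (r t) * p = t + n * int q" "int (r t') * p = t' + n' * int q" using r by blast
    with t(3) have "t - t' = (n' - n) * int q" by (simp add: algebra_simps)
    then have dvd: "int q dvd t - t'" by simp
    have "real q * hi - real q * lo < real q" using less q
      by (metis mult.right_neutral mult_less_cancel_left_pos of_nat_0_less_iff right_diff_distrib)
    moreover have "real q * lo \<le> of_int t" "of_int t \<le> real q * hi" "real q * lo \<le> of_int t'" "of_int t' \<le> real q * hi"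
      using t by (auto simp: ceiling_le_iff le_floor_iff)
    ultimately have "\<bar>real_of_int (t - t')\<bar> < real q" by auto
    then have "\<bar>t - t'\<bar> < int q" by linarith
    with dvd have "t - t' = 0"
      by (metis abs_of_nat dvd_imp_le_int linorder_not_less)
    then show "t = t'" by simp
  qed
  ultimately have "card ?T \<le> card ?R"
    by (intro card_inj_on_le[of r]) auto
  moreover have "real q * hi - real q * lo - 1 \<le> real (card ?T)"
    by (rule card_int_interval_bounds)
  ultimately show ?thesis by (simp add: algebra_simps)
qed

text \<open>Within one period, replacing \<open>\<beta>\<close> by p / q moves every point by less
  than 1 / Q. The count thus lies between the exact counts for the arc shrunk and enlarged by 1 / Q
  at both ends, which differ from q l by at most 2 q / Q + 1.\<close>

lemma card_rotation_period:
  fixes \<beta> w l :: real and p :: int and q :: nat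
  assumes q: "q > 0" "q \<le> Q" and cop: "coprime p (int q)"
    and approx: "\<bar>real q * \<beta> - of_int p\<bar> < 1 / real Q" and l: "0 \<le> l" "l < 1"
  shows "\<bar>real (card {b\<in>{m..<m+q}. in_mod1 (w - \<beta> * real b) 0 l}) - real q * l\<bar> \<le> 2 * real q / real Q + 1"
proof -
  have Q0: "0 \<le> 1 / real Q" by simp
  define w' where "w' = w - \<beta> * real m"
  let ?R = "{r. r < q \<and> in_mod1 (w' - \<beta> * real r) 0 l}"
  have "{b\<in>{m..<m+q}. in_mod1 (w - \<beta> * real b) 0 l} = (\<lambda>r. m + r) ` ?R"
  proof (intro set_eqI iffI)
    fix b assume "b \<in> {b\<in>{m..<m+q}. in_mod1 (w - \<beta> * real b) 0 l}"
    then show "b \<in> (\<lambda>r. m + r) ` ?R"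
      by (intro image_eqI[of _ _ "b - m"]) (auto simp: w'_def algebra_simps of_nat_diff)
  qed (auto simp: w'_def algebra_simps)
  then have card: "card {b\<in>{m..<m+q}. in_mod1 (w - \<beta> * real b) 0 l} = card ?R"
    by (simp add: card_image)
  define e where "e = (\<lambda>r::nat. real r * (real q * \<beta> - of_int p) / real q)"
  have e: "- (1 / real Q) \<le> e r" "e r \<le> 1 / real Q" if "r < q" for r
  proof -
    have "\<bar>e r\<bar> = (real r / real q) * \<bar>real q * \<beta> - of_int p\<bar>" by (simp add: e_def abs_mult)
    also have "\<dots> \<le> 1 * (1 / real Q)" using that approx by (intro mult_mono) auto
    finally show "- (1 / real Q) \<le> e r" "e r \<le> 1 / real Q" by auto
  qed
  have eq: "w' - \<beta> * real r = real r * of_int (-p) / real q + w' - e r" for r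
    using q by (simp add: e_def field_simps)
  have cop': "coprime (-p) (int q)" using cop by simp
  let ?U = "{r. r < q \<and> in_mod1 (real r * of_int (-p) / real q) (- w' - 1 / real Q) (l - w' + 1 / real Q)}"
  let ?L = "{r. r < q \<and> in_mod1 (real r * of_int (-p) / real q) (- w' + 1 / real Q) (l - w' - 1 / real Q)}"
  have "?R \<subseteq> ?U"
  proof clarify
    fix r assume r: "r < q" "in_mod1 (w' - \<beta> * real r) 0 l"
    from in_mod1_add[OF r(2), of "- w' - 1 / real Q" "e r - w'" "- w' + 1 / real Q"] e[OF r(1)]
    show "in_mod1 (real r * of_int (-p) / real q) (- w' - 1 / real Q) (l - w' + 1 / real Q)"
      unfolding eq by (simp add: algebra_simps)
  qed
  then have "real (card ?R) \<le> real (card ?U)" by (intro of_nat_mono card_mono) auto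
  also have "\<dots> \<le> real q * ((l - w' + 1 / real Q) - (- w' - 1 / real Q)) + 1"
    by (intro card_residues_in_arc_le q cop') (use l Q0 in linarith)
  finally have 1: "real (card ?R) \<le> real q * l + (2 * real q / real Q + 1)"
    by (simp add: algebra_simps)
  have "real q * ((l - w' - 1 / real Q) - (- w' + 1 / real Q)) - 1 \<le> real (card ?L)"
    by (intro card_residues_in_arc_ge q cop') (use l Q0 in linarith)
  also have "?L \<subseteq> ?R"
  proof clarify
    fix r assume r: "r < q" "in_mod1 (real r * of_int (-p) / real q) (- w' + 1 / real Q) (l - w' - 1 / real Q)"
    from in_mod1_add[OF r(2), of "w' - 1 / real Q" "w' - e r" "w' + 1 / real Q"] e[OF r(1)]
    show "in_mod1 (w' - \<beta> * real r) 0 l"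
      unfolding eq by (simp add: algebra_simps)
  qed
  then have "real (card ?L) \<le> real (card ?R)" by (intro of_nat_mono card_mono) auto
  finally have "real q * l - (2 * real q / real Q + 1) \<le> real (card ?R)"
    by (simp add: algebra_simps)
  with 1 show ?thesis unfolding card by linarith
qed

text \<open>Complete periods are peeled off one at a time. Nonnegativity of \<open>f\<close> bounds
  the incomplete last one by a full period, which produces the boundary term q l and the extra
  \<open>+ 1\<close>.\<close>

lemma sum_almost_periodic_bound:
  fixes f :: "nat \<Rightarrow> real"
  assumes q: "q > 0" and f: "\<And>b. 0 \<le> f b" and l: "0 \<le> l"
    and period: "\<And>m. \<bar>(\<Sum>b\<in>{m..<m+q}. f b) - real q * l\<bar> \<le> e"
  shows "\<bar>(\<Sum>b\<in>{m..<m+M}. f b) - real M * l\<bar> \<le> real q * l + (real M / real q + 1) * e"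
proof (induction M arbitrary: m rule: less_induct)
  case (less M)
  have e: "0 \<le> e" using period[of 0] by linarith
  show ?case
  proof (cases "M < q")
    case True
    have "(\<Sum>b\<in>{m..<m+M}. f b) \<le> (\<Sum>b\<in>{m..<m+q}. f b)"
      using True f by (intro sum_mono2) auto
    moreover have "0 \<le> (\<Sum>b\<in>{m..<m+M}. f b)" by (intro sum_nonneg f)
    moreover have "real M * l \<le> real q * l" using True l by (intro mult_right_mono) auto
    moreover have "0 \<le> real M * l" using l by simp
    moreover have "0 \<le> real M / real q * e" using e by simp
    moreover have "(real M / real q + 1) * e = real M / real q * e + e" by (simp add: algebra_simps)
    ultimately show ?thesis using period[of m] by linarith
  next
    case False
    then have qM: "q \<le> M" by simp
    have "(\<Sum>b\<in>{m..<m+M}. f b) = (\<Sum>b\<in>{m..<m+q}. f b) + (\<Sum>b\<in>{m+q..<m+q+(M-q)}. f b)"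
      using qM by (simp add: sum.atLeastLessThan_concat)
    moreover have "\<bar>(\<Sum>b\<in>{m+q..<m+q+(M-q)}. f b) - real (M-q) * l\<bar>
        \<le> real q * l + (real (M-q) / real q + 1) * e"
      using less.IH[of "M - q" "m + q"] q qM by simp
    moreover have "real (M-q) * l = real M * l - real q * l" "(real (M-q) / real q + 1) * e = (real M / real q + 1) * e - e"
      using qM q by (auto simp: of_nat_diff field_simps)
    ultimately show ?thesis using period[of m] by linarith
  qed
qed

section \<open>Diophantine type and equidistribution at scale \<open>2 ^ j\<close>\<close>

definition khinchin_type :: "(nat \<Rightarrow> real) \<Rightarrow> real \<Rightarrow> bool" where
  "khinchin_type \<psi> \<beta> \<longleftrightarrow> (\<exists>q0. \<forall>q\<ge>q0. \<forall>p::int. 1 / (real q * \<psi> q) \<le> \<bar>real q * \<beta> - of_int p\<bar>)"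

text \<open>The type condition and the approximation together give 1 / (q \<psi>(q)) < 1 / Q, so a
  good denominator at level \<open>Q\<close> cannot be much smaller than \<open>Q\<close>.\<close>

lemma khinchin_type_denominator_large:
  assumes kh: "khinchin_type \<psi> \<beta>" and mono: "mono \<psi>" and one: "\<And>q. 1 \<le> \<psi> q"
  shows "\<exists>B. \<forall>Q::nat. real Q > B \<longrightarrow> (\<forall>q p. 0 < q \<longrightarrow> \<bar>real q * \<beta> - of_int p\<bar> < 1 / real Q \<longrightarrow> 1 / real q \<le> \<psi> q / real Q)"
proof -
  obtain q1 where q1: "\<And>q p. q \<ge> q1 \<Longrightarrow> 1 / (real q * \<psi> q) \<le> \<bar>real q * \<beta> - of_int p\<bar>"
    using kh unfolding khinchin_type_def by metis
  define q0 where "q0 = Suc q1"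
  \<comment> \<open>The type condition is silent about small \<open>q\<close>. Multiplying such a
    \<open>q\<close> by \<open>q0\<close> brings it into the covered range and spoils the
    approximation only by the factor \<open>q0\<close>; the two bounds contradict each other as soon
    as Q exceeds this \<open>B\<close>.\<close>
  define B where "B = real q0 * (real (q0 * q0) * \<psi> (q0 * q0))"
  have "1 / real q \<le> \<psi> q / real Q"
    if Q: "real Q > B" and q: "0 < q" and ap: "\<bar>real q * \<beta> - of_int p\<bar> < 1 / real Q" for Q q and p :: int
  proof -
    have \<psi>0: "0 < \<psi> q" for q using one[of q] by linarith
    have "0 < q0" by (simp add: q0_def)
    then have B0: "0 < B" unfolding B_def by (intro mult_pos_pos \<psi>0) auto
    then have Q0: "0 < real Q" using Q by linarith
    have "q0 \<le> q"
    proof (rule ccontr)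
      assume "\<not> q0 \<le> q"
      then have qq: "q \<le> q0" by simp
      have "q1 * 1 \<le> q0 * q" using q by (intro mult_le_mono) (auto simp: q0_def)
      then have ge: "q0 * q \<ge> q1" by simp
      have "1 / (real (q0 * q0) * \<psi> (q0 * q0)) \<le> 1 / (real (q0 * q) * \<psi> (q0 * q))"
      proof (intro divide_left_mono mult_mono mult_pos_pos \<psi>0)
        show "\<psi> (q0 * q) \<le> \<psi> (q0 * q0)" using qq by (intro monoD[OF \<open>mono \<psi>\<close>]) simp
        show "real (q0 * q) \<le> real (q0 * q0)" using qq by (intro of_nat_mono) simp
        show "0 \<le> \<psi> (q0 * q)" using \<psi>0 less_imp_le by blast
        show "0 < real (q0 * q0)" "0 < real (q0 * q)" using \<open>0 < q0\<close> q by auto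
      qed auto
      also have "\<dots> \<le> \<bar>real (q0 * q) * \<beta> - of_int (int q0 * p)\<bar>" by (rule q1[OF ge])
      also have "real (q0 * q) * \<beta> - of_int (int q0 * p) = real q0 * (real q * \<beta> - of_int p)"
        by (simp add: algebra_simps)
      also have "\<bar>\<dots>\<bar> = real q0 * \<bar>real q * \<beta> - of_int p\<bar>" by (simp add: abs_mult)
      also have "\<dots> < real q0 * (1 / real Q)"
        using ap by (intro mult_strict_left_mono) (auto simp: q0_def)
      finally have "1 / (real (q0 * q0) * \<psi> (q0 * q0)) < real q0 / real Q" by simp
      moreover have "0 < real (q0 * q0) * \<psi> (q0 * q0)" using \<open>0 < q0\<close> by (intro mult_pos_pos \<psi>0) auto
      ultimately have "real Q < B" using Q0 unfolding B_def by (simp add: field_simps)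
      then show False using Q by simp
    qed
    then have "1 / (real q * \<psi> q) \<le> \<bar>real q * \<beta> - of_int p\<bar>" by (intro q1) (simp add: q0_def)
    with ap have "1 / (real q * \<psi> q) \<le> 1 / real Q" by linarith
    then show ?thesis using \<psi>0[of q] Q0 q by (simp add: field_simps)
  qed
  then show ?thesis by blast
qed

lemma rotation_arc_count:
  fixes l :: "nat \<Rightarrow> real"
  assumes kh: "khinchin_type \<psi> \<beta>" and mono: "mono \<psi>" and one: "\<And>q. 1 \<le> \<psi> q"
    and lpos: "\<And>j. 0 < l j" and l0: "l \<longlonglongrightarrow> 0"
    and big: "filterlim (\<lambda>j. 2 ^ j * l j / \<psi> (2 ^ j)) at_top sequentially"
    and \<eta>: "\<eta> > 0"
  shows "\<forall>\<^sub>F j in sequentially. \<forall>m w M. M \<le> 2 ^ j \<longrightarrow>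
     \<bar>real (card {b\<in>{m..<m+M}. in_mod1 (w - \<beta> * real b) 0 (l j)}) - real M * l j\<bar> \<le> \<eta> * 2 ^ j * l j"
proof -
  \<comment> \<open>Dirichlet is applied with Q about h N, where N = 2 ^ j. Then q is at most h N,
    so the boundary term q l is at most half of the allowed error; the other half is left for the
    errors of the periods, and the cap 1 gives q at most N.\<close>
  define h where "h = min (\<eta> / 2) 1"
  have h: "0 < h" "h \<le> 1" "h \<le> \<eta> / 2" using \<eta> by (auto simp: h_def)
  obtain B where B: "\<And>Q q p. real Q > B \<Longrightarrow> 0 < q \<Longrightarrow> \<bar>real q * \<beta> - of_int p\<bar> < 1 / real Q \<Longrightarrow> 1 / real q \<le> \<psi> q / real Q"
    using khinchin_type_denominator_large[OF kh mono one] by blast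
  have "filterlim (\<lambda>j::nat. (2::real) ^ j) at_top sequentially"
    by real_asymp
  then have e1: "\<forall>\<^sub>F j in sequentially. 2 ^ j \<ge> (2 * (\<bar>B\<bar> + 1) / h :: real)"
    by (simp add: filterlim_at_top)
  have e2: "\<forall>\<^sub>F j in sequentially. 2 ^ j * l j / \<psi> (2 ^ j) \<ge> 24 / (h * \<eta>)"
    using big by (simp add: filterlim_at_top)
  have e3: "\<forall>\<^sub>F j in sequentially. l j < 1" using order_tendstoD(2)[OF l0, of 1] by simp
  show ?thesis using e1 e2 e3
  proof eventually_elim
    case (elim j)
    define N where "N = (2::real) ^ j"
    define Q where "Q = nat \<lfloor>h * N\<rfloor>"
    have hN: "h * N \<ge> 2 * (\<bar>B\<bar> + 1)" using elim(1) h by (simp add: N_def field_simps)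
    have Q1: "real Q \<le> h * N" "real Q > h * N - 1" unfolding Q_def using hN by (auto; linarith)+
    have QB: "real Q > B" "real Q \<ge> h * N / 2" "Q > 0" using Q1 hN by (auto; linarith)+
    obtain p k :: int where pk: "coprime p k" "0 < k" "k \<le> int Q" "\<bar>of_int k * \<beta> - of_int p\<bar> < 1 / real Q"
      using Dirichlet_approx_coprime[of Q \<beta>] QB(3) by blast
    define q where "q = nat k"
    have q: "coprime p (int q)" "0 < q" "q \<le> Q" "\<bar>real q * \<beta> - of_int p\<bar> < 1 / real Q"
      using pk by (auto simp: q_def)
    have \<psi>0: "0 < \<psi> q" for q using one[of q] by linarith
    have qN: "real q \<le> h * N" using q(3) Q1(1) by linarith
    also have "\<dots> \<le> 1 * N" using h by (intro mult_right_mono) (auto simp: N_def)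
    finally have qN': "real q \<le> N" by simp
    then have "real q \<le> real (2 ^ j)" by (simp add: N_def)
    then have "q \<le> 2 ^ j" by (rule of_nat_le_iff[THEN iffD1])
    then have "\<psi> q \<le> \<psi> (2 ^ j)" using mono by (simp add: mono_def)
    then have inv: "1 / real q \<le> \<psi> (2 ^ j) / real Q"
      using B[OF QB(1) q(2) q(4)] QB(3) by (meson divide_right_mono of_nat_0_le_iff order_trans)
    show ?case
    proof (intro allI impI)
      fix m w and M :: nat assume M: "M \<le> 2 ^ j"
      then have MN: "real M \<le> N" by (simp add: N_def)
      let ?f = "\<lambda>b. if in_mod1 (w - \<beta> * real b) 0 (l j) then 1 else (0::real)"
      have cs: "(\<Sum>b\<in>{m..<m+M}. ?f b) = real (card {b\<in>{m..<m+M}. in_mod1 (w - \<beta> * real b) 0 (l j)})" for m M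
        by (simp add: sum.If_cases Int_def)
      have "\<bar>(\<Sum>b\<in>{m..<m+M}. ?f b) - real M * l j\<bar> \<le> real q * l j + (real M / real q + 1) * (2 * real q / real Q + 1)"
      proof (rule sum_almost_periodic_bound)
        show "\<bar>(\<Sum>b\<in>{m..<m+q}. ?f b) - real q * l j\<bar> \<le> 2 * real q / real Q + 1" for m
          unfolding cs using q elim(3) lpos[of j] by (intro card_rotation_period) auto
      qed (use q lpos[of j] in auto)
      also have "(real M / real q + 1) * (2 * real q / real Q + 1) = (real M + real q) * (2 / real Q + 1 / real q)"
        using q QB(3) by (simp add: field_simps)
      \<comment> \<open>Both 1 / Q and 1 / q are at most \<psi>(2 ^ j) / Q: the first because \<psi>
        is at least 1, the second by the lower bound on the denominator.\<close>
      also have "\<dots> \<le> (N + N) * (2 * (\<psi> (2 ^ j) / real Q) + \<psi> (2 ^ j) / real Q)"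
        using MN qN' inv one[of "2 ^ j"] QB(3)
        by (intro mult_mono add_mono inv) (auto simp: divide_simps)
      also have "\<dots> = 6 * N * \<psi> (2 ^ j) / real Q" by simp
      also have "\<dots> \<le> 6 * N * \<psi> (2 ^ j) / (h * N / 2)"
        using QB h \<psi>0[of "2 ^ j"] by (intro divide_left_mono) (auto simp: N_def)
      also have "\<dots> = 12 * \<psi> (2 ^ j) / h" using h by (simp add: N_def field_simps)
      also have "\<dots> \<le> \<eta> / 2 * (N * l j)"
      proof -
        have "24 / (h * \<eta>) * \<psi> (2 ^ j) \<le> N * l j"
          using elim(2) \<psi>0[of "2 ^ j"] by (simp add: N_def pos_le_divide_eq)
        then have "(\<eta> / 2) * (24 / (h * \<eta>) * \<psi> (2 ^ j)) \<le> (\<eta> / 2) * (N * l j)"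
          using \<eta> by (intro mult_left_mono) auto
        then show ?thesis using \<eta> by (simp add: field_simps)
      qed
      also have "real q * l j \<le> \<eta> / 2 * (N * l j)"
      proof -
        have "real q * l j \<le> (h * N) * l j" using qN lpos[of j] by (intro mult_right_mono) auto
        also have "\<dots> \<le> (\<eta> / 2 * N) * l j" using h lpos[of j]
          by (intro mult_right_mono) (auto simp: N_def)
        finally show ?thesis by simp
      qed
      finally show "\<bar>real (card {b\<in>{m..<m+M}. in_mod1 (w - \<beta> * real b) 0 (l j)}) - real M * l j\<bar> \<le> \<eta> * 2 ^ j * l j"
        unfolding cs by (simp add: N_def mult_ac)
    qed
  qed
qed

section \<open>Diophantine type of almost every number\<close>

text \<open>Borel-Cantelli, applied in each window of radius \<open>R\<close> separately, since over
  the whole line the exceptional set of a single \<open>q\<close> has infinite measure. The number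
  tested is \<open>2 * \<alpha>\<close> because the unperturbed terms have step 2.\<close>

lemma AE_khinchin_type:
  fixes \<psi> :: "nat \<Rightarrow> real"
  assumes one: "\<And>q. 1 \<le> \<psi> q" and sm: "summable (\<lambda>q. 1 / (real q * \<psi> q))"
  shows "AE \<alpha> in lborel. khinchin_type \<psi> (2 * \<alpha>)"
proof -
  define \<delta> where "\<delta> = (\<lambda>q. 1 / (real q * \<psi> q))"
  define I where "I = (\<lambda>q (p::int). {(of_int p - \<delta> q) / (2 * real q) .. (of_int p + \<delta> q) / (2 * real q)})"
  \<comment> \<open>For |\<alpha>| at most R, only these 4 q R + 3 integers \<open>p\<close> can be
    within \<delta> of 2 q \<alpha>, as \<delta> is at most 1. Each contributes an interval of
    length \<delta> / q, so the measure is at most (4 R + 3) \<delta>, which is summable.\<close>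
  define U where "U = (\<lambda>(R::nat) q. \<Union>p\<in>{- int (2 * q * R + 1)..int (2 * q * R + 1)}. I q p)"
  have \<delta>0: "0 \<le> \<delta> q" for q using one[of q] by (simp add: \<delta>_def)
  have \<delta>1: "\<delta> q \<le> 1" for q
  proof (cases "q = 0")
    case False
    then have "1 * 1 \<le> real q * \<psi> q" using one[of q] by (intro mult_mono) auto
    then show ?thesis by (simp add: \<delta>_def)
  qed (simp add: \<delta>_def)
  have sets: "U R q \<in> sets lborel" for R q unfolding U_def I_def by (intro sets.finite_UN) auto
  have "bounded (U R q)" for R q unfolding U_def I_def by (intro bounded_UN) auto
  then have fin: "emeasure lborel (U R q) < \<infinity>" for R q by (rule emeasure_bounded_finite)
  have meas: "measure lborel (U R q) \<le> (4 * real R + 3) * \<delta> q" for R q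
  proof (cases "q = 0")
    case True
    \<comment> \<open>Division by zero collapses all intervals for q = 0 to the origin.\<close>
    then have "U R q \<subseteq> {0}" by (auto simp: U_def I_def \<delta>_def)
    then have "measure lborel (U R q) \<le> measure lborel {0::real}"
      by (intro measure_mono_fmeasurable sets) (auto intro: fmeasurable_compact)
    also have "\<dots> \<le> (4 * real R + 3) * \<delta> q" using \<delta>0[of q] by simp
    finally show ?thesis .
  next
    case False
    have "measure lborel (U R q) \<le> (\<Sum>p\<in>{- int (2 * q * R + 1)..int (2 * q * R + 1)}. measure lborel (I q p))"
      unfolding U_def by (rule measure_UNION_le) (auto simp: I_def)
    also have "\<dots> = (\<Sum>p\<in>{- int (2 * q * R + 1)..int (2 * q * R + 1)}. \<delta> q / real q)"
    proof (rule sum.cong[OF refl])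
      fix p
      have "(of_int p - \<delta> q) / (2 * real q) \<le> (of_int p + \<delta> q) / (2 * real q)"
        using \<delta>0[of q] by (intro divide_right_mono) auto
      then show "measure lborel (I q p) = \<delta> q / real q"
        using False by (simp add: I_def field_simps)
    qed
    also have "\<dots> = (4 * real q * real R + 3) * (\<delta> q / real q)" by (simp add: algebra_simps)
    also have "\<dots> = (4 * real R + 3 / real q) * \<delta> q" using False by (simp add: field_simps)
    also have "\<dots> \<le> (4 * real R + 3) * \<delta> q"
      using False \<delta>0[of q] by (intro mult_right_mono add_left_mono) (auto simp: field_simps)
    finally show ?thesis .
  qed
  have "AE \<alpha> in lborel. \<forall>\<^sub>F q in sequentially. \<alpha> \<in> space lborel - U R q" for R
  proof (rule borel_cantelli_AE1[OF sets fin])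
    show "summable (\<lambda>q. measure lborel (U R q))"
    proof (rule summable_comparison_test')
      show "summable (\<lambda>q. (4 * real R + 3) * \<delta> q)" using sm unfolding \<delta>_def by (rule summable_mult)
      show "norm (measure lborel (U R q)) \<le> (4 * real R + 3) * \<delta> q" if "q \<ge> 0" for q
        using meas[of R q] by simp
    qed
  qed
  then have "AE \<alpha> in lborel. \<forall>R. \<forall>\<^sub>F q in sequentially. \<alpha> \<in> space lborel - U R q"
    unfolding AE_all_countable by blast
  then show ?thesis
  proof eventually_elim
    case (elim \<alpha>)
    define R where "R = nat \<lceil>\<bar>\<alpha>\<bar>\<rceil>"
    have R: "\<bar>\<alpha>\<bar> \<le> real R" unfolding R_def by linarith
    obtain q1 where q1: "\<And>q. q \<ge> q1 \<Longrightarrow> \<alpha> \<notin> U R q"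
      using elim unfolding eventually_sequentially by fastforce
    have "\<delta> q \<le> \<bar>real q * (2 * \<alpha>) - of_int p\<bar>" if q: "q \<ge> Suc q1" for q and p :: int
    proof (rule ccontr)
      assume "\<not> ?thesis"
      then have less: "\<bar>real q * (2 * \<alpha>) - of_int p\<bar> < \<delta> q" by simp
      have "\<bar>real q * (2 * \<alpha>)\<bar> \<le> 2 * real q * real R"
        using R by (simp add: abs_mult mult_left_mono mult_right_mono)
      then have "\<bar>of_int p\<bar> \<le> 2 * real q * real R + 1" using less \<delta>1[of q] by linarith
      then have "of_int \<bar>p\<bar> \<le> real_of_int (int (2 * q * R + 1))" by simp
      then have "\<bar>p\<bar> \<le> int (2 * q * R + 1)" by (simp only: of_int_le_iff)
      then have "p \<in> {- int (2 * q * R + 1)..int (2 * q * R + 1)}" by auto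
      moreover have "\<alpha> \<in> I q p"
        using less q by (auto simp: I_def field_simps abs_less_iff)
      ultimately have "\<alpha> \<in> U R q" unfolding U_def by blast
      then show False using q1[of q] q by simp
    qed
    then show ?case unfolding khinchin_type_def \<delta>_def by blast
  qed
qed

text \<open>The shift by \<open>exp (exp 1)\<close> makes both logarithms at least \<open>1\<close> at every \<open>q\<close>.\<close>

definition loglog_weight :: "real \<Rightarrow> nat \<Rightarrow> real" where
  "loglog_weight e q = ln (real q + exp (exp 1)) * ln (ln (real q + exp (exp 1))) powr e"

lemma ln_shift_ge:
  assumes "0 \<le> t"
  shows "exp 1 \<le> ln (t + exp (exp 1 :: real))" "1 \<le> ln (ln (t + exp (exp 1 :: real)))"
proof -
  have "ln (exp (exp 1 :: real)) \<le> ln (t + exp (exp 1))"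
    using assms by (subst ln_le_cancel_iff) (auto intro: add_nonneg_pos)
  then show 1: "exp 1 \<le> ln (t + exp (exp 1 :: real))" by simp
  then have "ln (exp (1::real)) \<le> ln (ln (t + exp (exp 1)))"
    by (subst ln_le_cancel_iff) (auto intro: less_le_trans[OF exp_gt_zero])
  then show "1 \<le> ln (ln (t + exp (exp 1 :: real)))" by simp
qed

lemma loglog_weight_ge_1:
  assumes "0 \<le> e"
  shows "1 \<le> loglog_weight e q"
proof -
  have "1 \<le> exp (1::real)" by simp
  then have "1 \<le> ln (real q + exp (exp 1))" using ln_shift_ge(1)[of "real q"] by linarith
  moreover have "1 \<le> ln (ln (real q + exp (exp 1))) powr e"
    using ln_shift_ge(2)[of "real q"] assms by (intro ge_one_powr_ge_zero) auto
  ultimately have "1 * 1 \<le> loglog_weight e q" unfolding loglog_weight_def by (intro mult_mono) auto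
  then show ?thesis by simp
qed

lemma mono_loglog_weight:
  assumes "0 \<le> e"
  shows "mono (loglog_weight e)"
proof (rule monoI)
  fix x y :: nat assume xy: "x \<le> y"
  have pos: "0 < exp (1::real)" by simp
  have 1: "ln (real x + exp (exp 1)) \<le> ln (real y + exp (exp 1))"
    using xy by (subst ln_le_cancel_iff) (auto intro: add_nonneg_pos)
  have 2: "0 < ln (real x + exp (exp 1))" using ln_shift_ge(1)[of "real x"] pos by linarith
  have 3: "1 \<le> ln (real x + exp (exp 1))" using ln_shift_ge(1)[of "real x"] one_le_exp_iff[of "1::real"] by linarith
  have "ln (ln (real x + exp (exp 1))) \<le> ln (ln (real y + exp (exp 1)))"
    using 1 2 by (subst ln_le_cancel_iff) auto
  then show "loglog_weight e x \<le> loglog_weight e y"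
    unfolding loglog_weight_def using 1 2 3 ln_shift_ge(2)[of "real x"] assms
    by (intro mult_mono powr_mono2) auto
qed

text \<open>The integral test in telescoping form: \<open>F\<close> is an antiderivative of the
  decreasing function \<open>h\<close> and tends to 0, so by the mean value theorem each term of the
  series is at most an increment of \<open>F\<close>.\<close>

lemma summable_inverse_loglog_weight:
  assumes "\<epsilon> > 0"
  shows "summable (\<lambda>q. 1 / (real q * loglog_weight (1 + \<epsilon>) q))"
proof -
  define E where "E = exp (exp (1::real))"
  define h where "h = (\<lambda>t. 1 / ((t + E) * (ln (t + E) * ln (ln (t + E)) powr (1 + \<epsilon>))))"
  define F where "F = (\<lambda>t. - (ln (ln (t + E)) powr (- \<epsilon>)) / \<epsilon>)"
  have E0: "0 < E" by (simp add: E_def)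
  have L: "0 < ln (t + E)" "0 < ln (ln (t + E))" if "0 \<le> t" for t
    using ln_shift_ge[OF that] unfolding E_def by (auto intro: less_le_trans[OF exp_gt_zero] less_le_trans)
  have deriv: "(F has_real_derivative h t) (at t)" if "0 \<le> t" for t
  proof -
    have "((\<lambda>t. ln (ln (t + E))) has_real_derivative 1 / (ln (t + E) * (t + E))) (at t)"
      using L[OF that] E0 that by (auto intro!: derivative_eq_intros simp: divide_simps)
    from DERIV_fun_powr[OF this L(2)[OF that], of "- \<epsilon>"]
    have "((\<lambda>t. ln (ln (t + E)) powr - \<epsilon>) has_real_derivative
        - \<epsilon> * ln (ln (t + E)) powr (- \<epsilon> - 1) * (1 / (ln (t + E) * (t + E)))) (at t)"
      by simp
    moreover have "- \<epsilon> - 1 = - (1 + \<epsilon>)" by simp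
    ultimately have "((\<lambda>t. ln (ln (t + E)) powr - \<epsilon>) has_real_derivative
        - \<epsilon> * (ln (ln (t + E)) powr (- (1 + \<epsilon>)) / (ln (t + E) * (t + E)))) (at t)"
      by simp
    from DERIV_cdivide[OF DERIV_minus[OF this], of \<epsilon>]
    have "(F has_real_derivative - (- \<epsilon> * (ln (ln (t + E)) powr (- (1 + \<epsilon>)) / (ln (t + E) * (t + E)))) / \<epsilon>) (at t)"
      unfolding F_def .
    moreover have "- (- \<epsilon> * (ln (ln (t + E)) powr (- (1 + \<epsilon>)) / (ln (t + E) * (t + E)))) / \<epsilon> = h t"
      unfolding h_def powr_minus using assms by (simp add: divide_simps)
    ultimately show ?thesis by simp
  qed
  have anti: "h b \<le> h a" if ab: "0 \<le> a" "a \<le> b" for a b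
  proof -
    have b: "0 \<le> b" using ab by linarith
    have l: "ln (a + E) \<le> ln (b + E)" using ab E0 by (subst ln_le_cancel_iff) auto
    then have ll: "ln (ln (a + E)) \<le> ln (ln (b + E))" using L[OF ab(1)] L[OF b] by (subst ln_le_cancel_iff) auto
    show ?thesis unfolding h_def using l ll ab E0 L[OF ab(1)] L[OF b] assms
      by (intro divide_left_mono mult_mono powr_mono2 mult_pos_pos) auto
  qed
  have "F \<longlonglongrightarrow> 0" unfolding F_def using assms E0 by real_asymp
  then have "summable (\<lambda>n. F (real (Suc n)) - F (real n))" by (intro telescope_summable)
  moreover have "norm (h (real (Suc n))) \<le> F (real (Suc n)) - F (real n)" for n
  proof -
    obtain z where z: "real n < z" "z < real (Suc n)" "F (real (Suc n)) - F (real n) = (real (Suc n) - real n) * h z"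
      using MVT2[of "real n" "real (Suc n)" F h] deriv by force
    have "0 \<le> h (real (Suc n))" unfolding h_def using L[of "real (Suc n)"] E0 by (auto simp del: of_nat_Suc)
    moreover have "F (real (Suc n)) - F (real n) = h z" using z(3) by simp
    ultimately show ?thesis using z(1,2) anti[of z "real (Suc n)"] by (simp del: of_nat_Suc)
  qed
  ultimately have "summable (\<lambda>n. h (real (Suc n)))"
    by (rule summable_comparison_test'[where N = 0])
  then have "summable (\<lambda>n. h (real n))" by (rule summable_Suc_iff[THEN iffD1])
  then have "summable (\<lambda>n. (1 + E) * h (real n))" by (rule summable_mult)
  moreover have "norm (1 / (real q * loglog_weight (1 + \<epsilon>) q)) \<le> (1 + E) * h (real q)" for q
  proof (cases "q = 0")
    case True
    then show ?thesis using E0 L[of 0] by (simp add: h_def)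
  next
    case False
    have w: "1 \<le> loglog_weight (1 + \<epsilon>) q" using assms by (intro loglog_weight_ge_1) auto
    \<comment> \<open>The telescoped series has q + E in place of the factor q; for q at least 1 the
      exchange costs the constant factor 1 + E.\<close>
    have "real q + E \<le> real q * (1 + E)" using False E0 by (simp add: algebra_simps)
    then have "(1 + E) / (real q * (1 + E) * loglog_weight (1 + \<epsilon>) q) \<le> (1 + E) / ((real q + E) * loglog_weight (1 + \<epsilon>) q)"
      using w E0 False by (intro divide_left_mono mult_right_mono mult_pos_pos) auto
    moreover have "(1 + E) / (real q * (1 + E) * loglog_weight (1 + \<epsilon>) q) = 1 / (real q * loglog_weight (1 + \<epsilon>) q)"
      using E0 by (simp add: divide_simps)
    ultimately have "1 / (real q * loglog_weight (1 + \<epsilon>) q) \<le> (1 + E) / ((real q + E) * loglog_weight (1 + \<epsilon>) q)"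
      by simp
    then show ?thesis using w by (simp add: h_def loglog_weight_def E_def)
  qed
  ultimately show ?thesis by (rule summable_comparison_test'[where N = 0])
qed

section \<open>Smoothed rotations\<close>

text \<open>For \<open>u\<close> uniform in [0, 1] the point is uniform on the arc of length
  \<open>\<kappa>\<close> ending at \<open>v\<close>. The minus sign reflects that the perturbed
  point is subtracted from the first point of the tuple.\<close>

definition arc_prob :: "real \<Rightarrow> real \<Rightarrow> real \<Rightarrow> real \<Rightarrow> real" where
  "arc_prob v \<kappa> lo hi = measure lborel {u\<in>{0..1}. in_mod1 (v - \<kappa> * u) lo hi}"

lemma measurable_in_mod1 [measurable (raw)]:
  assumes [measurable]: "f \<in> borel_measurable M"
  shows "Measurable.pred M (\<lambda>x. in_mod1 (f x) lo hi)"
  unfolding in_mod1_def by measurable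

text \<open>Exchanges the roles of the two arcs: the short target \<open>[lo, hi]\<close> becomes the domain of integration,
  and the points of a rotation only have to be counted in the longer arc \<open>[0, \<kappa>]\<close>.\<close>

lemma arc_prob_eq:
  assumes \<kappa>: "0 < \<kappa>" and le: "lo \<le> hi" and less: "\<kappa> + (hi - lo) < 1"
  shows "arc_prob v \<kappa> lo hi = measure lborel {z\<in>{lo..hi}. in_mod1 (v - z) 0 \<kappa>} / \<kappa>"
proof (cases "\<exists>m::int. lo \<le> v - of_int m \<and> v - of_int m \<le> \<kappa> + hi")
  case True
  then obtain m :: int where m: "lo \<le> v - of_int m" "v - of_int m \<le> \<kappa> + hi" by blast
  define w where "w = v - of_int m"
  \<comment> \<open>Since \<open>\<kappa> + (hi - lo) < 1\<close>, a single integer translate is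
    relevant. Both sets are then intervals, exchanged by the substitution z = w - \<kappa> u, whence
    the factor 1 / \<kappa>.\<close>
  have uniq: "m' = m" if "lo \<le> v - of_int m'" "v - of_int m' \<le> \<kappa> + hi" for m' :: int
    using that m less by linarith
  have 1: "{u\<in>{0..1}. in_mod1 (v - \<kappa> * u) lo hi} = {max 0 ((w - hi) / \<kappa>) .. min 1 ((w - lo) / \<kappa>)}"
  proof (intro set_eqI iffI)
    fix u assume "u \<in> {u\<in>{0..1}. in_mod1 (v - \<kappa> * u) lo hi}"
    then obtain m' :: int where u: "0 \<le> u" "u \<le> 1" "lo \<le> v - \<kappa> * u - of_int m'" "v - \<kappa> * u - of_int m' \<le> hi"
      unfolding in_mod1_def by auto
    have "0 \<le> \<kappa> * u" "\<kappa> * u \<le> \<kappa>" using u \<kappa> by (auto simp: mult_left_le)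
    with u have "m' = m" by (intro uniq) linarith+
    with u \<kappa> show "u \<in> {max 0 ((w - hi) / \<kappa>) .. min 1 ((w - lo) / \<kappa>)}"
      by (auto simp: w_def field_simps)
  next
    fix u assume u: "u \<in> {max 0 ((w - hi) / \<kappa>) .. min 1 ((w - lo) / \<kappa>)}"
    then show "u \<in> {u\<in>{0..1}. in_mod1 (v - \<kappa> * u) lo hi}"
      using \<kappa> by (auto simp: in_mod1_def w_def field_simps intro!: exI[of _ m])
  qed
  have 2: "{z\<in>{lo..hi}. in_mod1 (v - z) 0 \<kappa>} = {max lo (w - \<kappa>) .. min hi w}"
  proof (intro set_eqI iffI)
    fix z assume "z \<in> {z\<in>{lo..hi}. in_mod1 (v - z) 0 \<kappa>}"
    then obtain m' :: int where z: "lo \<le> z" "z \<le> hi" "0 \<le> v - z - of_int m'" "v - z - of_int m' \<le> \<kappa>"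
      unfolding in_mod1_def by auto
    then have "m' = m" by (intro uniq) linarith+
    with z show "z \<in> {max lo (w - \<kappa>) .. min hi w}" by (auto simp: w_def)
  next
    fix z assume z: "z \<in> {max lo (w - \<kappa>) .. min hi w}"
    then show "z \<in> {z\<in>{lo..hi}. in_mod1 (v - z) 0 \<kappa>}"
      by (auto simp: in_mod1_def w_def intro!: exI[of _ m])
  qed
  have w: "lo \<le> w" "w \<le> \<kappa> + hi" using m by (auto simp: w_def)
  have "max 0 ((w - hi) / \<kappa>) \<le> min 1 ((w - lo) / \<kappa>)"
    using w \<kappa> le by (auto simp: field_simps max_def min_def)
  moreover have "max lo (w - \<kappa>) \<le> min hi w" using w \<kappa> le by auto
  moreover have "\<kappa> * (min 1 ((w - lo) / \<kappa>) - max 0 ((w - hi) / \<kappa>)) = min hi w - max lo (w - \<kappa>)"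
    using \<kappa> by (auto simp: min_def max_def field_simps)
  ultimately show ?thesis unfolding arc_prob_def 1 2 using \<kappa> by (simp add: field_simps)
next
  case False
  have 1: "{u\<in>{0..1}. in_mod1 (v - \<kappa> * u) lo hi} = {}"
  proof (rule ccontr)
    assume "\<not> ?thesis"
    then obtain u and m' :: int where u: "0 \<le> u" "u \<le> 1" "lo \<le> v - \<kappa> * u - of_int m'" "v - \<kappa> * u - of_int m' \<le> hi"
      unfolding in_mod1_def by auto
    have "0 \<le> \<kappa> * u" "\<kappa> * u \<le> \<kappa>" using u \<kappa> by (auto simp: mult_left_le)
    with u have "lo \<le> v - of_int m'" "v - of_int m' \<le> \<kappa> + hi" by linarith+
    with False show False by blast
  qed
  have 2: "{z\<in>{lo..hi}. in_mod1 (v - z) 0 \<kappa>} = {}"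
  proof (rule ccontr)
    assume "\<not> ?thesis"
    then obtain z and m' :: int where z: "lo \<le> z" "z \<le> hi" "0 \<le> v - z - of_int m'" "v - z - of_int m' \<le> \<kappa>"
      unfolding in_mod1_def by auto
    then have "lo \<le> v - of_int m'" "v - of_int m' \<le> \<kappa> + hi" by linarith+
    with False show False by blast
  qed
  show ?thesis unfolding arc_prob_def 1 2 by simp
qed

lemma arc_prob_nonneg: "0 \<le> arc_prob v \<kappa> lo hi"
  by (simp add: arc_prob_def)

text \<open>This crude bound admits long arcs \<open>\<kappa>\<close>, as they may occur in the
  finitely many initial blocks: at most \<kappa> + 2 translates of the target are met, each for a
  set of \<open>u\<close> of length (hi - lo) / \<kappa>.\<close>

lemma arc_prob_le:
  assumes \<kappa>: "0 < \<kappa>" and le: "lo \<le> hi" and less: "hi - lo \<le> 1"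
  shows "arc_prob v \<kappa> lo hi \<le> (hi - lo) * (1 + 2 / \<kappa>)"
proof -
  let ?S = "{\<lceil>v - \<kappa> - hi\<rceil>..\<lfloor>v - lo\<rfloor>}"
  let ?I = "\<lambda>m::int. {(v - of_int m - hi) / \<kappa> .. (v - of_int m - lo) / \<kappa>}"
  have "{u\<in>{0..1}. in_mod1 (v - \<kappa> * u) lo hi} \<subseteq> (\<Union>m\<in>?S. ?I m)"
  proof
    fix u assume "u \<in> {u\<in>{0..1}. in_mod1 (v - \<kappa> * u) lo hi}"
    then obtain m :: int where u: "0 \<le> u" "u \<le> 1" "lo \<le> v - \<kappa> * u - of_int m" "v - \<kappa> * u - of_int m \<le> hi"
      unfolding in_mod1_def by auto
    have "0 \<le> \<kappa> * u" "\<kappa> * u \<le> \<kappa>" using u \<kappa> by (auto simp: mult_left_le)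
    with u have "v - \<kappa> - hi \<le> of_int m" "of_int m \<le> v - lo" by linarith+
    then have "m \<in> ?S" by (auto simp: ceiling_le_iff le_floor_iff)
    moreover have "u \<in> ?I m" using u \<kappa> by (auto simp: field_simps)
    ultimately show "u \<in> (\<Union>m\<in>?S. ?I m)" by blast
  qed
  moreover have "(\<Union>m\<in>?S. ?I m) \<in> fmeasurable lborel" by (intro fmeasurable.finite_UN fmeasurable_compact) auto
  ultimately have "arc_prob v \<kappa> lo hi \<le> measure lborel (\<Union>m\<in>?S. ?I m)"
    unfolding arc_prob_def by (intro measure_mono_fmeasurable) measurable
  also have "\<dots> \<le> (\<Sum>m\<in>?S. measure lborel (?I m))" by (rule measure_UNION_le) auto
  also have "\<dots> = (\<Sum>m\<in>?S. (hi - lo) / \<kappa>)"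
  proof (rule sum.cong[OF refl])
    fix m :: int
    have "(v - of_int m - hi) / \<kappa> \<le> (v - of_int m - lo) / \<kappa>" using le \<kappa> by (intro divide_right_mono) auto
    then show "measure lborel (?I m) = (hi - lo) / \<kappa>" using \<kappa> by (simp add: diff_divide_distrib)
  qed
  also have "\<dots> = real (card ?S) * ((hi - lo) / \<kappa>)" by simp
  also have "\<dots> \<le> (\<kappa> + 2) * ((hi - lo) / \<kappa>)"
  proof (rule mult_right_mono)
    have "real (card ?S) \<le> (v - lo) - (v - \<kappa> - hi) + 1"
      using \<kappa> le by (intro card_int_interval_bounds) linarith
    then show "real (card ?S) \<le> \<kappa> + 2" using less by linarith
  qed (use le \<kappa> in auto)
  also have "\<dots> = (hi - lo) * (1 + 2 / \<kappa>)" using \<kappa> by (simp add: field_simps)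
  finally show ?thesis .
qed

text \<open>The sum is 1 / \<kappa> times the integral over the target of a count in an arc of
  length \<kappa>. The error is therefore proportional to hi - lo, even for targets so short that
  most of them contain no rotation point.\<close>

lemma sum_arc_prob_bound:
  assumes \<kappa>: "0 < \<kappa>" and le: "lo \<le> hi" and less: "\<kappa> + (hi - lo) < 1" and fin: "finite B"
    and count: "\<And>w. \<bar>real (card {b\<in>B. in_mod1 (w - \<beta> * real b) 0 \<kappa>}) - A * \<kappa>\<bar> \<le> e * \<kappa>"
  shows "\<bar>(\<Sum>b\<in>B. arc_prob (y - \<beta> * real b) \<kappa> lo hi) - A * (hi - lo)\<bar> \<le> e * (hi - lo)"
proof -
  let ?S = "\<lambda>b. {z\<in>{lo..hi}. in_mod1 (y - \<beta> * real b - z) 0 \<kappa>}"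
  have S: "?S b \<in> fmeasurable lborel" for b
    by (rule fmeasurableI2[of "{lo..hi}"]) (auto intro: fmeasurable_compact, measurable)
  define f where "f = (\<lambda>z. \<Sum>b\<in>B. indicator (?S b) z :: real)"
  have intS: "integrable lborel (indicator (?S b) :: real \<Rightarrow> real)" for b
    using S[of b] by (simp add: fmeasurable_def)
  have int_f: "integrable lborel f" unfolding f_def by (intro Bochner_Integration.integrable_sum intS)
  have int_c: "integrable lborel (\<lambda>z. c * indicator {lo..hi} z :: real)" for c
    by (intro integrable_mult_right integrable_real_indicator) (auto simp: emeasure_lborel_Icc_eq)
  have sum_eq: "(\<Sum>b\<in>B. arc_prob (y - \<beta> * real b) \<kappa> lo hi) = (\<integral>z. f z \<partial>lborel) / \<kappa>"
  proof -
    have "(\<integral>z. f z \<partial>lborel) = (\<Sum>b\<in>B. \<integral>z. indicator (?S b) z \<partial>lborel)"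
      unfolding f_def by (intro Bochner_Integration.integral_sum intS)
    also have "\<dots> = (\<Sum>b\<in>B. measure lborel (?S b))" by (intro sum.cong) auto
    finally show ?thesis by (simp add: arc_prob_eq[OF \<kappa> le less] sum_divide_distrib)
  qed
  have f_eq: "f z = real (card {b\<in>B. in_mod1 ((y - z) - \<beta> * real b) 0 \<kappa>}) * indicator {lo..hi} z" for z
  proof (cases "z \<in> {lo..hi}")
    case True
    then have "f z = (\<Sum>b\<in>B. if in_mod1 ((y - z) - \<beta> * real b) 0 \<kappa> then 1 else 0)"
      unfolding f_def by (intro sum.cong) (auto simp: indicator_def algebra_simps)
    with True fin show ?thesis by (simp add: sum.If_cases Int_def)
  qed (auto simp: f_def indicator_def)
  have ic: "(\<integral>z. c * indicator {lo..hi} z \<partial>lborel) = c * (hi - lo)" for c :: real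
    using le by simp
  have cb: "real (card {b\<in>B. in_mod1 (w - \<beta> * real b) 0 \<kappa>}) \<le> (A + e) * \<kappa>"
    "(A - e) * \<kappa> \<le> real (card {b\<in>B. in_mod1 (w - \<beta> * real b) 0 \<kappa>})" for w
    using count[of w] by (auto simp: abs_le_iff algebra_simps)
  have "(\<integral>z. f z \<partial>lborel) \<le> (\<integral>z. ((A + e) * \<kappa>) * indicator {lo..hi} z \<partial>lborel)"
    unfolding f_eq by (intro integral_mono int_f[unfolded f_eq] int_c mult_right_mono)
      (auto intro: cb)
  then have 1: "(\<integral>z. f z \<partial>lborel) \<le> ((A + e) * \<kappa>) * (hi - lo)" by (simp only: ic)
  have "(\<integral>z. ((A - e) * \<kappa>) * indicator {lo..hi} z \<partial>lborel) \<le> (\<integral>z. f z \<partial>lborel)"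
    unfolding f_eq by (intro integral_mono int_f[unfolded f_eq] int_c mult_right_mono)
      (auto intro: cb)
  then have 2: "((A - e) * \<kappa>) * (hi - lo) \<le> (\<integral>z. f z \<partial>lborel)" by (simp only: ic)
  have "(\<integral>z. f z \<partial>lborel) / \<kappa> \<le> (A + e) * (hi - lo)" using 1 \<kappa> by (simp add: field_simps)
  moreover have "(A - e) * (hi - lo) \<le> (\<integral>z. f z \<partial>lborel) / \<kappa>" using 2 \<kappa> by (simp add: field_simps)
  ultimately show ?thesis unfolding sum_eq by (simp add: abs_le_iff algebra_simps)
qed

section \<open>Expected hits, summed over dyadic blocks\<close>

lemma dyadic_sum_bound:
  fixes a :: "nat \<Rightarrow> real"
  assumes block: "\<And>j M. j \<ge> j0 \<Longrightarrow> M \<le> 2 ^ j \<Longrightarrow> \<bar>\<Sum>b\<in>{2 ^ j..<2 ^ j + M}. a b\<bar> \<le> \<eta> * 2 ^ j"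
    and init: "\<bar>\<Sum>b\<in>{1..<2 ^ j0}. a b\<bar> \<le> K" and N: "N \<ge> 2 ^ j0" and \<eta>: "\<eta> \<ge> 0"
  shows "\<bar>\<Sum>b\<in>{1..N}. a b\<bar> \<le> K + 2 * \<eta> * real N"
proof -
  have split: "(\<Sum>b\<in>{1..<2 ^ j + M}. a b) = (\<Sum>b\<in>{1..<2 ^ j}. a b) + (\<Sum>b\<in>{2 ^ j..<2 ^ j + M}. a b)" for j M :: nat
    by (subst sum.atLeastLessThan_concat) auto
  have full: "\<bar>\<Sum>b\<in>{1..<2 ^ J}. a b\<bar> \<le> K + \<eta> * 2 ^ J" if "J \<ge> j0" for J
    using that
  proof (induction J rule: dec_induct)
    case base
    have "0 \<le> \<eta> * 2 ^ j0" using \<eta> by simp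
    then show ?case using init by linarith
  next
    case (step J)
    have "{1..<2 ^ Suc J} = {1..<2 ^ J + 2 ^ J :: nat}" by (simp add: mult_2)
    then have "(\<Sum>b\<in>{1..<2 ^ Suc J}. a b) = (\<Sum>b\<in>{1..<2 ^ J}. a b) + (\<Sum>b\<in>{2 ^ J..<2 ^ J + 2 ^ J}. a b)"
      using split[of J "2 ^ J"] by (simp only:)
    moreover have "\<eta> * 2 ^ Suc J = \<eta> * 2 ^ J + \<eta> * 2 ^ J" by simp
    ultimately show ?case using step.IH block[OF step.hyps(1), of "2 ^ J"] by linarith
  qed
  define J where "J = floor_log N"
  have N0: "N > 0" using N by (metis gr0I le_zero_eq power_not_zero zero_neq_numeral)
  have J: "2 ^ J \<le> N" "N < 2 * 2 ^ J" unfolding J_def using floor_log_exp2_le[of N] floor_log_exp2_gt[of N] N0 by auto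
  have J0: "j0 \<le> J" unfolding J_def using floor_log_le_iff[OF N] by simp
  \<comment> \<open>The last block is incomplete; \<open>+ 1\<close> because the sum includes the
    index N itself.\<close>
  define M where "M = N + 1 - 2 ^ J"
  have M: "M \<le> 2 ^ J" "{1..N} = {1..<2 ^ J + M}" using J by (auto simp: M_def)
  have "\<bar>\<Sum>b\<in>{1..N}. a b\<bar> \<le> K + \<eta> * 2 ^ J + \<eta> * 2 ^ J"
    unfolding M(2) split using full[OF J0] block[OF J0 M(1)] by linarith
  also have "\<dots> = K + 2 * \<eta> * real (2 ^ J)" by simp
  also have "\<dots> \<le> K + 2 * \<eta> * real N" using J(1) \<eta> by (intro add_left_mono mult_left_mono of_nat_mono) auto
  finally show ?thesis .
qed

text \<open>Everything here concerns one fixed \<alpha>, and randomness enters only through the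
  perturbations. \<open>G_large\<close> says that the main term of a rotation count at scale 2 ^ j
  dominates its error \<psi>(2 ^ j). Negative \<alpha> are recovered at the end by
  reflection.\<close>

locale perturbed_rotation =
  fixes \<psi> :: "nat \<Rightarrow> real" and G :: "nat \<Rightarrow> real" and \<alpha> :: real
  assumes \<psi>_mono: "mono \<psi>" and \<psi>_ge: "\<And>q. 1 \<le> \<psi> q"
    and G_pos: "\<And>j. 0 < G j" and G_lim: "G \<longlonglongrightarrow> 0"
    and G_large: "filterlim (\<lambda>j. 2 ^ j * G j / \<psi> (2 ^ j)) at_top sequentially"
    and \<alpha>_pos: "0 < \<alpha>" and \<alpha>_type: "khinchin_type \<psi> (2 * \<alpha>)"
begin

text \<open>The conditional probability that the perturbed point with index \<open>b\<close>
  satisfies its condition when the first point of the tuple sits at \<open>y\<close>.\<close>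

definition hit_prob :: "real \<Rightarrow> real \<Rightarrow> real \<Rightarrow> nat \<Rightarrow> real" where
  "hit_prob y lo hi b = arc_prob (y - 2 * \<alpha> * real b) (\<alpha> * G (floor_log b)) lo hi"

lemma hit_prob_le:
  assumes "lo \<le> hi" "hi - lo \<le> 1"
  shows "hit_prob y lo hi b \<le> (hi - lo) * (1 + 2 / (\<alpha> * G (floor_log b)))"
  unfolding hit_prob_def using assms \<alpha>_pos G_pos by (intro arc_prob_le) auto

lemma hit_prob_nonneg: "0 \<le> hit_prob y lo hi b"
  unfolding hit_prob_def by (rule arc_prob_nonneg)

text \<open>Uniformity in \<open>y\<close> is essential, because \<open>y\<close> will be the random
  position of another point; uniformity in the target is essential, because its length will be of
  order 1 / N.\<close>

lemma sum_hit_prob: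
  assumes \<eta>: "\<eta> > 0"
  shows "\<forall>\<^sub>F N in sequentially. \<forall>y lo hi. lo \<le> hi \<longrightarrow> hi - lo \<le> 1/2 \<longrightarrow>
    \<bar>(\<Sum>b\<in>{1..N}. hit_prob y lo hi b) - real N * (hi - lo)\<bar> \<le> \<eta> * real N * (hi - lo)"
proof -
  have "\<forall>\<^sub>F j in sequentially. \<forall>m w M. M \<le> 2 ^ j \<longrightarrow>
     \<bar>real (card {b\<in>{m..<m+M}. in_mod1 (w - (2 * \<alpha>) * real b) 0 (\<alpha> * G j)}) - real M * (\<alpha> * G j)\<bar>
        \<le> (\<eta> / 3) * 2 ^ j * (\<alpha> * G j)"
  proof (rule rotation_arc_count[OF \<alpha>_type \<psi>_mono \<psi>_ge])
    show "(\<lambda>j. \<alpha> * G j) \<longlonglongrightarrow> 0" using tendsto_mult_left[OF G_lim, of \<alpha>] by simp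
    have "filterlim (\<lambda>j. \<alpha> * (2 ^ j * G j / \<psi> (2 ^ j))) at_top sequentially"
      using \<alpha>_pos by (intro filterlim_tendsto_pos_mult_at_top[OF tendsto_const _ G_large])
    then show "filterlim (\<lambda>j. 2 ^ j * (\<alpha> * G j) / \<psi> (2 ^ j)) at_top sequentially"
      by (simp add: mult_ac)
  qed (use \<alpha>_pos G_pos \<eta> in auto)
  moreover have "\<forall>\<^sub>F j in sequentially. \<alpha> * G j < 1/2"
    using order_tendstoD(2)[OF tendsto_mult_left[OF G_lim, of \<alpha>], of "1/2"] by simp
  ultimately have "\<forall>\<^sub>F j in sequentially. \<alpha> * G j < 1/2 \<and> (\<forall>m w M. M \<le> 2 ^ j \<longrightarrow>
     \<bar>real (card {b\<in>{m..<m+M}. in_mod1 (w - (2 * \<alpha>) * real b) 0 (\<alpha> * G j)}) - real M * (\<alpha> * G j)\<bar>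
        \<le> (\<eta> / 3) * 2 ^ j * (\<alpha> * G j))"
    by eventually_elim blast
  then obtain j0 where small: "\<And>j. j \<ge> j0 \<Longrightarrow> \<alpha> * G j < 1/2"
    and cnt: "\<And>j m w M. j \<ge> j0 \<Longrightarrow> M \<le> 2 ^ j \<Longrightarrow>
     \<bar>real (card {b\<in>{m..<m+M}. in_mod1 (w - (2 * \<alpha>) * real b) 0 (\<alpha> * G j)}) - real M * (\<alpha> * G j)\<bar>
        \<le> (\<eta> / 3) * 2 ^ j * (\<alpha> * G j)"
    unfolding eventually_sequentially by blast
  \<comment> \<open>The initial blocks cost at most a fixed multiple K of hi - lo, which \<eta> N /
    3 eventually exceeds. The other two thirds of \<eta> pay for the factor 2 in
    \<open>dyadic_sum_bound\<close>.\<close>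
  define K where "K = (\<Sum>b\<in>{1..<2 ^ j0}. 2 + 2 / (\<alpha> * G (floor_log b)))"
  have "filterlim (\<lambda>N. \<eta> / 3 * real N) at_top sequentially"
    using \<eta> by (intro filterlim_tendsto_pos_mult_at_top[OF tendsto_const _ filterlim_real_sequentially]) auto
  then have "\<forall>\<^sub>F N in sequentially. K \<le> \<eta> / 3 * real N" by (simp add: filterlim_at_top)
  moreover have "\<forall>\<^sub>F N in sequentially. (2::nat) ^ j0 \<le> N" by (rule eventually_ge_at_top)
  ultimately show ?thesis
  proof eventually_elim
    case (elim N)
    show ?case
    proof (intro allI impI)
      fix y lo hi :: real assume le: "lo \<le> hi" and half: "hi - lo \<le> 1/2"
      have "\<bar>\<Sum>b\<in>{1..N}. hit_prob y lo hi b - (hi - lo)\<bar> \<le> K * (hi - lo) + 2 * (\<eta> / 3 * (hi - lo)) * real N"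
      proof (rule dyadic_sum_bound[OF _ _ elim(2)])
        fix j M :: nat assume j: "j0 \<le> j" and M: "M \<le> 2 ^ j"
        have fl: "floor_log b = j" if "b \<in> {2 ^ j..<2 ^ j + M}" for b
          using that M by (intro floor_log_eqI) auto
        have "\<bar>(\<Sum>b\<in>{2 ^ j..<2 ^ j + M}. arc_prob (y - (2 * \<alpha>) * real b) (\<alpha> * G j) lo hi) - real M * (hi - lo)\<bar>
            \<le> (\<eta> / 3 * 2 ^ j) * (hi - lo)"
          using small[OF j] half le \<alpha>_pos G_pos[of j] cnt[OF j M]
          by (intro sum_arc_prob_bound) auto
        moreover have "(\<Sum>b\<in>{2 ^ j..<2 ^ j + M}. arc_prob (y - (2 * \<alpha>) * real b) (\<alpha> * G j) lo hi)
            = (\<Sum>b\<in>{2 ^ j..<2 ^ j + M}. hit_prob y lo hi b)"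
          by (intro sum.cong) (simp_all add: hit_prob_def fl)
        moreover have "(\<Sum>b\<in>{2 ^ j..<2 ^ j + M}. hit_prob y lo hi b - (hi - lo)) =
            (\<Sum>b\<in>{2 ^ j..<2 ^ j + M}. hit_prob y lo hi b) - real M * (hi - lo)"
          by (simp add: sum_subtractf)
        moreover have "\<eta> / 3 * (hi - lo) * 2 ^ j = (\<eta> / 3 * 2 ^ j) * (hi - lo)" by simp
        ultimately show "\<bar>\<Sum>b\<in>{2 ^ j..<2 ^ j + M}. hit_prob y lo hi b - (hi - lo)\<bar> \<le> \<eta> / 3 * (hi - lo) * 2 ^ j"
          by (simp only:)
      next
        have "\<bar>\<Sum>b\<in>{1..<2 ^ j0}. hit_prob y lo hi b - (hi - lo)\<bar> \<le> (\<Sum>b\<in>{1..<2 ^ j0}. \<bar>hit_prob y lo hi b - (hi - lo)\<bar>)"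
          by (rule sum_abs)
        also have "\<dots> \<le> (\<Sum>b\<in>{1..<2 ^ j0}. (2 + 2 / (\<alpha> * G (floor_log b))) * (hi - lo))"
        proof (rule sum_mono)
          fix b
          have "hit_prob y lo hi b \<le> (hi - lo) * (1 + 2 / (\<alpha> * G (floor_log b)))"
            using le half by (intro hit_prob_le) auto
          then show "\<bar>hit_prob y lo hi b - (hi - lo)\<bar> \<le> (2 + 2 / (\<alpha> * G (floor_log b))) * (hi - lo)"
            using hit_prob_nonneg[of y lo hi b] le by (simp add: algebra_simps)
        qed
        also have "\<dots> = K * (hi - lo)" unfolding K_def by (simp add: sum_distrib_right)
        finally show "\<bar>\<Sum>b\<in>{1..<2 ^ j0}. hit_prob y lo hi b - (hi - lo)\<bar> \<le> K * (hi - lo)" .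
      qed (use \<eta> le in auto)
      moreover have "K * (hi - lo) \<le> (\<eta> / 3 * real N) * (hi - lo)"
        using elim(1) le by (intro mult_right_mono) auto
      moreover have "(\<Sum>b\<in>{1..N}. hit_prob y lo hi b - (hi - lo)) =
            (\<Sum>b\<in>{1..N}. hit_prob y lo hi b) - real N * (hi - lo)"
        by (simp add: sum_subtractf)
      moreover have "\<eta> / 3 * real N * (hi - lo) + 2 * (\<eta> / 3 * (hi - lo)) * real N = \<eta> * real N * (hi - lo)"
        by (simp add: field_simps)
      ultimately show "\<bar>(\<Sum>b\<in>{1..N}. hit_prob y lo hi b) - real N * (hi - lo)\<bar> \<le> \<eta> * real N * (hi - lo)"
        by linarith
    qed
  qed
qed

text \<open>No single point carries a noticeable share of the expected hits, so it does not matter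
  that indices already present in a tuple are excluded. A late block has N G at least 2 ^ j G, which
  is large; finitely many early indices are absorbed by letting N grow.\<close>

lemma hit_prob_uniformly_small:
  assumes \<eta>: "\<eta> > 0"
  shows "\<forall>\<^sub>F N in sequentially. \<forall>b\<in>{1..N}. (1 + 2 / (\<alpha> * G (floor_log b))) / real N \<le> \<eta>"
proof -
  \<comment> \<open>N G at least this K means 2 / (\<alpha> G) at most \<eta> N / 2; the remaining
    half of \<eta> N covers the summand 1.\<close>
  define K where "K = 4 / (\<eta> * \<alpha>)"
  have K0: "K > 0" using \<eta> \<alpha>_pos by (simp add: K_def)
  have "\<forall>\<^sub>F j in sequentially. K \<le> 2 ^ j * G j / \<psi> (2 ^ j)" using G_large by (simp add: filterlim_at_top)
  then obtain j0 where j0: "\<And>j. j \<ge> j0 \<Longrightarrow> K \<le> 2 ^ j * G j / \<psi> (2 ^ j)"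
    unfolding eventually_sequentially by blast
  have "\<forall>\<^sub>F N in sequentially. \<forall>b\<in>{..<2 ^ j0}. K \<le> real N * G (floor_log b)"
  proof (rule eventually_ball_finite, simp, rule ballI)
    fix b
    have "filterlim (\<lambda>N. G (floor_log b) * real N) at_top sequentially"
      using G_pos by (intro filterlim_tendsto_pos_mult_at_top[OF tendsto_const _ filterlim_real_sequentially]) auto
    then show "\<forall>\<^sub>F N in sequentially. K \<le> real N * G (floor_log b)" by (simp add: filterlim_at_top mult.commute)
  qed
  moreover have "\<forall>\<^sub>F N in sequentially. 2 / \<eta> \<le> real N"
    using filterlim_real_sequentially by (simp add: filterlim_at_top)
  moreover have "\<forall>\<^sub>F N in sequentially. (0::nat) < N" by (rule eventually_gt_at_top)
  ultimately show ?thesis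
  proof eventually_elim
    case (elim N)
    show ?case
    proof
      fix b assume b: "b \<in> {1..N}"
      let ?g = "G (floor_log b)"
      have "K \<le> real N * ?g"
      proof (cases "b < 2 ^ j0")
        case True
        then show ?thesis using elim by simp
      next
        case False
        then have "j0 \<le> floor_log b" using floor_log_le_iff[of "2 ^ j0" b] by simp
        then have "K \<le> 2 ^ floor_log b * ?g / \<psi> (2 ^ floor_log b)" by (rule j0)
        also have "\<dots> \<le> 2 ^ floor_log b * ?g / 1"
          using \<psi>_ge[of "2 ^ floor_log b"] G_pos[of "floor_log b"] by (intro divide_left_mono) auto
        also have "\<dots> \<le> real N * ?g"
        proof -
          have "2 ^ floor_log b \<le> N" using b floor_log_exp2_le[of b] by auto
          then have "real (2 ^ floor_log b) \<le> real N" by (rule of_nat_mono)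
          then show ?thesis using G_pos[of "floor_log b"] by simp
        qed
        finally show ?thesis .
      qed
      then have "2 / (\<alpha> * ?g) \<le> \<eta> / 2 * real N"
        using \<eta> \<alpha>_pos G_pos[of "floor_log b"] by (simp add: K_def field_simps)
      moreover have "1 \<le> \<eta> / 2 * real N" using elim(2) \<eta> by (simp add: field_simps)
      ultimately have "1 + 2 / (\<alpha> * ?g) \<le> \<eta> * real N" by linarith
      then show "(1 + 2 / (\<alpha> * ?g)) / real N \<le> \<eta>" using elim(3) by (simp add: field_simps)
    qed
  qed
qed

end

section \<open>Independent uniform perturbations\<close>

abbreviation unif :: "real measure" where "unif \<equiv> uniform_measure lborel {0..1}"
abbreviation Unif :: "(nat \<Rightarrow> real) measure" where "Unif \<equiv> Pi\<^sub>M UNIV (\<lambda>_. unif)"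

lemma prob_space_unif: "prob_space unif"
  by (rule prob_space_uniform_measure) auto

lemma prob_space_Unif: "prob_space Unif"
  by (intro prob_space_PiM prob_space_unif)

lemma space_Unif [simp]: "space Unif = UNIV"
  by (simp add: space_PiM)

text \<open>Overwriting coordinate \<open>b\<close> by an independent uniform value preserves the
  product measure, so Fubini integrates out that coordinate alone. This takes the place of
  conditioning on all other coordinates.\<close>

lemma measure_Unif_resample:
  assumes A [measurable]: "A \<in> sets Unif"
  shows "measure Unif A = (\<integral>\<omega>. measure unif {t. fun_upd \<omega> b t \<in> A} \<partial>Unif)"
    and "(\<lambda>\<omega>. measure unif {t. fun_upd \<omega> b t \<in> A}) \<in> borel_measurable Unif"
proof -
  interpret u: prob_space unif by (rule prob_space_unif)
  interpret U: prob_space Unif by (rule prob_space_Unif)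
  interpret P: pair_sigma_finite unif Unif ..
  let ?f = "\<lambda>(t, \<omega>). fun_upd \<omega> b (t :: real)"
  have f [measurable]: "?f \<in> measurable (unif \<Otimes>\<^sub>M Unif) Unif"
  proof (rule measurable_PiM_single')
    fix i :: nat
    have "(\<lambda>p. if i = b then fst p else snd p i) \<in> measurable (unif \<Otimes>\<^sub>M Unif) unif"
      by (cases "i = b") simp_all
    then show "(\<lambda>p. (case p of (t, \<omega>) \<Rightarrow> fun_upd \<omega> b t) i) \<in> measurable (unif \<Otimes>\<^sub>M Unif) unif"
      by (simp add: case_prod_beta fun_upd_def)
  qed auto
  have distr: "distr (unif \<Otimes>\<^sub>M Unif) Unif ?f = Unif"
    using distr_pair_PiM_eq_PiM[of UNIV "\<lambda>_. unif" b] prob_space_unif by simp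
  let ?S = "?f -` A \<inter> space (unif \<Otimes>\<^sub>M Unif)"
  have S: "?S \<in> sets (unif \<Otimes>\<^sub>M Unif)" by (rule measurable_sets[OF f A])
  have sec: "(\<lambda>t. (t, \<omega>)) -` ?S = {t. fun_upd \<omega> b t \<in> A}" for \<omega>
    by (auto simp: space_pair_measure)
  have "emeasure Unif A = emeasure (distr (unif \<Otimes>\<^sub>M Unif) Unif ?f) A" by (simp only: distr)
  also have "\<dots> = emeasure (unif \<Otimes>\<^sub>M Unif) ?S" by (rule emeasure_distr[OF f A])
  also have "\<dots> = (\<integral>\<^sup>+\<omega>. emeasure unif {t. fun_upd \<omega> b t \<in> A} \<partial>Unif)"
    unfolding P.emeasure_pair_measure_alt2[OF S] sec ..
  finally have em: "emeasure Unif A = (\<integral>\<^sup>+\<omega>. ennreal (measure unif {t. fun_upd \<omega> b t \<in> A}) \<partial>Unif)"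
    by (simp add: u.emeasure_eq_measure)
  have "(\<lambda>\<omega>. emeasure unif ((\<lambda>t. (t, \<omega>)) -` ?S)) \<in> borel_measurable Unif"
    by (rule P.measurable_emeasure_Pair2[OF S])
  then have "(\<lambda>\<omega>. enn2real (emeasure unif {t. fun_upd \<omega> b t \<in> A})) \<in> borel_measurable Unif"
    unfolding sec by measurable
  then show m: "(\<lambda>\<omega>. measure unif {t. fun_upd \<omega> b t \<in> A}) \<in> borel_measurable Unif"
    by (simp add: measure_def)
  have "(\<integral>\<omega>. measure unif {t. fun_upd \<omega> b t \<in> A} \<partial>Unif) = enn2real (emeasure Unif A)"
    unfolding em by (rule integral_eq_nn_integral[OF m]) auto
  then show "measure Unif A = (\<integral>\<omega>. measure unif {t. fun_upd \<omega> b t \<in> A} \<partial>Unif)"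
    by (simp add: measure_def)
qed

lemma measure_unif_eq:
  assumes "S \<in> sets lborel"
  shows "measure unif S = measure lborel {t\<in>{0..1}. t \<in> S}"
proof -
  have "{t\<in>{0..1}. t \<in> S} = {0..1} \<inter> S" by auto
  then show ?thesis using assms by (simp add: measure_def emeasure_uniform_measure divide_ennreal_def)
qed

lemma measure_Unif_Int_disjoint_support:
  assumes A: "A \<in> sets Unif" and B: "B \<in> sets Unif" and IJ: "I \<inter> J = {}"
    and suppA: "\<And>\<omega> \<omega>'. (\<And>i. i \<in> I \<Longrightarrow> \<omega> i = \<omega>' i) \<Longrightarrow> \<omega> \<in> A \<longleftrightarrow> \<omega>' \<in> A"
    and suppB: "\<And>\<omega> \<omega>'. (\<And>i. i \<in> J \<Longrightarrow> \<omega> i = \<omega>' i) \<Longrightarrow> \<omega> \<in> B \<longleftrightarrow> \<omega>' \<in> B"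
  shows "measure Unif (A \<inter> B) = measure Unif A * measure Unif B"
proof -
  interpret U: prob_space Unif by (rule prob_space_Unif)
  have "distr Unif unif (\<lambda>\<omega>. \<omega> i) = unif" for i
    by (rule distr_PiM_component) (auto intro: prob_space_unif)
  then have "U.indep_vars (\<lambda>_. unif) (\<lambda>i \<omega>. \<omega> i) UNIV"
    by (subst U.indep_vars_iff_distr_eq_PiM') (auto simp: restrict_UNIV distr_id)
  then have ind: "U.indep_var (PiM I (\<lambda>_. unif)) (\<lambda>\<omega>. restrict \<omega> I) (PiM J (\<lambda>_. unif)) (\<lambda>\<omega>. restrict \<omega> J)"
    by (rule U.indep_var_restrict[where X = "\<lambda>i \<omega>. \<omega> i", simplified]) (use IJ in auto)
  \<comment> \<open>Filling the missing coordinates with 0 turns a restricted family into a point of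
    the full product. The value is immaterial since membership depends only on the coordinates in
    the support.\<close>
  define e where "e = (\<lambda>(K::nat set) (\<omega>::nat \<Rightarrow> real) i. if i \<in> K then \<omega> i else 0)"
  have e [measurable]: "e K \<in> measurable (PiM K (\<lambda>_. unif)) Unif" for K
  proof (rule measurable_PiM_single')
    fix i :: nat
    show "(\<lambda>\<omega>. e K \<omega> i) \<in> measurable (PiM K (\<lambda>_. unif)) unif"
      unfolding e_def by (cases "i \<in> K") simp_all
  qed auto
  define A' where "A' = e I -` A \<inter> space (PiM I (\<lambda>_. unif))"
  define B' where "B' = e J -` B \<inter> space (PiM J (\<lambda>_. unif))"
  have A': "A' \<in> sets (PiM I (\<lambda>_. unif))" "B' \<in> sets (PiM J (\<lambda>_. unif))"
    unfolding A'_def B'_def using A B by (auto intro: measurable_sets[OF e])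
  have mA: "restrict \<omega> I \<in> A' \<longleftrightarrow> \<omega> \<in> A" for \<omega>
    unfolding A'_def using suppA[of "e I (restrict \<omega> I)" \<omega>] by (auto simp: space_PiM e_def)
  have mB: "restrict \<omega> J \<in> B' \<longleftrightarrow> \<omega> \<in> B" for \<omega>
    unfolding B'_def using suppB[of "e J (restrict \<omega> J)" \<omega>] by (auto simp: space_PiM e_def)
  have 1: "(\<lambda>\<omega>. (restrict \<omega> I, restrict \<omega> J)) -` (A' \<times> B') \<inter> space Unif = A \<inter> B"
    using mA mB by auto
  have 2: "(\<lambda>\<omega>. restrict \<omega> I) -` A' \<inter> space Unif = A" using mA by auto
  have 3: "(\<lambda>\<omega>. restrict \<omega> J) -` B' \<inter> space Unif = B" using mB by auto
  show ?thesis using U.indep_varD[OF ind A'] unfolding 1 2 3 .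
qed

section \<open>Expected number of close tuples\<close>

lemma finite_tuples: "finite (tuples k N)"
  unfolding tuples_def
  by (rule finite_subset[OF _ finite_lists_length_eq[of "{1..N}" k]]) auto

text \<open>Tuples grow at the end, so that entry 0, from which all differences are measured, never
  changes.\<close>

lemma sum_tuples_Suc:
  fixes f :: "nat list \<Rightarrow> real"
  shows "(\<Sum>as\<in>tuples (Suc k) N. f as) = (\<Sum>as\<in>tuples k N. \<Sum>b\<in>{1..N} - set as. f (as @ [b]))"
proof -
  have "(\<Sum>as\<in>tuples k N. \<Sum>b\<in>{1..N} - set as. f (as @ [b]))
      = (\<Sum>(as, b)\<in>(SIGMA as:tuples k N. {1..N} - set as). f (as @ [b]))"
    by (intro sum.Sigma finite_tuples) auto
  also have "\<dots> = (\<Sum>as\<in>tuples (Suc k) N. f as)"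
  proof (rule sum.reindex_bij_witness[where i = "\<lambda>as. (butlast as, last as)" and j = "\<lambda>(as, b). as @ [b]"])
    fix as assume as: "as \<in> tuples (Suc k) N"
    then obtain bs b where "as = bs @ [b]" unfolding tuples_def by (cases as rule: rev_cases) auto
    with as show "(butlast as, last as) \<in> (SIGMA as:tuples k N. {1..N} - set as)"
      "(case (butlast as, last as) of (as, b) \<Rightarrow> as @ [b]) = as"
      by (auto simp: tuples_def)
  qed (auto simp: tuples_def)
  finally show ?thesis ..
qed

context perturbed_rotation
begin

definition pt :: "(nat \<Rightarrow> real) \<Rightarrow> nat \<Rightarrow> real" where
  "pt \<omega> n = \<alpha> * (2 * real n + G (floor_log n) * \<omega> n)"

definition close :: "(nat \<Rightarrow> real) \<Rightarrow> (nat \<Rightarrow> real) \<Rightarrow> nat list \<Rightarrow> (nat \<Rightarrow> real) set" where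
  "close lo hi as = {\<omega>. \<forall>i\<in>{1..<length as}. in_mod1 (pt \<omega> (as ! 0) - pt \<omega> (as ! i)) (lo i) (hi i)}"

lemma measurable_pt [measurable]: "(\<lambda>\<omega>. pt \<omega> n) \<in> borel_measurable Unif"
proof -
  have "(\<lambda>\<omega>. \<omega> n) \<in> measurable Unif unif" by simp
  then have [measurable]: "(\<lambda>\<omega>. \<omega> n) \<in> borel_measurable Unif"
    by (simp cong: measurable_cong_sets)
  show ?thesis unfolding pt_def by measurable
qed

lemma sets_close [measurable]: "close lo hi as \<in> sets Unif"
proof -
  have "{\<omega> \<in> space Unif. \<forall>i\<in>{1..<length as}. in_mod1 (pt \<omega> (as ! 0) - pt \<omega> (as ! i)) (lo i) (hi i)} \<in> sets Unif"
    by measurable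
  then show ?thesis by (simp add: close_def)
qed

text \<open>Coordinate \<open>b\<close> occurs only in the last condition, as \<open>b\<close> is
  not in \<open>as\<close>. Integrating it out leaves the earlier conditions as an indicator and
  turns the last one into a hit probability around the random position of the first point.\<close>

lemma measure_close_snoc:
  assumes b: "b \<notin> set as" and as: "as \<noteq> []"
  defines "k \<equiv> length as"
  shows "measure Unif (close lo hi (as @ [b])) =
      (\<integral>\<omega>. indicator (close lo hi as) \<omega> * hit_prob (pt \<omega> (as ! 0)) (lo k) (hi k) b \<partial>Unif)"
    and "integrable Unif (\<lambda>\<omega>. indicator (close lo hi as) \<omega> * hit_prob (pt \<omega> (as ! 0)) (lo k) (hi k) b)"
proof -
  interpret U: prob_space Unif by (rule prob_space_Unif)
  interpret u: prob_space unif by (rule prob_space_unif)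
  let ?v = "\<lambda>\<omega>. pt \<omega> (as ! 0) - 2 * \<alpha> * real b"
  let ?S = "\<lambda>\<omega>. {t. in_mod1 (?v \<omega> - (\<alpha> * G (floor_log b)) * t) (lo k) (hi k)}"
  have upd: "pt (fun_upd \<omega> b t) n = pt \<omega> n" if "n \<noteq> b" for \<omega> t n
    using that by (simp add: pt_def)
  have updb: "pt (fun_upd \<omega> b t) b = \<alpha> * (2 * real b + G (floor_log b) * t)" for \<omega> t
    by (simp add: pt_def)
  have nth: "as ! i \<noteq> b" if "i < k" for i using that b by (auto simp: k_def)
  have k0: "0 < k" using as by (simp add: k_def)
  have set_eq: "{t. fun_upd \<omega> b t \<in> close lo hi (as @ [b])} = (if \<omega> \<in> close lo hi as then ?S \<omega> else {})" for \<omega>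
  proof -
    have "fun_upd \<omega> b t \<in> close lo hi (as @ [b]) \<longleftrightarrow> \<omega> \<in> close lo hi as \<and> t \<in> ?S \<omega>" for t
    proof -
      have "{1..<length (as @ [b])} = insert k {1..<k}" using k0 by (auto simp: k_def Suc_le_eq)
      then have "fun_upd \<omega> b t \<in> close lo hi (as @ [b]) \<longleftrightarrow>
         in_mod1 (pt (fun_upd \<omega> b t) ((as @ [b]) ! 0) - pt (fun_upd \<omega> b t) ((as @ [b]) ! k)) (lo k) (hi k) \<and>
         (\<forall>i\<in>{1..<k}. in_mod1 (pt (fun_upd \<omega> b t) ((as @ [b]) ! 0) - pt (fun_upd \<omega> b t) ((as @ [b]) ! i)) (lo i) (hi i))"
        unfolding close_def by simp
      also have "\<dots> \<longleftrightarrow> t \<in> ?S \<omega> \<and> (\<forall>i\<in>{1..<k}. in_mod1 (pt \<omega> (as ! 0) - pt \<omega> (as ! i)) (lo i) (hi i))"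
      proof (intro arg_cong2[where f = "(\<and>)"] ball_cong refl)
        show "in_mod1 (pt (fun_upd \<omega> b t) ((as @ [b]) ! 0) - pt (fun_upd \<omega> b t) ((as @ [b]) ! k)) (lo k) (hi k)
           = (t \<in> ?S \<omega>)"
          using k0 nth[of 0] by (simp add: nth_append upd updb k_def[symmetric] algebra_simps)
        fix i assume "i \<in> {1..<k}"
        then show "in_mod1 (pt (fun_upd \<omega> b t) ((as @ [b]) ! 0) - pt (fun_upd \<omega> b t) ((as @ [b]) ! i)) (lo i) (hi i)
           = in_mod1 (pt \<omega> (as ! 0) - pt \<omega> (as ! i)) (lo i) (hi i)"
          using k0 nth[of 0] nth[of i] by (simp add: nth_append upd k_def[symmetric])
      qed
      finally show ?thesis by (auto simp: close_def k_def)
    qed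
    then show ?thesis by auto
  qed
  have "?S \<omega> = {t \<in> space lborel. in_mod1 (?v \<omega> - (\<alpha> * G (floor_log b)) * t) (lo k) (hi k)}" for \<omega> by simp
  also have "\<dots> \<omega> \<in> sets lborel" for \<omega> by measurable
  finally have S: "?S \<omega> \<in> sets lborel" for \<omega> .
  have "measure unif (?S \<omega>) = hit_prob (pt \<omega> (as ! 0)) (lo k) (hi k) b" for \<omega>
    unfolding measure_unif_eq[OF S] hit_prob_def arc_prob_def by simp
  then have eq: "measure unif {t. fun_upd \<omega> b t \<in> close lo hi (as @ [b])} =
      indicator (close lo hi as) \<omega> * hit_prob (pt \<omega> (as ! 0)) (lo k) (hi k) b" for \<omega>
    unfolding set_eq by (auto simp: indicator_def)
  show "measure Unif (close lo hi (as @ [b])) =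
      (\<integral>\<omega>. indicator (close lo hi as) \<omega> * hit_prob (pt \<omega> (as ! 0)) (lo k) (hi k) b \<partial>Unif)"
    unfolding eq[symmetric] by (rule measure_Unif_resample) measurable
  show "integrable Unif (\<lambda>\<omega>. indicator (close lo hi as) \<omega> * hit_prob (pt \<omega> (as ! 0)) (lo k) (hi k) b)"
    unfolding eq[symmetric]
  proof (rule U.integrable_const_bound[of _ 1])
    show "(\<lambda>\<omega>. measure unif {t. fun_upd \<omega> b t \<in> close lo hi (as @ [b])}) \<in> borel_measurable Unif"
      by (rule measure_Unif_resample(2)) measurable
  qed simp
qed

text \<open>The summed hit probabilities depend on the random centre, but their bounds do not. The
  bounds leave the integral as constants, without any knowledge of the joint law of centre and
  earlier conditions.\<close>

lemma sum_measure_close_snoc: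
  assumes as: "as \<noteq> []" and B: "finite B" "B \<inter> set as = {}"
    and bounds: "\<And>y. c1 \<le> (\<Sum>b\<in>B. hit_prob y (lo (length as)) (hi (length as)) b)"
      "\<And>y. (\<Sum>b\<in>B. hit_prob y (lo (length as)) (hi (length as)) b) \<le> c2"
  shows "c1 * measure Unif (close lo hi as) \<le> (\<Sum>b\<in>B. measure Unif (close lo hi (as @ [b])))"
    and "(\<Sum>b\<in>B. measure Unif (close lo hi (as @ [b]))) \<le> c2 * measure Unif (close lo hi as)"
proof -
  interpret U: prob_space Unif by (rule prob_space_Unif)
  let ?k = "length as"
  let ?h = "\<lambda>b \<omega>. indicator (close lo hi as) \<omega> * hit_prob (pt \<omega> (as ! 0)) (lo ?k) (hi ?k) b"
  have nb: "b \<notin> set as" if "b \<in> B" for b using that B by auto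
  have "(\<Sum>b\<in>B. measure Unif (close lo hi (as @ [b]))) = (\<Sum>b\<in>B. \<integral>\<omega>. ?h b \<omega> \<partial>Unif)"
    using nb as by (intro sum.cong refl measure_close_snoc(1))
  also have "\<dots> = (\<integral>\<omega>. (\<Sum>b\<in>B. ?h b \<omega>) \<partial>Unif)"
    using nb as by (intro Bochner_Integration.integral_sum[symmetric] measure_close_snoc(2))
  finally have eq: "(\<Sum>b\<in>B. measure Unif (close lo hi (as @ [b]))) = (\<integral>\<omega>. (\<Sum>b\<in>B. ?h b \<omega>) \<partial>Unif)" .
  have int: "integrable Unif (\<lambda>\<omega>. \<Sum>b\<in>B. ?h b \<omega>)"
    using nb as by (intro Bochner_Integration.integrable_sum measure_close_snoc(2))
  have int_c: "integrable Unif (\<lambda>\<omega>. c * indicator (close lo hi as) \<omega> :: real)" for c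
    by (intro integrable_mult_right integrable_real_indicator) (auto simp: U.emeasure_eq_measure)
  have sum_eq: "(\<Sum>b\<in>B. ?h b \<omega>) = (\<Sum>b\<in>B. hit_prob (pt \<omega> (as ! 0)) (lo ?k) (hi ?k) b) * indicator (close lo hi as) \<omega>" for \<omega>
    by (subst sum_distrib_left[symmetric]) (rule mult.commute)
  have "(\<integral>\<omega>. c1 * indicator (close lo hi as) \<omega> \<partial>Unif) \<le> (\<integral>\<omega>. (\<Sum>b\<in>B. ?h b \<omega>) \<partial>Unif)"
    by (intro integral_mono int int_c) (simp add: sum_eq mult_right_mono bounds)
  then show "c1 * measure Unif (close lo hi as) \<le> (\<Sum>b\<in>B. measure Unif (close lo hi (as @ [b])))"
    unfolding eq by simp
  have "(\<integral>\<omega>. (\<Sum>b\<in>B. ?h b \<omega>) \<partial>Unif) \<le> (\<integral>\<omega>. c2 * indicator (close lo hi as) \<omega> \<partial>Unif)"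
    by (intro integral_mono int int_c) (simp add: sum_eq mult_right_mono bounds)
  then show "(\<Sum>b\<in>B. measure Unif (close lo hi (as @ [b]))) \<le> c2 * measure Unif (close lo hi as)"
    unfolding eq by simp
qed

definition mean_count :: "nat \<Rightarrow> (nat \<Rightarrow> real) \<Rightarrow> (nat \<Rightarrow> real) \<Rightarrow> nat \<Rightarrow> real" where
  "mean_count k lo hi N = (\<Sum>as\<in>tuples k N. measure Unif (close lo hi as))"

lemma mean_count_1: "mean_count 1 lo hi N = real N"
proof -
  interpret U: prob_space Unif by (rule prob_space_Unif)
  have "tuples 1 N = (\<lambda>a. [a]) ` {1..N}" by (auto simp: tuples_def length_Suc_conv)
  then have card: "card (tuples 1 N) = N" by (simp add: card_image inj_on_def)
  have "mean_count 1 lo hi N = (\<Sum>as\<in>tuples 1 N. 1)"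
    unfolding mean_count_def
  proof (rule sum.cong[OF refl])
    fix as assume "as \<in> tuples 1 N"
    then have "close lo hi as = space Unif" by (simp add: close_def tuples_def)
    then show "measure Unif (close lo hi as) = 1" using U.prob_space by simp
  qed
  then show ?thesis using card by simp
qed

text \<open>Each further index multiplies the mean by a factor between \<open>L i - k * D i\<close>
  and \<open>U i\<close>, where \<open>k * D i\<close> pays for the at most k excluded indices.
  Nonnegativity of the lower factors lets the lower bounds be multiplied.\<close>

lemma mean_count_bounds:
  assumes k: "1 \<le> k"
    and U: "\<And>i y. 1 \<le> i \<Longrightarrow> i < k \<Longrightarrow> (\<Sum>b\<in>{1..N}. hit_prob y (lo i) (hi i) b) \<le> U i"
    and L: "\<And>i y. 1 \<le> i \<Longrightarrow> i < k \<Longrightarrow> L i \<le> (\<Sum>b\<in>{1..N}. hit_prob y (lo i) (hi i) b)"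
    and D: "\<And>i y b. 1 \<le> i \<Longrightarrow> i < k \<Longrightarrow> b \<in> {1..N} \<Longrightarrow> hit_prob y (lo i) (hi i) b \<le> D i"
    and pos: "\<And>i. 1 \<le> i \<Longrightarrow> i < k \<Longrightarrow> 0 \<le> L i - real k * D i" "\<And>i. 1 \<le> i \<Longrightarrow> i < k \<Longrightarrow> 0 \<le> D i"
  shows "real N * (\<Prod>i\<in>{1..<k}. L i - real k * D i) \<le> mean_count k lo hi N \<and>
    mean_count k lo hi N \<le> real N * (\<Prod>i\<in>{1..<k}. U i)"
proof -
  have "real N * (\<Prod>i\<in>{1..<m}. L i - real k * D i) \<le> mean_count m lo hi N \<and>
    mean_count m lo hi N \<le> real N * (\<Prod>i\<in>{1..<m}. U i)" if "1 \<le> m" "m \<le> k" for m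
    using that
  proof (induction m rule: dec_induct)
    case base
    show ?case using mean_count_1[of lo hi N] by simp
  next
    case (step m)
    then have m: "1 \<le> m" "m < k" by auto
    have split: "{1..<Suc m} = insert m {1..<m}" using m by auto
    have ms: "mean_count (Suc m) lo hi N = (\<Sum>as\<in>tuples m N. \<Sum>b\<in>{1..N} - set as. measure Unif (close lo hi (as @ [b])))"
      unfolding mean_count_def by (rule sum_tuples_Suc)
    have U0: "0 \<le> U m" using U[OF m, of 0] sum_nonneg[of "{1..N}" "hit_prob 0 (lo m) (hi m)"] hit_prob_nonneg
      by (meson order_trans)
    have bnd: "(L m - real k * D m) * measure Unif (close lo hi as) \<le> (\<Sum>b\<in>{1..N} - set as. measure Unif (close lo hi (as @ [b])))
      \<and> (\<Sum>b\<in>{1..N} - set as. measure Unif (close lo hi (as @ [b]))) \<le> U m * measure Unif (close lo hi as)"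
      if as: "as \<in> tuples m N" for as
    proof -
      have len: "length as = m" "as \<noteq> []" "card (set as) = m" "set as \<subseteq> {1..N}"
        using as m by (auto simp: tuples_def distinct_card)
      have sum_split: "(\<Sum>b\<in>{1..N} - set as. hit_prob y (lo m) (hi m) b) =
         (\<Sum>b\<in>{1..N}. hit_prob y (lo m) (hi m) b) - (\<Sum>b\<in>set as. hit_prob y (lo m) (hi m) b)" for y
        using len by (subst sum_diff) auto
      have "(\<Sum>b\<in>set as. hit_prob y (lo m) (hi m) b) \<le> real (card (set as)) * D m" for y
        using len D[OF m] by (intro sum_bounded_above) auto
      moreover have "real (card (set as)) * D m \<le> real k * D m"
        using len m pos(2)[OF m] by (intro mult_right_mono) auto
      ultimately have lower: "L m - real k * D m \<le> (\<Sum>b\<in>{1..N} - set as. hit_prob y (lo m) (hi m) b)" for y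
        unfolding sum_split using L[OF m, of y] by (smt (verit))
      have upper: "(\<Sum>b\<in>{1..N} - set as. hit_prob y (lo m) (hi m) b) \<le> U m" for y
        unfolding sum_split using U[OF m, of y] sum_nonneg[of "set as" "hit_prob y (lo m) (hi m)"] hit_prob_nonneg
        by (smt (verit))
      show ?thesis
        using sum_measure_close_snoc[of as "{1..N} - set as" "L m - real k * D m" lo hi "U m"] len lower upper by auto
    qed
    have 1: "(L m - real k * D m) * mean_count m lo hi N \<le> mean_count (Suc m) lo hi N"
      unfolding ms unfolding mean_count_def sum_distrib_left using bnd by (intro sum_mono) blast
    have 2: "mean_count (Suc m) lo hi N \<le> U m * mean_count m lo hi N"
      unfolding ms unfolding mean_count_def sum_distrib_left using bnd by (intro sum_mono) blast
    have IH: "real N * (\<Prod>i\<in>{1..<m}. L i - real k * D i) \<le> mean_count m lo hi N"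
      "mean_count m lo hi N \<le> real N * (\<Prod>i\<in>{1..<m}. U i)" using step by auto
    have "(L m - real k * D m) * (real N * (\<Prod>i\<in>{1..<m}. L i - real k * D i)) \<le> mean_count (Suc m) lo hi N"
      using mult_left_mono[OF IH(1) pos(1)[OF m]] 1 by linarith
    moreover have "mean_count (Suc m) lo hi N \<le> U m * (real N * (\<Prod>i\<in>{1..<m}. U i))"
      using mult_left_mono[OF IH(2) U0] 2 by linarith
    ultimately show ?case unfolding split by (simp add: mult_ac)
  qed
  then show ?thesis using k by blast
qed

text \<open>Arbitrary tuple lengths are covered because the variance estimate applies this limit to
  merged tuples as well.\<close>

lemma mean_count_limit:
  assumes k: "1 \<le> k" and lh: "\<And>i. 1 \<le> i \<Longrightarrow> i < k \<Longrightarrow> l i < h i"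
  shows "(\<lambda>N. mean_count k (\<lambda>i. l i / real N) (\<lambda>i. h i / real N) N / real N) \<longlonglongrightarrow> (\<Prod>i\<in>{1..<k}. h i - l i)"
proof -
  let ?m = "\<lambda>N. mean_count k (\<lambda>i. l i / real N) (\<lambda>i. h i / real N) N / real N"
  let ?P = "\<Prod>i\<in>{1..<k}. h i - l i"
  \<comment> \<open>In the lower factor one \<eta> comes from the summed hit probabilities and k
    times \<eta> from the excluded indices, together k + 1.\<close>
  have bnd: "\<forall>\<^sub>F N in sequentially. (\<Prod>i\<in>{1..<k}. (h i - l i) * (1 - (real k + 1) * \<eta>)) \<le> ?m N \<and> ?m N \<le> (\<Prod>i\<in>{1..<k}. (h i - l i) * (1 + \<eta>))"
    if \<eta>: "0 < \<eta>" "(real k + 1) * \<eta> \<le> 1" for \<eta>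
  proof -
    have "\<forall>\<^sub>F N in sequentially. \<forall>i\<in>{1..<k}. (h i - l i) / real N \<le> 1/2"
    proof (rule eventually_ball_finite, simp, rule ballI)
      fix i
      have "(\<lambda>N. (h i - l i) / real N) \<longlonglongrightarrow> 0" by real_asymp
      from order_tendstoD(2)[OF this, of "1/2"] show "\<forall>\<^sub>F N in sequentially. (h i - l i) / real N \<le> 1/2"
        by (auto elim: eventually_mono)
    qed
    moreover have "\<forall>\<^sub>F N in sequentially. (0::nat) < N" by (rule eventually_gt_at_top)
    moreover note sum_hit_prob[OF \<eta>(1)] hit_prob_uniformly_small[OF \<eta>(1)]
    ultimately show ?thesis
    proof eventually_elim
      case (elim N)
      let ?lo = "\<lambda>i. l i / real N" and ?hi = "\<lambda>i. h i / real N"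
      have N: "real N > 0" using elim by simp
      have diff: "?hi i - ?lo i = (h i - l i) / real N" for i by (simp add: diff_divide_distrib)
      have half: "?hi i - ?lo i \<le> 1/2" "?lo i \<le> ?hi i" if "1 \<le> i" "i < k" for i
        using elim(1) that lh[OF that] N unfolding diff by (auto simp: divide_right_mono)
      have s: "\<bar>(\<Sum>b\<in>{1..N}. hit_prob y (?lo i) (?hi i) b) - (h i - l i)\<bar> \<le> \<eta> * (h i - l i)" if i: "1 \<le> i" "i < k" for i y
      proof -
        have "\<bar>(\<Sum>b\<in>{1..N}. hit_prob y (?lo i) (?hi i) b) - real N * (?hi i - ?lo i)\<bar> \<le> \<eta> * real N * (?hi i - ?lo i)"
          using elim(3) half[OF i] by blast
        moreover have "real N * (?hi i - ?lo i) = h i - l i" using N by (simp add: field_simps)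
        ultimately show ?thesis by (simp add: mult.assoc)
      qed
      have "real N * (\<Prod>i\<in>{1..<k}. (h i - l i) * (1 - \<eta>) - real k * (\<eta> * (h i - l i))) \<le> mean_count k ?lo ?hi N \<and>
        mean_count k ?lo ?hi N \<le> real N * (\<Prod>i\<in>{1..<k}. (h i - l i) * (1 + \<eta>))"
      proof (rule mean_count_bounds[OF k])
        fix i y assume i: "1 \<le> i" "i < k"
        show "(\<Sum>b\<in>{1..N}. hit_prob y (?lo i) (?hi i) b) \<le> (h i - l i) * (1 + \<eta>)"
          "(h i - l i) * (1 - \<eta>) \<le> (\<Sum>b\<in>{1..N}. hit_prob y (?lo i) (?hi i) b)"
          using s[OF i, of y] by (auto simp: abs_le_iff algebra_simps)
        fix b assume b: "b \<in> {1..N}"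
        have "hit_prob y (?lo i) (?hi i) b \<le> (?hi i - ?lo i) * (1 + 2 / (\<alpha> * G (floor_log b)))"
          using half[OF i] by (intro hit_prob_le) linarith+
        also have "\<dots> = (h i - l i) * ((1 + 2 / (\<alpha> * G (floor_log b))) / real N)" unfolding diff by simp
        also have "\<dots> \<le> (h i - l i) * \<eta>" using elim(4) b lh[OF i] by (intro mult_left_mono) auto
        finally show "hit_prob y (?lo i) (?hi i) b \<le> \<eta> * (h i - l i)" by (simp add: mult.commute)
      next
        fix i assume i: "1 \<le> i" "i < k"
        have "(h i - l i) * (1 - \<eta>) - real k * (\<eta> * (h i - l i)) = (h i - l i) * (1 - (real k + 1) * \<eta>)"
          by (simp add: algebra_simps)
        then show "0 \<le> (h i - l i) * (1 - \<eta>) - real k * (\<eta> * (h i - l i))" using \<eta> lh[OF i] by simp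
        show "0 \<le> \<eta> * (h i - l i)" using \<eta> lh[OF i] by simp
      qed
      moreover have "(\<Prod>i\<in>{1..<k}. (h i - l i) * (1 - \<eta>) - real k * (\<eta> * (h i - l i))) = (\<Prod>i\<in>{1..<k}. (h i - l i) * (1 - (real k + 1) * \<eta>))"
        by (intro prod.cong) (auto simp: algebra_simps)
      ultimately show ?case using N by (simp add: field_simps)
    qed
  qed
  have lim1: "((\<lambda>\<eta>. \<Prod>i\<in>{1..<k}. (h i - l i) * (1 - (real k + 1) * \<eta>)) \<longlongrightarrow> (\<Prod>i\<in>{1..<k}. (h i - l i) * (1 - (real k + 1) * 0))) (at_right 0)"
    by (intro tendsto_intros)
  have lim2: "((\<lambda>\<eta>. \<Prod>i\<in>{1..<k}. (h i - l i) * (1 + \<eta>)) \<longlongrightarrow> (\<Prod>i\<in>{1..<k}. (h i - l i) * (1 + 0))) (at_right 0)"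
    by (intro tendsto_intros)
  have "((\<lambda>\<eta>. (real k + 1) * \<eta>) \<longlongrightarrow> (real k + 1) * 0) (at_right 0)" by (intro tendsto_intros)
  then have small: "\<forall>\<^sub>F \<eta> in at_right 0. (real k + 1) * \<eta> < 1" by (intro order_tendstoD(2)) auto
  have pos: "\<forall>\<^sub>F \<eta> in at_right (0::real). 0 < \<eta>" by (rule eventually_at_right_less)
  show ?thesis
  proof (rule order_tendstoI)
    fix a assume "a < ?P"
    then have "\<forall>\<^sub>F \<eta> in at_right 0. a < (\<Prod>i\<in>{1..<k}. (h i - l i) * (1 - (real k + 1) * \<eta>))"
      using order_tendstoD(1)[OF lim1, of a] by simp
    with small pos have "\<forall>\<^sub>F \<eta> in at_right 0. a < (\<Prod>i\<in>{1..<k}. (h i - l i) * (1 - (real k + 1) * \<eta>)) \<and> 0 < \<eta> \<and> (real k + 1) * \<eta> < 1"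
      by eventually_elim auto
    then obtain \<eta> where "a < (\<Prod>i\<in>{1..<k}. (h i - l i) * (1 - (real k + 1) * \<eta>))" "0 < \<eta>" "(real k + 1) * \<eta> \<le> 1"
      using eventually_happens' trivial_limit_at_right_real[of 0] by (metis (no_types, lifting) less_imp_le)
    with bnd[of \<eta>] show "\<forall>\<^sub>F N in sequentially. a < ?m N" by (auto elim!: eventually_mono)
  next
    fix a assume "?P < a"
    then have "\<forall>\<^sub>F \<eta> in at_right 0. (\<Prod>i\<in>{1..<k}. (h i - l i) * (1 + \<eta>)) < a"
      using order_tendstoD(2)[OF lim2, of a] by simp
    with small pos have "\<forall>\<^sub>F \<eta> in at_right 0. (\<Prod>i\<in>{1..<k}. (h i - l i) * (1 + \<eta>)) < a \<and> 0 < \<eta> \<and> (real k + 1) * \<eta> < 1"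
      by eventually_elim auto
    then obtain \<eta> where "(\<Prod>i\<in>{1..<k}. (h i - l i) * (1 + \<eta>)) < a" "0 < \<eta>" "(real k + 1) * \<eta> \<le> 1"
      using eventually_happens' trivial_limit_at_right_real[of 0] by (metis (no_types, lifting) less_imp_le)
    with bnd[of \<eta>] show "\<forall>\<^sub>F N in sequentially. ?m N < a" by (auto elim!: eventually_mono)
  qed
qed

end

section \<open>Variance and almost sure convergence\<close>

text \<open>The sum of the squared deviations has finite expectation, hence converges almost surely,
  and its terms tend to 0. The shift by \<open>start\<close> allows a variance bound that holds only
  eventually.\<close>

lemma (in prob_space) AE_tendsto_of_summable_variance:
  fixes X :: "nat \<Rightarrow> 'a \<Rightarrow> real"
  assumes [measurable]: "\<And>j. X j \<in> borel_measurable M"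
    and int: "\<And>j. integrable M (\<lambda>x. (X j x - m j)\<^sup>2)"
    and bnd: "\<And>j. j \<ge> start \<Longrightarrow> expectation (\<lambda>x. (X j x - m j)\<^sup>2) \<le> v j" and sm: "summable v"
    and lim: "m \<longlonglongrightarrow> L"
  shows "AE x in M. (\<lambda>j. X j x) \<longlonglongrightarrow> L"
proof -
  let ?Z = "\<lambda>j x. (X (j + start) x - m (j + start))\<^sup>2"
  have v: "0 \<le> expectation (?Z j)" "expectation (?Z j) \<le> v (j + start)" for j using bnd[of "j + start"] by auto
  have sm': "summable (\<lambda>j. v (j + start))" using sm by (simp add: summable_iff_shift)
  have sm2: "summable (\<lambda>j. expectation (?Z j))"
    by (rule summable_comparison_test'[OF sm', where N = 0]) (use v in auto)
  have "(\<integral>\<^sup>+x. (\<Sum>j. ennreal (?Z j x)) \<partial>M) = (\<Sum>j. \<integral>\<^sup>+x. ennreal (?Z j x) \<partial>M)"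
    by (rule nn_integral_suminf) measurable
  also have "\<dots> = (\<Sum>j. ennreal (expectation (?Z j)))"
    by (intro suminf_cong nn_integral_eq_integral int) auto
  also have "\<dots> = ennreal (\<Sum>j. expectation (?Z j))" by (rule suminf_ennreal_eq[OF v(1) summable_sums[OF sm2]])
  finally have "(\<integral>\<^sup>+x. (\<Sum>j. ennreal (?Z j x)) \<partial>M) \<noteq> \<infinity>" by simp
  then have "AE x in M. (\<Sum>j. ennreal (?Z j x)) \<noteq> \<infinity>"
    by (intro nn_integral_noteq_infinite) measurable
  then show ?thesis
  proof eventually_elim
    case (elim x)
    then have "summable (\<lambda>j. ?Z j x)" by (intro summable_suminf_not_top) auto
    then have "(\<lambda>j. ?Z j x) \<longlonglongrightarrow> 0" by (rule summable_LIMSEQ_zero)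
    then have "(\<lambda>j. sqrt (?Z j x)) \<longlonglongrightarrow> sqrt 0" by (rule tendsto_real_sqrt)
    then have "(\<lambda>j. \<bar>X (j + start) x - m (j + start)\<bar>) \<longlonglongrightarrow> 0" by simp
    then have "(\<lambda>j. X (j + start) x - m (j + start)) \<longlonglongrightarrow> 0" by (simp add: tendsto_rabs_zero_iff)
    moreover have "(\<lambda>j. m (j + start)) \<longlonglongrightarrow> L" using lim by (rule LIMSEQ_ignore_initial_segment)
    ultimately have "(\<lambda>j. (X (j + start) x - m (j + start)) + m (j + start)) \<longlonglongrightarrow> 0 + L" by (rule tendsto_add)
    then show ?case by (simp add: LIMSEQ_offset[where k = start])
  qed
qed

section \<open>Second moment of the tuple count\<close>

context perturbed_rotation
begin

definition rand_count :: "nat \<Rightarrow> (nat \<Rightarrow> real) \<Rightarrow> (nat \<Rightarrow> real) \<Rightarrow> nat \<Rightarrow> (nat \<Rightarrow> real) \<Rightarrow> real" where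
  "rand_count k lo hi N \<omega> = (\<Sum>as\<in>tuples k N. indicator (close lo hi as) \<omega>)"

lemma measurable_rand_count [measurable]: "rand_count k lo hi N \<in> borel_measurable Unif"
  unfolding rand_count_def by measurable

lemma integrable_indicator_Unif: "A \<in> sets Unif \<Longrightarrow> integrable Unif (indicator A :: _ \<Rightarrow> real)"
proof -
  interpret U: prob_space Unif by (rule prob_space_Unif)
  show "A \<in> sets Unif \<Longrightarrow> integrable Unif (indicator A :: _ \<Rightarrow> real)"
    by (intro integrable_real_indicator) (auto simp: U.emeasure_eq_measure)
qed

lemma measure_close_disjoint:
  assumes "set as \<inter> set bs = {}"
  shows "measure Unif (close lo hi as \<inter> close lo hi bs) = measure Unif (close lo hi as) * measure Unif (close lo hi bs)"
proof (rule measure_Unif_Int_disjoint_support[OF _ _ assms])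
  fix cs :: "nat list" and \<omega> \<omega>' :: "nat \<Rightarrow> real"
  have "\<omega> \<in> close lo hi cs \<longleftrightarrow> \<omega>' \<in> close lo hi cs" if eq: "\<And>i. i \<in> set cs \<Longrightarrow> \<omega> i = \<omega>' i" for cs and \<omega> \<omega>' :: "nat \<Rightarrow> real"
  proof -
    have "pt \<omega> (cs ! 0) - pt \<omega> (cs ! i) = pt \<omega>' (cs ! 0) - pt \<omega>' (cs ! i)" if i: "i \<in> {1..<length cs}" for i
    proof -
      have "\<omega> (cs ! 0) = \<omega>' (cs ! 0)" "\<omega> (cs ! i) = \<omega>' (cs ! i)"
        using i by (auto intro!: eq nth_mem)
      then show ?thesis by (simp add: pt_def)
    qed
    then show ?thesis by (simp add: close_def)
  qed
  then show "\<And>\<omega> \<omega>'. (\<And>i. i \<in> set as \<Longrightarrow> \<omega> i = \<omega>' i) \<Longrightarrow> \<omega> \<in> close lo hi as \<longleftrightarrow> \<omega>' \<in> close lo hi as"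
    "\<And>\<omega> \<omega>'. (\<And>i. i \<in> set bs \<Longrightarrow> \<omega> i = \<omega>' i) \<Longrightarrow> \<omega> \<in> close lo hi bs \<longleftrightarrow> \<omega>' \<in> close lo hi bs"
    by blast+
qed measurable

lemma expectation_rand_count: "(\<integral>\<omega>. rand_count k lo hi N \<omega> \<partial>Unif) = mean_count k lo hi N"
  and integrable_rand_count: "integrable Unif (rand_count k lo hi N)"
proof -
  show "integrable Unif (rand_count k lo hi N)"
    unfolding rand_count_def by (intro Bochner_Integration.integrable_sum integrable_indicator_Unif sets_close)
  have "(\<integral>\<omega>. rand_count k lo hi N \<omega> \<partial>Unif) = (\<Sum>as\<in>tuples k N. \<integral>\<omega>. indicator (close lo hi as) \<omega> \<partial>Unif)"
    unfolding rand_count_def by (intro Bochner_Integration.integral_sum integrable_indicator_Unif sets_close)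
  then show "(\<integral>\<omega>. rand_count k lo hi N \<omega> \<partial>Unif) = mean_count k lo hi N"
    by (simp add: mean_count_def)
qed

text \<open>Expanding the square gives one covariance per pair of tuples. Independence kills the
  pairs without a common entry; for the others the subtracted product is dropped.\<close>

lemma variance_rand_count_le:
  fixes k N lo hi
  defines "T \<equiv> tuples k N"
  shows "(\<integral>\<omega>. (rand_count k lo hi N \<omega> - mean_count k lo hi N)\<^sup>2 \<partial>Unif)
    \<le> (\<Sum>(as, bs)\<in>{(as, bs)\<in>T \<times> T. set as \<inter> set bs \<noteq> {}}. measure Unif (close lo hi as \<inter> close lo hi bs))" (is "_ \<le> sum ?c ?S")
    and "integrable Unif (\<lambda>\<omega>. (rand_count k lo hi N \<omega> - mean_count k lo hi N)\<^sup>2)"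
proof -
  interpret U: prob_space Unif by (rule prob_space_Unif)
  let ?C = "rand_count k lo hi N"
  let ?A = "close lo hi"
  have finT: "finite T" unfolding T_def by (rule finite_tuples)
  have sq: "(?C \<omega>)\<^sup>2 = (\<Sum>p\<in>T \<times> T. indicator (?A (fst p) \<inter> ?A (snd p)) \<omega>)" for \<omega>
    unfolding rand_count_def power2_eq_square sum_product sum.cartesian_product T_def
    by (intro sum.cong) (auto simp: indicator_def)
  have int2: "integrable Unif (\<lambda>\<omega>. (?C \<omega>)\<^sup>2)"
    unfolding sq by (intro Bochner_Integration.integrable_sum integrable_indicator_Unif sets.Int sets_close)
  have e2: "(\<integral>\<omega>. (?C \<omega>)\<^sup>2 \<partial>Unif) = (\<Sum>p\<in>T \<times> T. measure Unif (?A (fst p) \<inter> ?A (snd p)))"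
  proof -
    have "(\<integral>\<omega>. (?C \<omega>)\<^sup>2 \<partial>Unif) = (\<Sum>p\<in>T \<times> T. \<integral>\<omega>. indicator (?A (fst p) \<inter> ?A (snd p)) \<omega> \<partial>Unif)"
      unfolding sq by (intro Bochner_Integration.integral_sum integrable_indicator_Unif sets.Int sets_close)
    then show ?thesis by (simp only: integral_indicator) simp
  qed
  have e1: "(mean_count k lo hi N)\<^sup>2 = (\<Sum>p\<in>T \<times> T. measure Unif (?A (fst p)) * measure Unif (?A (snd p)))"
    unfolding mean_count_def power2_eq_square sum_product sum.cartesian_product T_def
    by (intro sum.cong) auto
  have "(\<integral>\<omega>. (?C \<omega> - mean_count k lo hi N)\<^sup>2 \<partial>Unif) = (\<integral>\<omega>. (?C \<omega>)\<^sup>2 \<partial>Unif) - (mean_count k lo hi N)\<^sup>2"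
    using U.variance_eq[OF integrable_rand_count int2] by (simp add: expectation_rand_count)
  also have "\<dots> = (\<Sum>p\<in>T \<times> T. measure Unif (?A (fst p) \<inter> ?A (snd p)) - measure Unif (?A (fst p)) * measure Unif (?A (snd p)))"
    unfolding e1 e2 by (simp add: sum_subtractf)
  also have "\<dots> \<le> (\<Sum>p\<in>T \<times> T. if p \<in> ?S then ?c p else 0)"
  proof (rule sum_mono)
    fix p assume p: "p \<in> T \<times> T"
    show "measure Unif (?A (fst p) \<inter> ?A (snd p)) - measure Unif (?A (fst p)) * measure Unif (?A (snd p)) \<le> (if p \<in> ?S then ?c p else 0)"
    proof (cases "set (fst p) \<inter> set (snd p) = {}")
      case True
      then show ?thesis using measure_close_disjoint[OF True, of lo hi] by (auto simp: case_prod_beta)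
    next
      case False
      with p have "p \<in> ?S" by (auto simp: case_prod_beta)
      then show ?thesis by (simp add: case_prod_beta)
    qed
  qed
  also have "\<dots> = sum ?c ?S"
    using finT by (subst sum.inter_restrict[symmetric]) (auto intro!: sum.cong)
  finally show "(\<integral>\<omega>. (?C \<omega> - mean_count k lo hi N)\<^sup>2 \<partial>Unif) \<le> sum ?c ?S" .
  have "(\<lambda>\<omega>. (?C \<omega> - mean_count k lo hi N)\<^sup>2) = (\<lambda>\<omega>. (?C \<omega>)\<^sup>2 - 2 * mean_count k lo hi N * ?C \<omega> + (mean_count k lo hi N)\<^sup>2)"
    by (auto simp: power2_eq_square algebra_simps)
  then show "integrable Unif (\<lambda>\<omega>. (?C \<omega> - mean_count k lo hi N)\<^sup>2)"
    by (simp only:) (intro Bochner_Integration.integrable_add Bochner_Integration.integrable_diff int2 integrable_mult_right integrable_rand_count U.integrable_const)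
qed

text \<open>A path from the first entry of \<open>as\<close> to a shared entry, back to the first
  entry of \<open>bs\<close>, and on to any entry of \<open>bs\<close> has three steps of size at
  most \<open>r\<close>. Filtering keeps the merged tuple free of repetitions.\<close>

lemma close_Int_subset_close_merge:
  assumes lo: "\<And>i. 1 \<le> i \<Longrightarrow> i < k \<Longrightarrow> - r \<le> lo i" and hi: "\<And>i. 1 \<le> i \<Longrightarrow> i < k \<Longrightarrow> hi i \<le> r" and r: "0 \<le> r"
    and len: "length as = k" "length bs = k" and ne: "set as \<inter> set bs \<noteq> {}"
  shows "close lo hi as \<inter> close lo hi bs \<subseteq> close (\<lambda>_. - (3 * r)) (\<lambda>_. 3 * r) (as @ filter (\<lambda>b. b \<notin> set as) bs)"
proof
  fix \<omega> assume \<omega>: "\<omega> \<in> close lo hi as \<inter> close lo hi bs"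
  have zero: "in_mod1 0 (- r) r" unfolding in_mod1_def using r by (intro exI[of _ 0]) auto
  have near: "in_mod1 (pt \<omega> (cs ! 0) - pt \<omega> c) (- r) r" if c: "\<omega> \<in> close lo hi cs" "length cs = k" "c \<in> set cs" for cs c
  proof -
    obtain i where i: "i < k" "c = cs ! i" using c(2,3) by (auto simp: in_set_conv_nth)
    show ?thesis
    proof (cases "i = 0")
      case True
      then show ?thesis using zero i by simp
    next
      case False
      then have i1: "1 \<le> i" by simp
      have "in_mod1 (pt \<omega> (cs ! 0) - pt \<omega> (cs ! i)) (lo i) (hi i)"
        using c i i1 unfolding close_def by auto
      then show ?thesis using lo[OF i1 i(1)] hi[OF i1 i(1)] i by (auto intro: in_mod1_mono)
    qed
  qed
  obtain e where e: "e \<in> set as" "e \<in> set bs" using ne by blast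
  have near3: "in_mod1 (pt \<omega> (as ! 0) - pt \<omega> c) (- (3 * r)) (3 * r)" if c: "c \<in> set as \<union> set bs" for c
  proof (cases "c \<in> set as")
    case True
    then have "in_mod1 (pt \<omega> (as ! 0) - pt \<omega> c) (- r) r" using \<omega> len by (intro near) auto
    then show ?thesis using r by (auto intro: in_mod1_mono)
  next
    case False
    with c have "c \<in> set bs" by blast
    then have 1: "in_mod1 (pt \<omega> (bs ! 0) - pt \<omega> c) (- r) r" using \<omega> len by (intro near) auto
    have 2: "in_mod1 (pt \<omega> (as ! 0) - pt \<omega> e) (- r) r" using \<omega> len e by (intro near) auto
    have "in_mod1 (pt \<omega> (bs ! 0) - pt \<omega> e) (- r) r" using \<omega> len e by (intro near) auto
    then have 3: "in_mod1 (- (pt \<omega> (bs ! 0) - pt \<omega> e)) (- r) r" unfolding in_mod1_uminus by simp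
    from in_mod1_add2[OF 1 in_mod1_add2[OF 2 3]] show ?thesis by (simp add: algebra_simps)
  qed
  have "as \<noteq> []" using e by auto
  then have 0: "(as @ filter (\<lambda>b. b \<notin> set as) bs) ! 0 = as ! 0" by (simp add: nth_append)
  show "\<omega> \<in> close (\<lambda>_. - (3 * r)) (\<lambda>_. 3 * r) (as @ filter (\<lambda>b. b \<notin> set as) bs)"
    unfolding close_def 0
  proof (intro CollectI ballI near3)
    fix i assume "i \<in> {1..<length (as @ filter (\<lambda>b. b \<notin> set as) bs)}"
    then have "(as @ filter (\<lambda>b. b \<notin> set as) bs) ! i \<in> set (as @ filter (\<lambda>b. b \<notin> set as) bs)"
      by (intro nth_mem) simp
    then show "(as @ filter (\<lambda>b. b \<notin> set as) bs) ! i \<in> set as \<union> set bs" by auto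
  qed
qed

text \<open>Two close tuples sharing an entry merge into a single close tuple of length below \<open>2 * k\<close>, and
  boundedly many pairs merge into the same tuple.\<close>

lemma sum_intersecting_le:
  fixes k N lo hi
  defines "T \<equiv> tuples k N"
  assumes lo: "\<And>i. 1 \<le> i \<Longrightarrow> i < k \<Longrightarrow> - r \<le> lo i" and hi: "\<And>i. 1 \<le> i \<Longrightarrow> i < k \<Longrightarrow> hi i \<le> r" and r: "0 \<le> r"
  shows "(\<Sum>(as, bs)\<in>{(as, bs)\<in>T \<times> T. set as \<inter> set bs \<noteq> {}}. measure Unif (close lo hi as \<inter> close lo hi bs))
    \<le> (\<Sum>m\<in>{k..<2*k}. real m ^ k * mean_count m (\<lambda>_. - (3 * r)) (\<lambda>_. 3 * r) N)" (is "sum ?c ?S \<le> _")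
proof -
  interpret U: prob_space Unif by (rule prob_space_Unif)
  define W where "W = (\<Union>m\<in>{k..<2*k}. tuples m N)"
  define Fib where "Fib = (\<lambda>cs::nat list. {bs. set bs \<subseteq> set cs \<and> length bs = k})"
  \<comment> \<open>Keeping \<open>bs\<close> beside the merged tuple makes the map injective, as
    \<open>as\<close> is its prefix of length k. Given a merged tuple of length m, \<open>bs\<close>
    is a word of length k over its entries, so there are at most m ^ k choices.\<close>
  define \<phi> where "\<phi> = (\<lambda>(as, bs::nat list). (as @ filter (\<lambda>b. b \<notin> set as) bs, bs))"
  let ?R = "close (\<lambda>_. - (3 * r)) (\<lambda>_. 3 * r)"
  have finW: "finite W" unfolding W_def by (auto intro: finite_tuples)
  have finF: "finite (Fib cs)" for cs unfolding Fib_def by (rule finite_lists_length_eq) simp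
  have finS: "finite (Sigma W Fib)" by (intro finite_SigmaI finW finF)
  have inj: "inj_on \<phi> ?S"
  proof (rule inj_onI, clarify)
    fix as bs as' bs' assume h: "as \<in> T" "as' \<in> T" "\<phi> (as, bs) = \<phi> (as', bs')"
    then have "length as = length as'" by (auto simp: T_def tuples_def)
    with h(3) show "as = as' \<and> bs = bs'" by (auto simp: \<phi>_def)
  qed
  have sub: "\<phi> ` ?S \<subseteq> Sigma W Fib"
  proof
    fix q assume "q \<in> \<phi> ` ?S"
    then obtain as bs where h: "q = \<phi> (as, bs)" "as \<in> T" "bs \<in> T" "set as \<inter> set bs \<noteq> {}" by auto
    let ?f = "filter (\<lambda>b. b \<notin> set as) bs"
    have a: "length as = k" "distinct as" "set as \<subseteq> {1..N}" and b: "length bs = k" "distinct bs" "set bs \<subseteq> {1..N}"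
      using h by (auto simp: T_def tuples_def)
    obtain e where "e \<in> set as" "e \<in> set bs" using h(4) by blast
    \<comment> \<open>A shared entry is filtered out, so the merged length stays strictly below 2
      k.\<close>
    then have "length ?f < length bs" by (intro length_filter_less[of e]) auto
    then have len: "length (as @ ?f) \<in> {k..<2*k}" using a b by auto
    moreover have "as @ ?f \<in> tuples (length (as @ ?f)) N" unfolding tuples_def using a b by auto
    ultimately have "as @ ?f \<in> W" unfolding W_def by blast
    moreover have "bs \<in> Fib (as @ ?f)" unfolding Fib_def using b by auto
    ultimately show "q \<in> Sigma W Fib" using h(1) by (simp add: \<phi>_def)
  qed
  have "sum ?c ?S \<le> (\<Sum>p\<in>?S. measure Unif (?R (fst (\<phi> p))))"
  proof (rule sum_mono, clarify)
    fix as bs assume h: "as \<in> T" "bs \<in> T" "set as \<inter> set bs \<noteq> {}"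
    then have "length as = k" "length bs = k" by (auto simp: T_def tuples_def)
    from close_Int_subset_close_merge[OF lo hi r this h(3)]
    show "measure Unif (close lo hi as \<inter> close lo hi bs) \<le> measure Unif (?R (fst (\<phi> (as, bs))))"
      by (intro U.finite_measure_mono) (auto simp: \<phi>_def)
  qed
  also have "\<dots> = (\<Sum>q\<in>\<phi> ` ?S. measure Unif (?R (fst q)))" by (subst sum.reindex[OF inj]) (simp add: comp_def)
  also have "\<dots> \<le> (\<Sum>q\<in>Sigma W Fib. measure Unif (?R (fst q)))"
    by (intro sum_mono2 finS sub) auto
  also have "\<dots> = (\<Sum>cs\<in>W. \<Sum>bs\<in>Fib cs. measure Unif (?R cs))"
    using finW finF by (subst sum.Sigma) (auto simp: case_prod_beta)
  also have "\<dots> = (\<Sum>cs\<in>W. real (card (set cs) ^ k) * measure Unif (?R cs))"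
    unfolding Fib_def by (simp add: card_lists_length_eq)
  also have "\<dots> = (\<Sum>m\<in>{k..<2*k}. \<Sum>cs\<in>tuples m N. real (card (set cs) ^ k) * measure Unif (?R cs))"
  proof -
    have "tuples m N \<inter> tuples m' N = {}" if "m \<noteq> m'" for m m' using that by (auto simp: tuples_def)
    then show ?thesis unfolding W_def by (intro sum.UNION_disjoint) (simp_all add: finite_tuples)
  qed
  also have "\<dots> = (\<Sum>m\<in>{k..<2*k}. real m ^ k * mean_count m (\<lambda>_. - (3 * r)) (\<lambda>_. 3 * r) N)"
    unfolding mean_count_def sum_distrib_left
    by (intro sum.cong refl) (auto simp: tuples_def distinct_card)
  finally show ?thesis .
qed

text \<open>Every merged length contributes a mean count of order N, because the windows remain of
  size O(1 / N). Division by N squared leaves O(1 / N).\<close>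

lemma variance_rand_count_bound:
  assumes k: "1 \<le> k"
  shows "\<exists>K. \<forall>\<^sub>F N in sequentially.
    (\<integral>\<omega>. (rand_count k (\<lambda>i. l i / real N) (\<lambda>i. h i / real N) N \<omega> / real N
        - mean_count k (\<lambda>i. l i / real N) (\<lambda>i. h i / real N) N / real N)\<^sup>2 \<partial>Unif) \<le> K / real N"
proof -
  define r where "r = 1 + (\<Sum>i\<in>{1..<k}. \<bar>l i\<bar> + \<bar>h i\<bar>)"
  have r: "\<bar>l i\<bar> + \<bar>h i\<bar> \<le> r" if "1 \<le> i" "i < k" for i
  proof -
    have "\<bar>l i\<bar> + \<bar>h i\<bar> \<le> (\<Sum>i\<in>{1..<k}. \<bar>l i\<bar> + \<bar>h i\<bar>)"
      using that by (intro member_le_sum) auto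
    then show ?thesis by (simp add: r_def)
  qed
  have r0: "r > 0" unfolding r_def by (simp add: add_pos_nonneg sum_nonneg)
  let ?mc = "\<lambda>m N. mean_count m (\<lambda>_. - (3 * r) / real N) (\<lambda>_. (3 * r) / real N) N"
  \<comment> \<open>6 r is the length of the merged window [-3 r, 3 r]; the \<open>+ 1\<close> is
    slack above the limiting product.\<close>
  define K where "K = (\<Sum>m\<in>{k..<2*k}. real m ^ k * ((\<Prod>i\<in>{1..<m}. 6 * r) + 1))"
  have "\<forall>\<^sub>F N in sequentially. \<forall>m\<in>{k..<2*k}. ?mc m N / real N \<le> (\<Prod>i\<in>{1..<m}. 6 * r) + 1"
  proof (rule eventually_ball_finite, simp, rule ballI)
    fix m assume "m \<in> {k..<2*k}"
    then have "(\<lambda>N. ?mc m N / real N) \<longlonglongrightarrow> (\<Prod>i\<in>{1..<m}. 3 * r - - (3 * r))"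
      using k r0 by (intro mean_count_limit) auto
    then have "(\<lambda>N. ?mc m N / real N) \<longlonglongrightarrow> (\<Prod>i\<in>{1..<m}. 6 * r)" by simp
    from order_tendstoD(2)[OF this, of "(\<Prod>i\<in>{1..<m}. 6 * r) + 1"]
    show "\<forall>\<^sub>F N in sequentially. ?mc m N / real N \<le> (\<Prod>i\<in>{1..<m}. 6 * r) + 1"
      by (auto elim: eventually_mono)
  qed
  moreover have "\<forall>\<^sub>F N in sequentially. (0::nat) < N" by (rule eventually_gt_at_top)
  ultimately have "\<forall>\<^sub>F N in sequentially.
    (\<integral>\<omega>. (rand_count k (\<lambda>i. l i / real N) (\<lambda>i. h i / real N) N \<omega> / real N
        - mean_count k (\<lambda>i. l i / real N) (\<lambda>i. h i / real N) N / real N)\<^sup>2 \<partial>Unif) \<le> K / real N"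
  proof eventually_elim
    case (elim N)
    let ?lo = "\<lambda>i. l i / real N" and ?hi = "\<lambda>i. h i / real N"
    have N: "real N > 0" using elim by simp
    have "(\<integral>\<omega>. (rand_count k ?lo ?hi N \<omega> - mean_count k ?lo ?hi N)\<^sup>2 \<partial>Unif)
      \<le> (\<Sum>(as, bs)\<in>{(as, bs)\<in>tuples k N \<times> tuples k N. set as \<inter> set bs \<noteq> {}}. measure Unif (close ?lo ?hi as \<inter> close ?lo ?hi bs))"
      by (rule variance_rand_count_le)
    also have "\<dots> \<le> (\<Sum>m\<in>{k..<2*k}. real m ^ k * mean_count m (\<lambda>_. - (3 * (r / real N))) (\<lambda>_. 3 * (r / real N)) N)"
    proof (rule sum_intersecting_le)
      fix i assume i: "1 \<le> i" "i < k"
      have "- r \<le> l i" "h i \<le> r" using r[OF i] by linarith+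
      then show "- (r / real N) \<le> l i / real N" "h i / real N \<le> r / real N"
        using N by (auto simp: field_simps)
    qed (use r0 in auto)
    also have "\<dots> = (\<Sum>m\<in>{k..<2*k}. real m ^ k * ?mc m N)" by simp
    also have "\<dots> \<le> (\<Sum>m\<in>{k..<2*k}. real m ^ k * (((\<Prod>i\<in>{1..<m}. 6 * r) + 1) * real N))"
      using elim(1) N by (intro sum_mono mult_left_mono) (auto simp: pos_divide_le_eq)
    also have "\<dots> = K * real N" unfolding K_def by (simp add: sum_distrib_right mult.assoc)
    finally have var: "(\<integral>\<omega>. (rand_count k ?lo ?hi N \<omega> - mean_count k ?lo ?hi N)\<^sup>2 \<partial>Unif) \<le> K * real N" .
    have "(\<integral>\<omega>. (rand_count k ?lo ?hi N \<omega> / real N - mean_count k ?lo ?hi N / real N)\<^sup>2 \<partial>Unif)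
       = (\<integral>\<omega>. (rand_count k ?lo ?hi N \<omega> - mean_count k ?lo ?hi N)\<^sup>2 / (real N)\<^sup>2 \<partial>Unif)"
      by (simp add: diff_divide_distrib[symmetric] power_divide)
    also have "\<dots> = (\<integral>\<omega>. (rand_count k ?lo ?hi N \<omega> - mean_count k ?lo ?hi N)\<^sup>2 \<partial>Unif) / (real N)\<^sup>2" by simp
    also have "\<dots> \<le> K * real N / (real N)\<^sup>2" using var by (intro divide_right_mono) auto
    also have "\<dots> = K / real N" using N by (simp add: power2_eq_square)
    finally show ?case .
  qed
  then show ?thesis by blast
qed

text \<open>The bound K / N is not summable over all N, but along N = j ^ 2 it becomes K / j ^ 2,
  which is.\<close>

lemma AE_rand_count_squares:
  assumes k: "1 \<le> k" and lh: "\<And>i. 1 \<le> i \<Longrightarrow> i < k \<Longrightarrow> l i < h i"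
  shows "AE \<omega> in Unif. (\<lambda>j. rand_count k (\<lambda>i. l i / real (j^2)) (\<lambda>i. h i / real (j^2)) (j^2) \<omega> / real (j^2))
    \<longlonglongrightarrow> (\<Prod>i\<in>{1..<k}. h i - l i)"
proof -
  interpret U: prob_space Unif by (rule prob_space_Unif)
  let ?X = "\<lambda>N \<omega>. rand_count k (\<lambda>i. l i / real N) (\<lambda>i. h i / real N) N \<omega> / real N"
  let ?m = "\<lambda>N. mean_count k (\<lambda>i. l i / real N) (\<lambda>i. h i / real N) N / real N"
  obtain K where "\<forall>\<^sub>F N in sequentially. (\<integral>\<omega>. (?X N \<omega> - ?m N)\<^sup>2 \<partial>Unif) \<le> K / real N"
    using variance_rand_count_bound[OF k] by blast
  then obtain N0 where N0: "\<And>N. N \<ge> N0 \<Longrightarrow> (\<integral>\<omega>. (?X N \<omega> - ?m N)\<^sup>2 \<partial>Unif) \<le> K / real N"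
    unfolding eventually_sequentially by blast
  show ?thesis
  proof (rule U.AE_tendsto_of_summable_variance[where start = N0 and v = "\<lambda>j. K * (1 / real (j^2))"])
    show "(\<lambda>j. ?m (j^2)) \<longlonglongrightarrow> (\<Prod>i\<in>{1..<k}. h i - l i)"
      using mean_count_limit[OF k lh]
      by (rule filterlim_compose) (auto intro!: filterlim_subseq simp: strict_mono_def power_strict_mono)
    show "summable (\<lambda>j. K * (1 / real (j^2)))"
      using inverse_power_summable[of 2, where 'a = real] by (intro summable_mult) (simp add: field_simps)
    fix j
    have "(\<lambda>\<omega>. (?X (j^2) \<omega> - ?m (j^2))\<^sup>2) = (\<lambda>\<omega>. (rand_count k (\<lambda>i. l i / real (j^2)) (\<lambda>i. h i / real (j^2)) (j^2) \<omega>
         - mean_count k (\<lambda>i. l i / real (j^2)) (\<lambda>i. h i / real (j^2)) (j^2))\<^sup>2 / (real (j^2))\<^sup>2)"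
      by (simp add: diff_divide_distrib[symmetric] power_divide)
    then show "integrable Unif (\<lambda>\<omega>. (?X (j^2) \<omega> - ?m (j^2))\<^sup>2)"
      by (simp only:) (intro integrable_divide_zero variance_rand_count_le(2))
    show "(\<integral>\<omega>. (?X (j^2) \<omega> - ?m (j^2))\<^sup>2 \<partial>Unif) \<le> K * (1 / real (j^2))" if "N0 \<le> j"
    proof -
      have "j \<le> j^2" by (simp add: power2_eq_square)
      then show ?thesis using N0[of "j^2"] that by simp
    qed
  qed measurable
qed

end

section \<open>From squares and rational intervals to the full limit\<close>

definition perturbed_seq :: "(nat \<Rightarrow> real) \<Rightarrow> (nat \<Rightarrow> real) \<Rightarrow> nat \<Rightarrow> real" where
  "perturbed_seq G \<omega> n = 2 * real n + G (floor_log n) * \<omega> n"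

lemma corr_count_eq_sum:
  "real (corr_count k y s N) = (\<Sum>as\<in>tuples k N. if \<forall>i\<in>{1..k-1}.
      in_mod1 (y (as ! 0) - y (as ! i)) (s (2*i - 1) / real N) (s (2*i) / real N) then 1 else 0)"
  unfolding corr_count_def using finite_tuples[of k N] by (simp add: sum.If_cases Int_def)

lemma (in perturbed_rotation) AE_corr_count_squares:
  assumes k: "1 \<le> k" and s: "admissible k s"
  shows "AE \<omega> in Unif. (\<lambda>j. real (corr_count k (\<lambda>n. \<alpha> * perturbed_seq G \<omega> n) s (j^2)) / real (j^2))
    \<longlonglongrightarrow> (\<Prod>i\<in>{1..k-1}. s (2*i) - s (2*i - 1))"
proof -
  have eq: "{1..<k} = {1..k-1}" using k by auto
  have "real (corr_count k (\<lambda>n. \<alpha> * perturbed_seq G \<omega> n) s N)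
      = rand_count k (\<lambda>i. s (2*i - 1) / real N) (\<lambda>i. s (2*i) / real N) N \<omega>" for N \<omega>
    unfolding corr_count_eq_sum rand_count_def
  proof (rule sum.cong[OF refl])
    fix as assume "as \<in> tuples k N"
    then have "length as = k" by (simp add: tuples_def)
    then show "(if \<forall>i\<in>{1..k-1}. in_mod1 (\<alpha> * perturbed_seq G \<omega> (as ! 0) - \<alpha> * perturbed_seq G \<omega> (as ! i))
          (s (2*i - 1) / real N) (s (2*i) / real N) then 1 else 0)
       = indicator (close (\<lambda>i. s (2*i - 1) / real N) (\<lambda>i. s (2*i) / real N) as) \<omega>"
      unfolding close_def pt_def perturbed_seq_def by (simp add: eq[simplified] indicator_def)
  qed
  then show ?thesis
    using AE_rand_count_squares[OF k, of "\<lambda>i. s (2*i - 1)" "\<lambda>i. s (2*i)"] s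
    unfolding eq admissible_def by simp
qed

section \<open>Monotonicity and countably many endpoints\<close>

lemma corr_count_mono:
  assumes "N \<le> N'" and "\<And>i. 1 \<le> i \<Longrightarrow> i < k \<Longrightarrow> s' (2*i - 1) / real N' \<le> s (2*i - 1) / real N"
    and "\<And>i. 1 \<le> i \<Longrightarrow> i < k \<Longrightarrow> s (2*i) / real N \<le> s' (2*i) / real N'"
  shows "corr_count k y s N \<le> corr_count k y s' N'"
  unfolding corr_count_def
proof (rule card_mono)
  show "finite {as \<in> tuples k N'. \<forall>i\<in>{1..k-1}. in_mod1 (y (as ! 0) - y (as ! i)) (s' (2*i - 1) / real N') (s' (2*i) / real N')}"
    using finite_tuples by simp
  show "{as \<in> tuples k N. \<forall>i\<in>{1..k-1}. in_mod1 (y (as ! 0) - y (as ! i)) (s (2*i - 1) / real N) (s (2*i) / real N)}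
    \<subseteq> {as \<in> tuples k N'. \<forall>i\<in>{1..k-1}. in_mod1 (y (as ! 0) - y (as ! i)) (s' (2*i - 1) / real N') (s' (2*i) / real N')}"
  proof clarify
    fix as assume as: "as \<in> tuples k N"
      and h: "\<forall>i\<in>{1..k-1}. in_mod1 (y (as ! 0) - y (as ! i)) (s (2*i - 1) / real N) (s (2*i) / real N)"
    have "as \<in> tuples k N'" using as assms(1) by (auto simp: tuples_def)
    moreover have "in_mod1 (y (as ! 0) - y (as ! i)) (s' (2*i - 1) / real N') (s' (2*i) / real N')" if i: "i \<in> {1..k-1}" for i
    proof -
      have "1 \<le> i" "i < k" using i by auto
      with h i assms(2,3)[of i] show ?thesis by (auto intro: in_mod1_mono)
    qed
    ultimately show "as \<in> tuples k N' \<and> (\<forall>i\<in>{1..k-1}. in_mod1 (y (as ! 0) - y (as ! i)) (s' (2*i - 1) / real N') (s' (2*i) / real N'))"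
      by blast
  qed
qed

text \<open>Finite lists of rationals form a countable type, so the exceptional null sets of all
  these endpoint sequences can be united.\<close>

definition list_seq :: "rat list \<Rightarrow> nat \<Rightarrow> real" where
  "list_seq L n = (if n < length L then of_rat (L ! n) else 0)"

lemma list_seq_approx:
  assumes "\<And>n. n < m \<Longrightarrow> l n < h n"
  shows "\<exists>L. \<forall>n<m. l n < list_seq L n \<and> list_seq L n < h n"
proof -
  have "\<forall>n\<in>{..<m}. \<exists>q. l n < of_rat q \<and> of_rat q < h n"
    using assms of_rat_dense by blast
  from bchoice[OF this] obtain f where f: "\<forall>n\<in>{..<m}. l n < of_rat (f n) \<and> of_rat (f n) < h n" ..
  have "list_seq (map f [0..<m]) n = of_rat (f n)" if "n < m" for n
    using that by (simp add: list_seq_def)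
  with f show ?thesis by (intro exI[of _ "map f [0..<m]"]) simp
qed

lemma filterlim_floor_sqrt: "filterlim floor_sqrt at_top sequentially"
  unfolding filterlim_at_top
proof
  fix Z
  have "\<forall>\<^sub>F N in sequentially. Z\<^sup>2 \<le> N" by (rule eventually_ge_at_top)
  then show "\<forall>\<^sub>F N in sequentially. Z \<le> floor_sqrt N" by eventually_elim (rule le_floor_sqrtI)
qed

text \<open>Both squares enclosing N are asymptotic to N because consecutive squares have ratio
  tending to 1; hence squares are dense enough for interpolation.\<close>

lemma floor_sqrt_ratios:
  shows "(\<lambda>N. real ((floor_sqrt N)\<^sup>2) / real N) \<longlonglongrightarrow> 1"
    and "(\<lambda>N. real ((Suc (floor_sqrt N))\<^sup>2) / real N) \<longlonglongrightarrow> 1"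
proof -
  have j1: "(\<lambda>j. real (j\<^sup>2) / real ((Suc j)\<^sup>2)) \<longlonglongrightarrow> 1"
    and j2: "(\<lambda>j. real ((Suc j)\<^sup>2) / real (j\<^sup>2)) \<longlonglongrightarrow> 1"
    unfolding of_nat_power of_nat_Suc by real_asymp+
  have lim1: "(\<lambda>N. real ((floor_sqrt N)\<^sup>2) / real ((Suc (floor_sqrt N))\<^sup>2)) \<longlonglongrightarrow> 1"
    by (rule filterlim_compose[OF j1 filterlim_floor_sqrt])
  have lim2: "(\<lambda>N. real ((Suc (floor_sqrt N))\<^sup>2) / real ((floor_sqrt N)\<^sup>2)) \<longlonglongrightarrow> 1"
    by (rule filterlim_compose[OF j2 filterlim_floor_sqrt])
  have pos: "\<forall>\<^sub>F N in sequentially. (0::nat) < N" by (rule eventually_gt_at_top)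
  have lo: "real ((floor_sqrt N)\<^sup>2) \<le> real N" and up: "real N \<le> real ((Suc (floor_sqrt N))\<^sup>2)" for N
    using floor_sqrt_power2_le[of N] Suc_floor_sqrt_power2_gt[of N] by (auto intro: of_nat_mono simp del: of_nat_power)
  have N0: "0 < real ((floor_sqrt N)\<^sup>2)" if "0 < N" for N
    using that by (simp add: floor_sqrt_greater_zero_iff)
  show "(\<lambda>N. real ((floor_sqrt N)\<^sup>2) / real N) \<longlonglongrightarrow> 1"
  proof (rule tendsto_sandwich[OF _ _ lim1 tendsto_const])
    show "\<forall>\<^sub>F N in sequentially. real ((floor_sqrt N)\<^sup>2) / real ((Suc (floor_sqrt N))\<^sup>2) \<le> real ((floor_sqrt N)\<^sup>2) / real N"
      using pos by eventually_elim (intro divide_left_mono up, auto)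
    show "\<forall>\<^sub>F N in sequentially. real ((floor_sqrt N)\<^sup>2) / real N \<le> 1"
      using pos
    proof eventually_elim
      case (elim N)
      then show ?case using lo[of N] by (simp del: of_nat_power)
    qed
  qed
  show "(\<lambda>N. real ((Suc (floor_sqrt N))\<^sup>2) / real N) \<longlonglongrightarrow> 1"
  proof (rule tendsto_sandwich[OF _ _ tendsto_const lim2])
    show "\<forall>\<^sub>F N in sequentially. 1 \<le> real ((Suc (floor_sqrt N))\<^sup>2) / real N"
      using pos
    proof eventually_elim
      case (elim N)
      then show ?case using up[of N] by (simp del: of_nat_power)
    qed
    show "\<forall>\<^sub>F N in sequentially. real ((Suc (floor_sqrt N))\<^sup>2) / real N \<le> real ((Suc (floor_sqrt N))\<^sup>2) / real ((floor_sqrt N)\<^sup>2)"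
      using pos
    proof eventually_elim
      case (elim N)
      then show ?case by (intro divide_left_mono lo mult_pos_pos N0) auto
    qed
  qed
qed

text \<open>Monotonicity in both the number of points and the intervals reduces the full limit to squares
  and to countably many intervals.\<close>

lemma poissonian_corr_of_squares:
  assumes sq: "\<And>L. admissible k (list_seq L) \<Longrightarrow>
      (\<lambda>j. real (corr_count k y (list_seq L) (j^2)) / real (j^2)) \<longlonglongrightarrow> (\<Prod>i\<in>{1..k-1}. list_seq L (2*i) - list_seq L (2*i - 1))"
  shows "poissonian_corr k y"
  unfolding poissonian_corr_def
proof (intro allI impI)
  fix s assume s: "admissible k s"
  let ?I = "{1..k-1}"
  let ?F = "\<lambda>N. real (corr_count k y s N) / real N"
  let ?P = "\<Prod>i\<in>?I. s (2*i) - s (2*i - 1)"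
  \<comment> \<open>Comparing N with a square M rewrites the endpoint s / N as (s M / N) / M. As |s|
    is at most B, a ratio M / N within \<delta> / B of 1 displaces \<open>s\<close> by less than
    \<delta>. The summand 1 makes B positive.\<close>
  define B where "B = 1 + (\<Sum>n<2*k. \<bar>s n\<bar>)"
  have B: "\<bar>s n\<bar> \<le> B" if "n < 2*k" for n
    using member_le_sum[of n "{..<2*k}" "\<lambda>n. \<bar>s n\<bar>"] that by (simp add: B_def)
  have B0: "B > 0" unfolding B_def by (simp add: add_pos_nonneg sum_nonneg)
  have gap: "s (2*i - 1) < s (2*i)" if "i \<in> ?I" for i using s that unfolding admissible_def by auto
  have ix: "2*i < 2*k" "2*i - 1 < 2*k" "odd (2*i - 1)" if "i \<in> ?I" for i using that by auto
  have near1: "\<forall>\<^sub>F N in sequentially. \<bar>real ((floor_sqrt N)\<^sup>2) / real N - 1\<bar> < e"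
    "\<forall>\<^sub>F N in sequentially. \<bar>real ((Suc (floor_sqrt N))\<^sup>2) / real N - 1\<bar> < e" if "e > 0" for e
    using tendstoD[OF floor_sqrt_ratios(1) that] tendstoD[OF floor_sqrt_ratios(2) that] by (simp_all add: dist_real_def)
  have move: "\<bar>s n * \<rho> - s n\<bar> < \<delta>" if "\<bar>\<rho> - 1\<bar> < \<delta> / B" "n < 2*k" for n \<rho> \<delta>
  proof -
    have "\<bar>s n * \<rho> - s n\<bar> = \<bar>s n\<bar> * \<bar>\<rho> - 1\<bar>" by (simp add: abs_mult[symmetric] algebra_simps)
    also have "\<dots> \<le> B * \<bar>\<rho> - 1\<bar>" using B[OF that(2)] by (intro mult_right_mono) auto
    also have "\<dots> < B * (\<delta> / B)" using that(1) B0 by (intro mult_strict_left_mono) auto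
    finally show ?thesis using B0 by simp
  qed
  have pos: "\<forall>\<^sub>F N in sequentially. (0::nat) < N" by (rule eventually_gt_at_top)
  have upper: "\<forall>\<^sub>F N in sequentially. ?F N < a" if \<delta>: "\<delta> > 0" and a: "(\<Prod>i\<in>?I. s (2*i) - s (2*i - 1) + 4 * \<delta>) < a" for \<delta> a
  proof -
    \<comment> \<open>Odd indices are lower endpoints. Every endpoint moves outwards by between
      \<delta> and 2 \<delta>: at least \<delta> to absorb the displacement caused by M / N, at most
      2 \<delta> so that each interval grows by at most 4 \<delta>.\<close>
    have "\<exists>L. \<forall>n<2*k. (if odd n then s n - 2 * \<delta> else s n + \<delta>) < list_seq L n
        \<and> list_seq L n < (if odd n then s n - \<delta> else s n + 2 * \<delta>)"
      by (rule list_seq_approx) (use \<delta> in auto)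
    then obtain L where L: "\<And>n. n < 2*k \<Longrightarrow> (if odd n then s n - 2 * \<delta> else s n + \<delta>) < list_seq L n
        \<and> list_seq L n < (if odd n then s n - \<delta> else s n + 2 * \<delta>)"
      by blast
    have L1: "s (2*i - 1) - 2 * \<delta> < list_seq L (2*i - 1)" "list_seq L (2*i - 1) < s (2*i - 1) - \<delta>"
      "s (2*i) + \<delta> < list_seq L (2*i)" "list_seq L (2*i) < s (2*i) + 2 * \<delta>" if "i \<in> ?I" for i
      using L[of "2*i - 1"] L[of "2*i"] ix[OF that] by auto
    have adm: "admissible k (list_seq L)"
      unfolding admissible_def
    proof (intro allI impI)
      fix i assume "1 \<le> i \<and> i < k"
      then have "i \<in> ?I" by auto
      then show "list_seq L (2*i - 1) < list_seq L (2*i)" using L1[of i] gap[of i] \<delta> by linarith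
    qed
    \<comment> \<open>The square is taken above N, since more points and wider intervals both
      increase the count.\<close>
    have "(\<lambda>N. real (corr_count k y (list_seq L) ((Suc (floor_sqrt N))\<^sup>2)) / real ((Suc (floor_sqrt N))\<^sup>2))
        \<longlonglongrightarrow> (\<Prod>i\<in>?I. list_seq L (2*i) - list_seq L (2*i - 1))"
      by (rule filterlim_compose[OF sq[OF adm] filterlim_compose[OF filterlim_Suc filterlim_floor_sqrt]])
    from tendsto_mult[OF this floor_sqrt_ratios(2)]
    have "(\<lambda>N. real (corr_count k y (list_seq L) ((Suc (floor_sqrt N))\<^sup>2)) / real ((Suc (floor_sqrt N))\<^sup>2)
          * (real ((Suc (floor_sqrt N))\<^sup>2) / real N)) \<longlonglongrightarrow> (\<Prod>i\<in>?I. list_seq L (2*i) - list_seq L (2*i - 1))"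
      by (simp only: mult_1_right)
    note lim = order_tendstoD(2)[OF this]
    have "(\<Prod>i\<in>?I. list_seq L (2*i) - list_seq L (2*i - 1)) \<le> (\<Prod>i\<in>?I. s (2*i) - s (2*i - 1) + 4 * \<delta>)"
    proof (rule prod_mono)
      fix i assume i: "i \<in> ?I"
      show "0 \<le> list_seq L (2*i) - list_seq L (2*i - 1) \<and> list_seq L (2*i) - list_seq L (2*i - 1) \<le> s (2*i) - s (2*i - 1) + 4 * \<delta>"
        using L1[OF i] gap[OF i] \<delta> by linarith
    qed
    from lim[OF le_less_trans[OF this a]] have "\<forall>\<^sub>F N in sequentially. real (corr_count k y (list_seq L) ((Suc (floor_sqrt N))\<^sup>2)) / real ((Suc (floor_sqrt N))\<^sup>2)
          * (real ((Suc (floor_sqrt N))\<^sup>2) / real N) < a"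
      .
    moreover have "\<forall>\<^sub>F N in sequentially. \<bar>real ((Suc (floor_sqrt N))\<^sup>2) / real N - 1\<bar> < \<delta> / B"
      using \<delta> B0 by (intro near1) auto
    ultimately show ?thesis using pos
    proof eventually_elim
      case (elim N)
      define M where "M = (Suc (floor_sqrt N))\<^sup>2"
      have M0: "0 < real M" by (simp add: M_def)
      have N0: "0 < real N" using elim by simp
      have NM: "N \<le> M" unfolding M_def using Suc_floor_sqrt_power2_gt[of N] by simp
      have near: "\<bar>real M / real N - 1\<bar> < \<delta> / B" using elim(2) unfolding M_def .
      have "corr_count k y s N \<le> corr_count k y (list_seq L) M"
      proof (rule corr_count_mono[OF NM])
        fix i assume "1 \<le> i" "i < k"
        then have i: "i \<in> ?I" by auto
        have "list_seq L (2*i - 1) \<le> s (2*i - 1) * (real M / real N)" "s (2*i) * (real M / real N) \<le> list_seq L (2*i)"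
          using move[OF near ix(2)[OF i]] move[OF near ix(1)[OF i]] L1[OF i] by linarith+
        then show "list_seq L (2*i - 1) / real M \<le> s (2*i - 1) / real N" "s (2*i) / real N \<le> list_seq L (2*i) / real M"
          using N0 M0 by (auto simp: field_simps)
      qed
      then have "?F N \<le> real (corr_count k y (list_seq L) M) / real N"
        using N0 by (intro divide_right_mono) auto
      also have "\<dots> = real (corr_count k y (list_seq L) M) / real M * (real M / real N)" using M0 by simp
      also have "\<dots> < a" using elim(1) unfolding M_def .
      finally show ?case .
    qed
  qed
  \<comment> \<open>The mirror image: the largest square up to N and intervals moved inwards. The
    condition on 4 \<delta> keeps the shrunken intervals admissible and the factors of the product
    nonnegative.\<close>
  have lower: "\<forall>\<^sub>F N in sequentially. a < ?F N" if \<delta>: "\<delta> > 0" and small: "\<And>i. i \<in> ?I \<Longrightarrow> 4 * \<delta> < s (2*i) - s (2*i - 1)"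
    and a: "a < (\<Prod>i\<in>?I. s (2*i) - s (2*i - 1) - 4 * \<delta>)" for \<delta> a
  proof -
    have "\<exists>L. \<forall>n<2*k. (if odd n then s n + \<delta> else s n - 2 * \<delta>) < list_seq L n
        \<and> list_seq L n < (if odd n then s n + 2 * \<delta> else s n - \<delta>)"
      by (rule list_seq_approx) (use \<delta> in auto)
    then obtain L where L: "\<And>n. n < 2*k \<Longrightarrow> (if odd n then s n + \<delta> else s n - 2 * \<delta>) < list_seq L n
        \<and> list_seq L n < (if odd n then s n + 2 * \<delta> else s n - \<delta>)"
      by blast
    have L1: "s (2*i - 1) + \<delta> < list_seq L (2*i - 1)" "list_seq L (2*i - 1) < s (2*i - 1) + 2 * \<delta>"
      "s (2*i) - 2 * \<delta> < list_seq L (2*i)" "list_seq L (2*i) < s (2*i) - \<delta>" if "i \<in> ?I" for i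
      using L[of "2*i - 1"] L[of "2*i"] ix[OF that] by auto
    have adm: "admissible k (list_seq L)"
      unfolding admissible_def
    proof (intro allI impI)
      fix i assume "1 \<le> i \<and> i < k"
      then have "i \<in> ?I" by auto
      then show "list_seq L (2*i - 1) < list_seq L (2*i)" using L1[of i] small[of i] by linarith
    qed
    have "(\<lambda>N. real (corr_count k y (list_seq L) ((floor_sqrt N)\<^sup>2)) / real ((floor_sqrt N)\<^sup>2))
        \<longlonglongrightarrow> (\<Prod>i\<in>?I. list_seq L (2*i) - list_seq L (2*i - 1))"
      by (rule filterlim_compose[OF sq[OF adm] filterlim_floor_sqrt])
    from tendsto_mult[OF this floor_sqrt_ratios(1)]
    have "(\<lambda>N. real (corr_count k y (list_seq L) ((floor_sqrt N)\<^sup>2)) / real ((floor_sqrt N)\<^sup>2)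
          * (real ((floor_sqrt N)\<^sup>2) / real N)) \<longlonglongrightarrow> (\<Prod>i\<in>?I. list_seq L (2*i) - list_seq L (2*i - 1))"
      by (simp only: mult_1_right)
    note lim = order_tendstoD(1)[OF this]
    have "(\<Prod>i\<in>?I. s (2*i) - s (2*i - 1) - 4 * \<delta>) \<le> (\<Prod>i\<in>?I. list_seq L (2*i) - list_seq L (2*i - 1))"
    proof (rule prod_mono)
      fix i assume i: "i \<in> ?I"
      show "0 \<le> s (2*i) - s (2*i - 1) - 4 * \<delta> \<and> s (2*i) - s (2*i - 1) - 4 * \<delta> \<le> list_seq L (2*i) - list_seq L (2*i - 1)"
        using L1[OF i] small[OF i] by linarith
    qed
    from lim[OF less_le_trans[OF a this]] have "\<forall>\<^sub>F N in sequentially. a < real (corr_count k y (list_seq L) ((floor_sqrt N)\<^sup>2)) / real ((floor_sqrt N)\<^sup>2)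
          * (real ((floor_sqrt N)\<^sup>2) / real N)"
      .
    moreover have "\<forall>\<^sub>F N in sequentially. \<bar>real ((floor_sqrt N)\<^sup>2) / real N - 1\<bar> < \<delta> / B"
      using \<delta> B0 by (intro near1) auto
    ultimately show ?thesis using pos
    proof eventually_elim
      case (elim N)
      define M where "M = (floor_sqrt N)\<^sup>2"
      have M0: "0 < real M" using elim(3) by (simp add: M_def floor_sqrt_greater_zero_iff)
      have N0: "0 < real N" using elim by simp
      have NM: "M \<le> N" unfolding M_def by simp
      have near: "\<bar>real M / real N - 1\<bar> < \<delta> / B" using elim(2) unfolding M_def .
      have "corr_count k y (list_seq L) M \<le> corr_count k y s N"
      proof (rule corr_count_mono[OF NM])
        fix i assume "1 \<le> i" "i < k"
        then have i: "i \<in> ?I" by auto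
        have "s (2*i - 1) * (real M / real N) \<le> list_seq L (2*i - 1)" "list_seq L (2*i) \<le> s (2*i) * (real M / real N)"
          using move[OF near ix(2)[OF i]] move[OF near ix(1)[OF i]] L1[OF i] by linarith+
        then show "s (2*i - 1) / real N \<le> list_seq L (2*i - 1) / real M" "list_seq L (2*i) / real M \<le> s (2*i) / real N"
          using N0 M0 by (auto simp: field_simps)
      qed
      have "a < real (corr_count k y (list_seq L) M) / real M * (real M / real N)" using elim(1) unfolding M_def .
      also have "\<dots> = real (corr_count k y (list_seq L) M) / real N" using M0 by simp
      also have "\<dots> \<le> ?F N"
        using N0 \<open>corr_count k y (list_seq L) M \<le> corr_count k y s N\<close> by (intro divide_right_mono) auto
      finally show ?case .
    qed
  qed
  have lim_up: "((\<lambda>\<delta>. \<Prod>i\<in>?I. s (2*i) - s (2*i - 1) + 4 * \<delta>) \<longlongrightarrow> (\<Prod>i\<in>?I. s (2*i) - s (2*i - 1) + 4 * 0)) (at_right 0)"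
    by (intro tendsto_intros)
  have lim_lo: "((\<lambda>\<delta>. \<Prod>i\<in>?I. s (2*i) - s (2*i - 1) - 4 * \<delta>) \<longlongrightarrow> (\<Prod>i\<in>?I. s (2*i) - s (2*i - 1) - 4 * 0)) (at_right 0)"
    by (intro tendsto_intros)
  have dpos: "\<forall>\<^sub>F \<delta> in at_right (0::real). 0 < \<delta>" by (rule eventually_at_right_less)
  have dsmall: "\<forall>\<^sub>F \<delta> in at_right (0::real). \<forall>i\<in>?I. 4 * \<delta> < s (2*i) - s (2*i - 1)"
  proof (rule eventually_ball_finite, simp, rule ballI)
    fix i assume i: "i \<in> ?I"
    have "((\<lambda>\<delta>::real. 4 * \<delta>) \<longlongrightarrow> 4 * 0) (at_right 0)" by (intro tendsto_intros)
    then show "\<forall>\<^sub>F \<delta> in at_right (0::real). 4 * \<delta> < s (2*i) - s (2*i - 1)"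
      using gap[OF i] by (intro order_tendstoD(2)) auto
  qed
  show "?F \<longlonglongrightarrow> ?P"
  proof (rule order_tendstoI)
    fix a assume "?P < a"
    then have "\<forall>\<^sub>F \<delta> in at_right 0. (\<Prod>i\<in>?I. s (2*i) - s (2*i - 1) + 4 * \<delta>) < a"
      using order_tendstoD(2)[OF lim_up, of a] by simp
    with dpos have "\<forall>\<^sub>F \<delta> in at_right 0. 0 < \<delta> \<and> (\<Prod>i\<in>?I. s (2*i) - s (2*i - 1) + 4 * \<delta>) < a"
      by eventually_elim auto
    from eventually_happens'[OF trivial_limit_at_right_real this] upper show "\<forall>\<^sub>F N in sequentially. ?F N < a" by blast
  next
    fix a assume "a < ?P"
    then have "\<forall>\<^sub>F \<delta> in at_right 0. a < (\<Prod>i\<in>?I. s (2*i) - s (2*i - 1) - 4 * \<delta>)"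
      using order_tendstoD(1)[OF lim_lo, of a] by simp
    with dpos dsmall have "\<forall>\<^sub>F \<delta> in at_right 0. 0 < \<delta> \<and> (\<forall>i\<in>?I. 4 * \<delta> < s (2*i) - s (2*i - 1)) \<and> a < (\<Prod>i\<in>?I. s (2*i) - s (2*i - 1) - 4 * \<delta>)"
      by eventually_elim auto
    from eventually_happens'[OF trivial_limit_at_right_real this] lower show "\<forall>\<^sub>F N in sequentially. a < ?F N" by blast
  qed
qed

text \<open>Negation turns each window [lo, hi] into [-hi, -lo], of the same length. Accordingly
  \<open>s'\<close> swaps the two endpoints of every pair and changes their signs.\<close>

lemma poissonian_corr_uminus:
  assumes "poissonian_corr k y"
  shows "poissonian_corr k (\<lambda>n. - y n)"
  unfolding poissonian_corr_def
proof (intro allI impI)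
  fix s assume s: "admissible k s"
  define s' where "s' = (\<lambda>n. if even n then - s (n - 1) else - s (n + 1))"
  have s': "s' (2*i - 1) = - s (2*i)" "s' (2*i) = - s (2*i - 1)" if "1 \<le> i" for i
    using that by (auto simp: s'_def)
  have adm: "admissible k s'" using s s' by (auto simp: admissible_def)
  have lim: "(\<lambda>N. real (corr_count k y s' N) / real N) \<longlonglongrightarrow> (\<Prod>i\<in>{1..k-1}. s' (2*i) - s' (2*i - 1))"
    using assms adm unfolding poissonian_corr_def by blast
  have "corr_count k (\<lambda>n. - y n) s N = corr_count k y s' N" for N
  proof -
    have "in_mod1 (- y (as ! 0) - - y (as ! i)) (s (2*i - 1) / real N) (s (2*i) / real N) \<longleftrightarrow>
       in_mod1 (y (as ! 0) - y (as ! i)) (s' (2*i - 1) / real N) (s' (2*i) / real N)" if "i \<in> {1..k-1}" for as i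
      using in_mod1_uminus[of "y (as ! 0) - y (as ! i)" "s (2*i - 1) / real N" "s (2*i) / real N"] s'[of i] that by simp
    then show ?thesis unfolding corr_count_def by (intro arg_cong[of _ _ card] Collect_cong conj_cong refl ball_cong) auto
  qed
  moreover have "(\<Prod>i\<in>{1..k-1}. s' (2*i) - s' (2*i - 1)) = (\<Prod>i\<in>{1..k-1}. s (2*i) - s (2*i - 1))"
  proof (rule prod.cong[OF refl])
    fix i assume "i \<in> {1..k-1}"
    then show "s' (2*i) - s' (2*i - 1) = s (2*i) - s (2*i - 1)" using s'[of i] by auto
  qed
  ultimately show "(\<lambda>N. real (corr_count k (\<lambda>n. - y n) s N) / real N) \<longlonglongrightarrow> (\<Prod>i\<in>{1..k-1}. s (2*i) - s (2*i - 1))"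
    using lim by (simp only:)
qed

section \<open>Energy and conclusion\<close>

lemma tendsto_real_iff_inverse_Suc:
  fixes f :: "nat \<Rightarrow> real"
  shows "f \<longlonglongrightarrow> l \<longleftrightarrow> (\<forall>n. \<exists>j. \<forall>i\<ge>j. \<bar>f i - l\<bar> < inverse (real (Suc n)))"
proof
  assume "f \<longlonglongrightarrow> l"
  then show "\<forall>n. \<exists>j. \<forall>i\<ge>j. \<bar>f i - l\<bar> < inverse (real (Suc n))"
    unfolding LIMSEQ_iff by (simp del: of_nat_Suc)
next
  assume h: "\<forall>n. \<exists>j. \<forall>i\<ge>j. \<bar>f i - l\<bar> < inverse (real (Suc n))"
  show "f \<longlonglongrightarrow> l"
    unfolding LIMSEQ_iff
  proof (intro allI impI)
    fix r :: real assume "0 < r"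
    then obtain n where n: "inverse (real (Suc n)) < r" using reals_Archimedean by blast
    obtain j where "\<forall>i\<ge>j. \<bar>f i - l\<bar> < inverse (real (Suc n))" using h by blast
    then have "\<forall>i\<ge>j. norm (f i - l) < r" using n by (auto intro: less_trans)
    then show "\<exists>j. \<forall>i\<ge>j. norm (f i - l) < r" by blast
  qed
qed

text \<open>Fubini for null sets requires measurability jointly in \<alpha> and the perturbations.
  With tolerances 1 / (n + 1), convergence is a countable combination of conditions on single
  counts.\<close>

lemma measurable_corr_count_limit:
  "{p \<in> space (lborel \<Otimes>\<^sub>M Unif). 0 < fst p \<longrightarrow>
     (\<lambda>j. real (corr_count k (\<lambda>n. fst p * perturbed_seq G (snd p) n) s (j^2)) / real (j^2)) \<longlonglongrightarrow> c}
   \<in> sets (lborel \<Otimes>\<^sub>M Unif)"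
proof -
  have [measurable]: "(\<lambda>p. snd p n) \<in> borel_measurable (lborel \<Otimes>\<^sub>M Unif)" for n
  proof -
    have "(\<lambda>\<omega>. \<omega> n) \<in> measurable Unif unif" by simp
    then have "(\<lambda>\<omega>. \<omega> n) \<in> borel_measurable Unif" by (simp cong: measurable_cong_sets)
    from measurable_compose[OF measurable_snd this] show ?thesis .
  qed
  have [measurable]: "(\<lambda>p. fst p) \<in> borel_measurable (lborel \<Otimes>\<^sub>M Unif)"
    using measurable_fst[of lborel Unif] by (simp cong: measurable_cong_sets)
  have [measurable]: "(\<lambda>p. real (corr_count k (\<lambda>n. fst p * perturbed_seq G (snd p) n) s N)) \<in> borel_measurable (lborel \<Otimes>\<^sub>M Unif)" for N
    unfolding corr_count_eq_sum perturbed_seq_def by measurable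
  show ?thesis unfolding tendsto_real_iff_inverse_Suc by measurable
qed

text \<open>The exchange is carried out for one level and one endpoint sequence at a time. Only
  afterwards are countably many null sets united, and the uncountable family of all endpoints is
  reached by a deterministic argument for fixed \<alpha> and \<omega>.\<close>

lemma AE_perturbed_poissonian:
  assumes \<psi>: "mono \<psi>" "\<And>q. 1 \<le> \<psi> q" "summable (\<lambda>q. 1 / (real q * \<psi> q))"
    and G: "\<And>j. 0 < G j" "G \<longlonglongrightarrow> 0" "filterlim (\<lambda>j. 2 ^ j * G j / \<psi> (2 ^ j)) at_top sequentially"
  shows "AE \<omega> in Unif. AE \<alpha> in lborel. \<forall>k\<ge>2. poissonian_corr k (\<lambda>n. \<alpha> * perturbed_seq G \<omega> n)"
proof -
  interpret U: prob_space Unif by (rule prob_space_Unif)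
  interpret P: pair_sigma_finite lborel Unif ..
  let ?Q = "\<lambda>k s \<alpha> \<omega>. 0 < \<alpha> \<longrightarrow> (\<lambda>j. real (corr_count k (\<lambda>n. \<alpha> * perturbed_seq G \<omega> n) s (j^2)) / real (j^2))
      \<longlonglongrightarrow> (\<Prod>i\<in>{1..k-1}. s (2*i) - s (2*i - 1))"
  have "AE \<omega> in Unif. AE \<alpha> in lborel. ?Q k s \<alpha> \<omega>" if "2 \<le> k" "admissible k s" for k s
  proof -
    have "AE \<alpha> in lborel. AE \<omega> in Unif. ?Q k s \<alpha> \<omega>"
      using AE_khinchin_type[OF \<psi>(2,3)]
    proof eventually_elim
      case (elim \<alpha>)
      show ?case
      proof (cases "0 < \<alpha>")
        case True
        interpret perturbed_rotation \<psi> G \<alpha> by unfold_locales (use \<psi> G True elim in auto)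
        show ?thesis using AE_corr_count_squares[of k s] that by auto
      qed simp
    qed
    then show ?thesis
      by (subst (asm) P.AE_commute) (rule measurable_corr_count_limit, assumption)
  qed
  then have "AE \<omega> in Unif. AE \<alpha> in lborel. 2 \<le> k \<and> admissible k (list_seq L) \<longrightarrow> ?Q k (list_seq L) \<alpha> \<omega>" for k L
    by (cases "2 \<le> k \<and> admissible k (list_seq L)") auto
  then have "AE \<omega> in Unif. \<forall>k L. AE \<alpha> in lborel. 2 \<le> k \<and> admissible k (list_seq L) \<longrightarrow> ?Q k (list_seq L) \<alpha> \<omega>"
    unfolding AE_all_countable by (intro allI)
  then show ?thesis
  proof eventually_elim
    case (elim \<omega>)
    then have "AE \<alpha> in lborel. \<forall>k L. 2 \<le> k \<and> admissible k (list_seq L) \<longrightarrow> ?Q k (list_seq L) \<alpha> \<omega>"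
      unfolding AE_all_countable .
    then have pos: "AE \<alpha> in lborel. 0 < \<alpha> \<longrightarrow> (\<forall>k\<ge>2. poissonian_corr k (\<lambda>n. \<alpha> * perturbed_seq G \<omega> n))"
    proof eventually_elim
      case (elim \<alpha>)
      then show ?case by (intro impI allI poissonian_corr_of_squares) blast
    qed
    \<comment> \<open>Lebesgue measure is invariant under negation, so the exceptional null set
      carries over to negative \<alpha>.\<close>
    then have "AE \<alpha> in distr lborel borel uminus. 0 < \<alpha> \<longrightarrow> (\<forall>k\<ge>2. poissonian_corr k (\<lambda>n. \<alpha> * perturbed_seq G \<omega> n))"
      by (simp only: lborel_distr_uminus)
    then have neg: "AE \<alpha> in lborel. 0 < - \<alpha> \<longrightarrow> (\<forall>k\<ge>2. poissonian_corr k (\<lambda>n. - \<alpha> * perturbed_seq G \<omega> n))"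
      by (rule AE_distrD[rotated]) measurable
    have "AE \<alpha> in lborel. \<alpha> \<noteq> (0::real)" by (rule AE_lborel_singleton)
    with pos neg show ?case
    proof eventually_elim
      case (elim \<alpha>)
      show ?case
      proof (cases "0 < \<alpha>")
        case False
        with elim(3) have "0 < - \<alpha>" by simp
        with elim(2) have "\<forall>k\<ge>2. poissonian_corr k (\<lambda>n. - \<alpha> * perturbed_seq G \<omega> n)" by blast
        then show ?thesis using poissonian_corr_uminus[of _ "\<lambda>n. - \<alpha> * perturbed_seq G \<omega> n"] by simp
      qed (use elim in blast)
    qed
  qed
qed

lemma AE_Unif_bounded: "AE \<omega> in Unif. \<forall>n. 0 \<le> \<omega> n \<and> \<omega> n \<le> 1"
proof -
  have "AE x in unif. 0 \<le> x \<and> x \<le> 1" by (rule AE_uniform_measureI) auto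
  then have "AE \<omega> in Unif. 0 \<le> \<omega> n \<and> \<omega> n \<le> 1" for n
    by (intro AE_PiM_component[where P = "\<lambda>x. 0 \<le> x \<and> x \<le> 1"]) (auto intro: prob_space_unif)
  then show ?thesis unfolding AE_all_countable by (intro allI)
qed

section \<open>Additive energy of a perturbed progression\<close>

lemma additive_energy_dyadic_block:
  assumes N: "8 * m \<le> N" and m: "0 < m"
    and x: "\<And>n. 4 * m \<le> n \<Longrightarrow> n < 8 * m \<Longrightarrow> 2 * real n \<le> x n \<and> x n \<le> 2 * real n + g" and g: "2 * g < \<gamma>"
  shows "m ^ 3 \<le> additive_energy x N \<gamma>"
proof -
  \<comment> \<open>For p, q, r < m the last index lies strictly between 4 m and 7 m, so the offset
    5 m keeps all four indices in one block and the subtraction on naturals exact. First plus second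
    index equals third plus fourth, which gives m ^ 3 quadruples.\<close>
  let ?f = "\<lambda>(p, q, r). (5 * m + p, 5 * m + q, 5 * m + r, 5 * m + p + q - r)"
  let ?S = "{(a, b, c, d). a \<in> {1..N} \<and> b \<in> {1..N} \<and> c \<in> {1..N} \<and> d \<in> {1..N} \<and> \<bar>x a + x b - x c - x d\<bar> < \<gamma>}"
  let ?D = "{..<m} \<times> {..<m} \<times> {..<m}"
  \<comment> \<open>Each of the two sums exceeds the common unperturbed value by an amount between 0
    and 2 g, so they differ by at most 2 g.\<close>
  have close: "\<bar>xa + xb - xc - xd\<bar> < \<gamma>" if "A \<le> xa" "xa \<le> A + g" "B \<le> xb" "xb \<le> B + g"
    "C \<le> xc" "xc \<le> C + g" "D \<le> xd" "xd \<le> D + g" "A + B = C + D" for A B C D xa xb xc xd :: real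
    using that g by linarith
  have "inj_on ?f ?D" by (auto simp: inj_on_def)
  moreover have "?f ` ?D \<subseteq> ?S"
  proof (clarify)
    fix p q r assume h: "p < m" "q < m" "r < m"
    let ?a = "5 * m + p" and ?b = "5 * m + q" and ?c = "5 * m + r" and ?d = "5 * m + p + q - r"
    have d: "real ?d = 5 * real m + real p + real q - real r" using h by (simp add: of_nat_diff)
    have "2 * real n \<le> x n \<and> x n \<le> 2 * real n + g" if "n \<in> {?a, ?b, ?c, ?d}" for n
      using that h by (intro x) auto
    then have "2 * real ?a \<le> x ?a" "x ?a \<le> 2 * real ?a + g" "2 * real ?b \<le> x ?b" "x ?b \<le> 2 * real ?b + g"
      "2 * real ?c \<le> x ?c" "x ?c \<le> 2 * real ?c + g" "2 * real ?d \<le> x ?d" "x ?d \<le> 2 * real ?d + g"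
      by blast+
    moreover have "2 * real ?a + 2 * real ?b = 2 * real ?c + 2 * real ?d" unfolding d by simp
    ultimately have "\<bar>x ?a + x ?b - x ?c - x ?d\<bar> < \<gamma>" by (rule close)
    then show "?a \<in> {1..N} \<and> ?b \<in> {1..N} \<and> ?c \<in> {1..N} \<and> ?d \<in> {1..N} \<and> \<bar>x ?a + x ?b - x ?c - x ?d\<bar> < \<gamma>"
      using h N by auto
  qed
  moreover have "finite ?S"
    by (rule finite_subset[of _ "{1..N} \<times> {1..N} \<times> {1..N} \<times> {1..N}"]) auto
  ultimately have "card ?D \<le> card ?S" by (rule card_inj_on_le)
  then show ?thesis unfolding additive_energy_def by (simp add: power3_eq_cube card_cartesian_product)
qed

lemma perturbed_energy:
  assumes \<omega>: "\<And>n. 0 \<le> \<omega> n \<and> \<omega> n \<le> 1" and G: "\<And>j. 0 < G j"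
    and \<gamma>: "\<forall>\<^sub>F j in sequentially. \<forall>N. 2 ^ Suc j \<le> N \<and> N < 2 ^ Suc (Suc j) \<longrightarrow> 2 * G j < \<gamma> N"
  shows "\<forall>\<^sub>F N in sequentially. 1 / 4096 * real N ^ 3 \<le> real (additive_energy (perturbed_seq G \<omega>) N (\<gamma> N))"
proof -
  obtain j0 where j0: "\<And>j N. j \<ge> j0 \<Longrightarrow> 2 ^ Suc j \<le> N \<Longrightarrow> N < 2 ^ Suc (Suc j) \<Longrightarrow> 2 * G j < \<gamma> N"
    using \<gamma> unfolding eventually_sequentially by blast
  have "\<forall>\<^sub>F N in sequentially. (2::nat) ^ (j0 + 3) \<le> N" by (rule eventually_ge_at_top)
  then show ?thesis
  proof eventually_elim
    case (elim N)
    have "j0 + 3 \<le> floor_log N" using floor_log_le_iff[OF elim] by simp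
    define i where "i = floor_log N - 3"
    have i: "floor_log N = i + 3" "j0 \<le> i" using \<open>j0 + 3 \<le> floor_log N\<close> by (simp_all add: i_def)
    have N0: "0 < N" by (rule less_le_trans[OF _ elim]) simp
    \<comment> \<open>N lies in [8 m, 16 m), and the block [4 m, 8 m) with perturbation size
      \<open>G (i + 2)\<close> lies below it. The constant 4096 is 16 cubed, from N < 16 m.\<close>
    define m where "m = (2::nat) ^ i"
    have N1: "8 * m \<le> N" "N < 16 * m"
      using floor_log_exp2_le[OF N0] floor_log_exp2_gt[of N] unfolding i m_def by (auto simp: power_add)
    have "2 * G (i + 2) < \<gamma> N" using N1 i by (intro j0) (auto simp: m_def)
    then have "m ^ 3 \<le> additive_energy (perturbed_seq G \<omega>) N (\<gamma> N)"
    proof (rule additive_energy_dyadic_block[OF N1(1), rotated 2])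
      fix n assume n: "4 * m \<le> n" "n < 8 * m"
      have "floor_log n = i + 2" using n by (intro floor_log_eqI) (auto simp: m_def)
      then show "2 * real n \<le> perturbed_seq G \<omega> n \<and> perturbed_seq G \<omega> n \<le> 2 * real n + G (i + 2)"
        using \<omega>[of n] G[of "i + 2"] by (simp add: perturbed_seq_def mult_left_le)
    qed (simp add: m_def)
    then have "real m ^ 3 \<le> real (additive_energy (perturbed_seq G \<omega>) N (\<gamma> N))"
      by (simp only: of_nat_power[symmetric] of_nat_le_iff)
    moreover have "real N ^ 3 \<le> (16 * real m) ^ 3" using N1 by (intro power_mono) auto
    moreover have "(16 * real m) ^ 3 = 4096 * real m ^ 3" by (simp add: power_mult_distrib)
    ultimately show ?case by linarith
  qed
qed

text \<open>The exponent lies strictly between the one of the Khinchin weight, \<open>1 + c / 3\<close>, and the one of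
  \<open>gammaN\<close>, \<open>1 + c\<close>; both gaps are needed.\<close>

definition perturb_scale :: "real \<Rightarrow> nat \<Rightarrow> real" where
  "perturb_scale c j = min (1/2) (loglog_weight (1 + 2 * c / 3) (2 ^ j) / 2 ^ j)"

section \<open>Asymptotics of the perturbation size\<close>

lemma perturb_scale_bounds:
  assumes "c > 0"
  shows "0 < perturb_scale c j" "perturb_scale c j \<le> 1/2" "perturb_scale c j \<le> loglog_weight (1 + 2 * c / 3) (2 ^ j) / 2 ^ j"
proof -
  have "1 \<le> loglog_weight (1 + 2 * c / 3) (2 ^ j)" using assms by (intro loglog_weight_ge_1) auto
  then show "0 < perturb_scale c j" by (simp add: perturb_scale_def)
qed (unfold perturb_scale_def, rule min.cobounded1, rule min.cobounded2)

lemma perturb_scale_raw_tendsto: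
  assumes "c > 0"
  shows "(\<lambda>j. loglog_weight (1 + 2 * c / 3) (2 ^ j) / 2 ^ j) \<longlonglongrightarrow> 0"
proof -
  have "((\<lambda>t::real. ln (t + exp (exp 1)) * ln (ln (t + exp (exp 1))) powr (1 + 2 * c / 3) / t) \<longlongrightarrow> 0) at_top"
    using assms by real_asymp
  moreover have "filterlim (\<lambda>j::nat. (2::real) ^ j) at_top sequentially" by real_asymp
  ultimately have "(\<lambda>j::nat. ln (2 ^ j + exp (exp 1)) * ln (ln (2 ^ j + exp (exp 1))) powr (1 + 2 * c / 3) / 2 ^ j) \<longlonglongrightarrow> (0::real)"
    by (rule filterlim_compose)
  then show ?thesis by (simp add: loglog_weight_def)
qed

lemma perturb_scale_tendsto:
  assumes "c > 0"
  shows "perturb_scale c \<longlonglongrightarrow> 0"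
proof -
  have "(\<lambda>j. min (1/2) (loglog_weight (1 + 2 * c / 3) (2 ^ j) / 2 ^ j)) \<longlonglongrightarrow> min (1/2) 0"
    by (intro tendsto_min tendsto_const perturb_scale_raw_tendsto assms)
  then show ?thesis by (simp add: perturb_scale_def[abs_def])
qed

lemma loglog_weight_split:
  "loglog_weight (a + b) q = loglog_weight a q * ln (ln (real q + exp (exp 1))) powr b"
  by (simp add: loglog_weight_def powr_add)

lemma filterlim_loglog_powr:
  assumes "a > 0"
  shows "filterlim (\<lambda>j::nat. ln (ln (2 ^ j + exp (exp 1) :: real)) powr a) at_top sequentially"
proof -
  have "filterlim (\<lambda>t::real. ln (ln (t + exp (exp 1))) powr a) at_top at_top" using assms by real_asymp
  moreover have "filterlim (\<lambda>j::nat. (2::real) ^ j) at_top sequentially" by real_asymp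
  ultimately show ?thesis by (rule filterlim_compose)
qed

text \<open>Once the cap 1/2 is inactive, the ratio is exactly the surplus factor between the
  exponents 1 + 2 c / 3 and 1 + c / 3, an unbounded power of the iterated logarithm.\<close>

lemma perturb_scale_large:
  assumes "c > 0"
  shows "filterlim (\<lambda>j. 2 ^ j * perturb_scale c j / loglog_weight (1 + c / 3) (2 ^ j)) at_top sequentially"
proof -
  have "\<forall>\<^sub>F j in sequentially. loglog_weight (1 + 2 * c / 3) (2 ^ j) / 2 ^ j < 1/2"
    using order_tendstoD(2)[OF perturb_scale_raw_tendsto[OF assms], of "1/2"] by simp
  then have "\<forall>\<^sub>F j in sequentially. ln (ln (2 ^ j + exp (exp 1))) powr (c / 3) = 2 ^ j * perturb_scale c j / loglog_weight (1 + c / 3) (2 ^ j)"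
  proof eventually_elim
    case (elim j)
    then have "2 ^ j * perturb_scale c j = loglog_weight (1 + 2 * c / 3) (2 ^ j)" by (simp add: perturb_scale_def)
    also have "1 + 2 * c / 3 = (1 + c / 3) + c / 3" by simp
    finally have "2 ^ j * perturb_scale c j = loglog_weight (1 + c / 3) (2 ^ j) * ln (ln (2 ^ j + exp (exp 1))) powr (c / 3)"
      using loglog_weight_split[of "1 + c / 3" "c / 3" "2 ^ j"] by simp
    moreover have "1 \<le> loglog_weight (1 + c / 3) (2 ^ j)" using assms by (intro loglog_weight_ge_1) auto
    ultimately show ?case by simp
  qed
  then show ?thesis using filterlim_loglog_powr[of "c / 3"] assms by (simp add: filterlim_cong)
qed

lemma perturb_scale_below_gammaN:
  assumes c: "c > 0"
  shows "\<forall>\<^sub>F j in sequentially. \<forall>N. 2 ^ Suc j \<le> N \<and> N < 2 ^ Suc (Suc j) \<longrightarrow> 2 * perturb_scale c j < gammaN c N"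
proof -
  \<comment> \<open>The 8 combines the factor 2 in front of the scale with the factor 4 from N < 4 *
    2 ^ j. The surplus power c / 3 of the iterated logarithm eventually beats it.\<close>
  have "\<forall>\<^sub>F j in sequentially. 8 < ln (ln (2 ^ j + exp (exp 1) :: real)) powr (c / 3)"
    using filterlim_loglog_powr[of "c / 3"] c by (simp add: filterlim_at_top_dense)
  \<comment> \<open>This absorbs the shift in the weight: 2 ^ j plus the shift is at most 2 * 2 ^ j,
    hence at most N.\<close>
  moreover have "\<forall>\<^sub>F j::nat in sequentially. exp (exp 1) \<le> (2::real) ^ j" by real_asymp
  ultimately show ?thesis
  proof eventually_elim
    case (elim j)
    show ?case
    proof (intro allI impI)
      fix N :: nat assume N: "2 ^ Suc j \<le> N \<and> N < 2 ^ Suc (Suc j)"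
      define t where "t = (2::real) ^ j"
      define A where "A = ln (t + exp (exp 1))"
      have t0: "0 < t" by (simp add: t_def)
      have "real (2 ^ Suc j) \<le> real N" "real N < real (2 ^ Suc (Suc j))" using N by (auto simp only: of_nat_le_iff of_nat_less_iff)
      then have N1: "2 * t \<le> real N" "real N < 4 * t" by (simp_all add: t_def)
      then have N2: "t + exp (exp 1) \<le> real N" using elim(2) by (simp add: t_def)
      have A: "exp 1 \<le> A" "1 \<le> ln A" using ln_shift_ge[of t] t0 by (simp_all add: A_def)
      have A0: "0 < A" using A(1) exp_gt_zero[of "1::real"] by linarith
      have N0: "0 < real N" using N1 t0 by linarith
      have AN: "A \<le> ln (real N)" unfolding A_def using N2 N0 t0 by (subst ln_le_cancel_iff) (auto intro: add_pos_pos)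
      then have AN2: "ln A \<le> ln (ln (real N))" using A0 by (subst ln_le_cancel_iff) auto
      have P: "8 < ln A powr (c / 3)" using elim(1) by (simp add: A_def t_def)
      have "0 < ln A" using A(2) by linarith
      then have W: "0 < A * ln A powr (1 + 2 * c / 3)" by (intro mult_pos_pos A0) (simp only: powr_gt_zero)
      have w: "loglog_weight (1 + 2 * c / 3) (2 ^ j) = A * ln A powr (1 + 2 * c / 3)"
        by (simp add: loglog_weight_def A_def t_def)
      have "2 * perturb_scale c j \<le> 2 * (A * ln A powr (1 + 2 * c / 3) / t)"
        using perturb_scale_bounds(3)[OF c, of j] by (simp add: w t_def)
      also have "\<dots> = 8 * (A * ln A powr (1 + 2 * c / 3)) / (4 * t)" by simp
      also have "\<dots> < (ln A powr (c / 3) * (A * ln A powr (1 + 2 * c / 3))) / (4 * t)"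
        by (intro divide_strict_right_mono mult_strict_right_mono P W) (use t0 in simp)
      also have "\<dots> = A * ln A powr (1 + c) / (4 * t)"
        by (simp add: powr_add[symmetric] mult.left_commute add.commute)
      also have "\<dots> \<le> ln (real N) * ln (ln (real N)) powr (1 + c) / real N"
      proof (intro frac_le mult_mono powr_mono2 AN AN2)
        show "0 \<le> ln A" using A(2) by linarith
        show "0 \<le> ln (real N)" using AN A0 by linarith
        then show "0 \<le> ln (real N) * ln (ln (real N)) powr (1 + c)" by simp
      qed (use c N0 N1 in auto)
      finally show "2 * perturb_scale c j < gammaN c N" by (simp add: gammaN_def)
    qed
  qed
qed

theorem theorem4:
  fixes c :: real
  assumes "c > 0"
  shows "\<exists>x :: nat \<Rightarrow> real.
           (\<forall>n\<ge>1. x n < x (Suc n) \<and> x (Suc n) - x n \<ge> 1)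
         \<and> (\<exists>C>0. \<forall>\<^sub>F N in sequentially.
                real (additive_energy x N (gammaN c N)) \<ge> C * real N ^ 3)
         \<and> (AE \<alpha> in lborel. \<forall>k\<ge>2. poissonian_corr k (\<lambda>n. \<alpha> * x n))"
proof -
  interpret U: prob_space Unif by (rule prob_space_Unif)
  have "AE \<omega> in Unif. AE \<alpha> in lborel. \<forall>k\<ge>2. poissonian_corr k (\<lambda>n. \<alpha> * perturbed_seq (perturb_scale c) \<omega> n)"
  proof (rule AE_perturbed_poissonian)
    show "mono (loglog_weight (1 + c / 3))" using assms by (intro mono_loglog_weight) auto
    show "1 \<le> loglog_weight (1 + c / 3) q" for q using assms by (intro loglog_weight_ge_1) auto
    show "summable (\<lambda>q. 1 / (real q * loglog_weight (1 + c / 3) q))"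
      using assms by (intro summable_inverse_loglog_weight) auto
  qed (use assms perturb_scale_bounds perturb_scale_tendsto perturb_scale_large in auto)
  with AE_Unif_bounded have "AE \<omega> in Unif. (\<forall>n. 0 \<le> \<omega> n \<and> \<omega> n \<le> 1) \<and>
      (AE \<alpha> in lborel. \<forall>k\<ge>2. poissonian_corr k (\<lambda>n. \<alpha> * perturbed_seq (perturb_scale c) \<omega> n))"
    by eventually_elim blast
  \<comment> \<open>A property that holds almost surely under a probability measure has a witness;
    this fixes one deterministic sequence.\<close>
  moreover have "ae_filter Unif \<noteq> bot" using U.emeasure_space_1 by (simp add: Measure_Space.ae_filter_eq_bot_iff)
  ultimately obtain \<omega> where \<omega>: "\<And>n. 0 \<le> \<omega> n \<and> \<omega> n \<le> 1"
    and poisson: "AE \<alpha> in lborel. \<forall>k\<ge>2. poissonian_corr k (\<lambda>n. \<alpha> * perturbed_seq (perturb_scale c) \<omega> n)"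
    using eventually_happens' by blast
  let ?x = "perturbed_seq (perturb_scale c) \<omega>"
  have pert: "0 \<le> perturb_scale c (floor_log n) * \<omega> n \<and> perturb_scale c (floor_log n) * \<omega> n \<le> 1/2" for n
  proof -
    have "perturb_scale c (floor_log n) * \<omega> n \<le> 1/2 * 1"
      using perturb_scale_bounds(1,2)[OF assms, of "floor_log n"] \<omega>[of n] by (intro mult_mono) auto
    then show ?thesis using perturb_scale_bounds(1)[OF assms, of "floor_log n"] \<omega>[of n] by simp
  qed
  \<comment> \<open>The slope contributes 2, and by the cap in \<open>perturb_scale\<close> the
    perturbations take away at most 1/2.\<close>
  have gap: "?x (Suc n) - ?x n \<ge> 1" for n
    using pert[of n] pert[of "Suc n"] unfolding perturbed_seq_def by simp
  have "\<forall>n\<ge>1. ?x n < ?x (Suc n) \<and> ?x (Suc n) - ?x n \<ge> 1"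
  proof (intro allI impI conjI)
    fix n show "?x n < ?x (Suc n)" using gap[of n] by linarith
  qed (rule gap)
  moreover have "\<forall>\<^sub>F N in sequentially. 1 / 4096 * real N ^ 3 \<le> real (additive_energy ?x N (gammaN c N))"
    by (rule perturbed_energy[OF \<omega> perturb_scale_bounds(1)[OF assms] perturb_scale_below_gammaN[OF assms]])
  then have "\<exists>C>0. \<forall>\<^sub>F N in sequentially. real (additive_energy ?x N (gammaN c N)) \<ge> C * real N ^ 3"
    by (intro exI[of _ "1 / 4096"]) simp
  ultimately show ?thesis using poisson by blast
qed

end
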